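(* Assume $1 \leq p < \infty$ and $m \in \mathbb{N}$, and let $\frac1p+\frac1q=1$. Take $\phi \in L^q(\mathbb{R}^d)$ with $P|\phi| \in L^\infty(\mathbb{R}^d)$ and $\int_{\mathbb{R}^d} \phi \, dx = 1$, and assume $b=I$. Then for all $f\in W^{m,p}(\mathbb{R}^d)$, $$\| f \|_{W^{m,p}} \approx \| Tf \|_{\ell^\infty(w^{m,p},\alpha)} = \sup_{j > 0} \sum_{|\rho|\leq m} |\alpha_j|^{|\rho|} \| \Delta^\rho T_j f \|_{\ell^p} = \sup_{j > 0} \sum_{|\rho|\leq m} |\alpha_j|^{|\rho|} \| \{\Delta^\rho \langle f,\phi_{j,k}\rangle\}_{k\in\mathbb{Z}^d} \|_{\ell^p} ,$$ i.e. the norms $\|f\|_{W^{m,p}}$ and $\|Tf\|_{\ell^\infty(w^{m,p},\alpha)}$ are each bounded by a positive constant, independent of $f$, times the other.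
   Context: Fix $d\in\mathbb{N}$. The dilation matrices are isotropic and expanding: $a_j=\alpha_j I$ ($j=1,2,3,\ldots$), where $\alpha_j$ are nonzero real numbers with $|\alpha_j|\to\infty$ as $j\to\infty$. The translation matrix is $b=I$. Functions are complex-valued; $j>0$ means $j=1,2,3,\ldots$; $1/\infty=0$. For $\phi\in L^q$, $\phi_{j,k}(x)=|\det a_j|^{1/q}\phi(a_jx-k)$ for $k\in\mathbb{Z}^d$, and $\langle f,\phi_{j,k}\rangle=\int_{\mathbb{R}^d}f\,\overline{\phi_{j,k}}\,dx$. The analysis operator at scale $j$ is $T_jf=\{\langle f,\phi_{j,k}\rangle\}_{k\in\mathbb{Z}^d}$, and $Tf=\{\langle f,\phi_{j,k}\rangle\}_{j>0,k\in\mathbb{Z}^d}$. The periodization is $Pf(x)=\sum_{k\in\mathbb{Z}^d}f(x-k)$. $W^{m,p}=W^{m,p}(\mathbb{R}^d)$ is the Sobolev space of functions with $m$ derivatives in $L^p$, normed by $\|f\|_{W^{m,p}}=\sum_{|\rho|\le m}\|D^\rho f\|_p$ ($\rho$ multiindices). For sequences $s=\{s_k\}_{k\in\mathbb{Z}^d}$, $\Delta_ts=\{s_k-s_{k-e_t}\}_{k\in\mathbb{Z}^d}$, $t=1,\ldots,d$, with $e_t$ the $t$-th coordinate unit vector, and $\Delta^\rho=\Delta_1^{\rho_1}\cdots\Delta_d^{\rho_d}$ (acting on the $k$-index). *)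

theory Defs
  imports "HOL-Probability.Essential_Supremum"
begin

section \<open>Lebesgue spaces\<close>

definition epowr :: "ennreal \<Rightarrow> real \<Rightarrow> ennreal" where
  "epowr x r = (if x = \<infinity> then \<infinity> else ennreal (enn2real x powr r))"

text \<open>The intended exponents are \<open>1 \<le> p \<le> \<infinity>\<close>. The norm is extended-valued, so that \<open>\<infinity>\<close> means
  that the function is not in \<open>L\<^sup>p\<close>. For the counting measure this is the \<open>\<ell>\<^sup>p\<close> norm.\<close>

definition Lnorm :: "'a measure \<Rightarrow> ennreal \<Rightarrow> ('a \<Rightarrow> ennreal) \<Rightarrow> ennreal" where
  "Lnorm M p h =
     (if p = \<infinity> then esssup M h
      else epowr (\<integral>\<^sup>+ x. epowr (h x) (enn2real p) \<partial>M) (1 / enn2real p))"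

abbreviation emod :: "('a \<Rightarrow> complex) \<Rightarrow> 'a \<Rightarrow> ennreal" where
  "emod f \<equiv> \<lambda>x. ennreal (norm (f x))"

definition Lp_norm :: "ennreal \<Rightarrow> (real^'d \<Rightarrow> complex) \<Rightarrow> ennreal" where
  "Lp_norm p f = Lnorm lebesgue p (emod f)"

definition Lp_space :: "ennreal \<Rightarrow> (real^'d \<Rightarrow> complex) set" where
  "Lp_space p = {f. f \<in> borel_measurable lebesgue \<and> Lp_norm p f < \<infinity>}"

definition lp_norm :: "ennreal \<Rightarrow> ('k \<Rightarrow> complex) \<Rightarrow> ennreal" where
  "lp_norm p s = Lnorm (count_space UNIV) p (emod s)"


section \<open>Multiindices\<close>

text \<open>The coordinates of \<open>real^'d\<close> are indexed by an arbitrary finite type, so an enumeration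
  \<open>t\<^sub>1, \<dots>, t\<^sub>d\<close> of it is chosen. It is irrelevant which one, because \<open>mpower\<close> below is only applied to
  commuting operators (finite differences, and partial derivatives of smooth functions).\<close>

definition coords :: "'d::finite list" where
  "coords = (SOME ts. distinct ts \<and> set ts = UNIV)"

definition mpower :: "('d::finite \<Rightarrow> 'a \<Rightarrow> 'a) \<Rightarrow> nat^'d \<Rightarrow> 'a \<Rightarrow> 'a" where
  "mpower A \<rho> = foldr (\<lambda>t. A t ^^ (\<rho> $ t)) coords"

definition mdeg :: "nat^'d \<Rightarrow> nat" where
  "mdeg \<rho> = (\<Sum>t\<in>UNIV. \<rho> $ t)"

lemma coords: "distinct (coords :: 'd::finite list)" "set (coords :: 'd list) = UNIV"
proof -
  have "\<exists>ts :: 'd list. distinct ts \<and> set ts = UNIV"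
    using finite_distinct_list[of "UNIV :: 'd set"] by auto
  then have "distinct (coords :: 'd list) \<and> set (coords :: 'd list) = UNIV"
    unfolding coords_def by (rule someI_ex)
  then show "distinct (coords :: 'd list)" "set (coords :: 'd list) = UNIV" by auto
qed

lemma finite_mdeg_le: "finite {\<rho> :: nat^'d. mdeg \<rho> \<le> m}"
proof (rule finite_subset)
  show "{\<rho> :: nat^'d. mdeg \<rho> \<le> m} \<subseteq> vec_lambda ` (UNIV \<rightarrow>\<^sub>E {..m})"
  proof
    fix \<rho> :: "nat^'d" assume "\<rho> \<in> {\<rho>. mdeg \<rho> \<le> m}"
    then have m: "(\<Sum>t\<in>UNIV. \<rho> $ t) \<le> m" by (simp add: mdeg_def)
    have "\<rho> $ t \<le> m" for t
      using member_le_sum[of t UNIV "\<lambda>t. \<rho> $ t"] m by simp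
    then have "vec_nth \<rho> \<in> UNIV \<rightarrow>\<^sub>E {..m}" by auto
    then show "\<rho> \<in> vec_lambda ` (UNIV \<rightarrow>\<^sub>E {..m})"
      by (metis image_eqI vec_nth_inverse)
  qed
qed (auto intro!: finite_imageI finite_PiE)


section \<open>Weak derivatives and Sobolev spaces\<close>

definition partial :: "'d::finite \<Rightarrow> (real^'d \<Rightarrow> complex) \<Rightarrow> real^'d \<Rightarrow> complex" where
  "partial t g = (\<lambda>x. frechet_derivative g (at x) (axis t 1))"

text \<open>All iterated partial derivatives are differentiable, hence continuous: this is \<open>C\<^sup>\<infinity>\<close>.\<close>

definition smooth :: "(real^'d \<Rightarrow> complex) \<Rightarrow> bool" where
  "smooth g \<longleftrightarrow> (\<forall>ts. foldr partial ts g differentiable_on UNIV)"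

definition test_function :: "(real^'d \<Rightarrow> complex) \<Rightarrow> bool" where
  "test_function \<psi> \<longleftrightarrow> smooth \<psi> \<and> compact (closure {x. \<psi> x \<noteq> 0})"

definition locally_integrable :: "(real^'d \<Rightarrow> complex) \<Rightarrow> bool" where
  "locally_integrable f \<longleftrightarrow> (\<forall>K. compact K \<longrightarrow> f absolutely_integrable_on K)"

definition is_weak_deriv ::
  "nat^'d \<Rightarrow> (real^'d \<Rightarrow> complex) \<Rightarrow> (real^'d \<Rightarrow> complex) \<Rightarrow> bool" where
  "is_weak_deriv \<rho> f g \<longleftrightarrow> locally_integrable f \<and> locally_integrable g \<and>
     (\<forall>\<psi>. test_function \<psi> \<longrightarrow>
        (LINT x|lebesgue. f x * mpower partial \<rho> \<psi> x) =
        (-1) ^ mdeg \<rho> * (LINT x|lebesgue. g x * \<psi> x))"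

text \<open>Weak derivatives are unique up to null sets, so the choice does not affect the norm.\<close>

definition weak_deriv :: "nat^'d \<Rightarrow> (real^'d \<Rightarrow> complex) \<Rightarrow> real^'d \<Rightarrow> complex" where
  "weak_deriv \<rho> f = (SOME g. is_weak_deriv \<rho> f g)"

definition Sobolev_space :: "nat \<Rightarrow> ennreal \<Rightarrow> (real^'d \<Rightarrow> complex) set" where
  "Sobolev_space m p =
     {f \<in> Lp_space p. \<forall>\<rho>. mdeg \<rho> \<le> m \<longrightarrow> (\<exists>g \<in> Lp_space p. is_weak_deriv \<rho> f g)}"

definition Sobolev_norm :: "nat \<Rightarrow> ennreal \<Rightarrow> (real^'d \<Rightarrow> complex) \<Rightarrow> ennreal" where
  "Sobolev_norm m p f = (\<Sum>\<rho> | mdeg \<rho> \<le> m. Lp_norm p (weak_deriv \<rho> f))"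


section \<open>Affine systems and the analysis operator\<close>

definition lat :: "int^'d \<Rightarrow> real^'d" where
  "lat k = (\<chi> t. of_int (k $ t))"

definition periodization ::
  "(real^'d \<Rightarrow> 'a::{comm_monoid_add, t2_space}) \<Rightarrow> real^'d \<Rightarrow> 'a" where
  "periodization f x = (\<Sum>\<^sub>\<infinity>k. f (x - lat k))"

definition affine ::
  "ennreal \<Rightarrow> (nat \<Rightarrow> real^'d^'d) \<Rightarrow> (real^'d \<Rightarrow> complex) \<Rightarrow> nat \<Rightarrow> int^'d \<Rightarrow> real^'d \<Rightarrow> complex" where
  "affine q a \<phi> j k x =
     of_real (\<bar>det (a j)\<bar> powr enn2real (1 / q)) * \<phi> (a j *v x - lat k)"

definition pairing :: "(real^'d \<Rightarrow> complex) \<Rightarrow> (real^'d \<Rightarrow> complex) \<Rightarrow> complex" where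
  "pairing f g = (LINT x|lebesgue. f x * cnj (g x))"

definition analysis ::
  "ennreal \<Rightarrow> (nat \<Rightarrow> real^'d^'d) \<Rightarrow> (real^'d \<Rightarrow> complex) \<Rightarrow>
     (real^'d \<Rightarrow> complex) \<Rightarrow> nat \<Rightarrow> int^'d \<Rightarrow> complex" where
  "analysis q a \<phi> f j k = pairing f (affine q a \<phi> j k)"

definition diff :: "'d::finite \<Rightarrow> (int^'d \<Rightarrow> complex) \<Rightarrow> int^'d \<Rightarrow> complex" where
  "diff t s = (\<lambda>k. s k - s (k - axis t 1))"

lemma diff_commute: "diff t \<circ> diff u = diff u \<circ> diff t"
  by (simp add: fun_eq_iff diff_def algebra_simps)

text \<open>The norm of \<open>\<ell>\<^sup>\<infinity>(w\<^sup>m\<^sup>,\<^sup>p, \<alpha>)\<close>; the scales are \<open>j = 1, 2, 3, \<dots>\<close>.\<close>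

definition linf_w_norm ::
  "nat \<Rightarrow> ennreal \<Rightarrow> (nat \<Rightarrow> real) \<Rightarrow> (nat \<Rightarrow> int^'d \<Rightarrow> complex) \<Rightarrow> ennreal" where
  "linf_w_norm m p \<alpha> s =
     (SUP j\<in>{0<..}. \<Sum>\<rho> | mdeg \<rho> \<le> m.
        ennreal (\<bar>\<alpha> j\<bar> ^ mdeg \<rho>) * lp_norm p (mpower diff \<rho> (s j)))"

end

theory Submission
  imports Defs "HOL-Computational_Algebra.Polynomial" "HOL-Probability.Probability_Measure"
begin

text \<open>A difference in the index \<open>k\<close> of \<open>\<langle>f, \<phi>\<^sub>j\<^sub>,\<^sub>k\<rangle>\<close> is a difference of \<open>f\<close> with step \<open>1 / \<alpha>\<^sub>j\<close>,
  that is, the average of a derivative of \<open>f\<close> over a segment. Moving the average onto the kernel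
  gives \<open>\<alpha>\<^sub>j\<^sup>|\<^sup>\<rho>\<^sup>| \<Delta>\<^sup>\<rho> T\<^sub>j f = T'\<^sub>j (D\<^sup>\<rho> f)\<close>, where \<open>T'\<^sub>j\<close> is formed with the convolution \<open>\<Phi>\<close> of \<open>\<phi>\<close> and a
  B-spline. This \<open>\<Phi>\<close> again has integral 1 and a bounded periodization of \<open>|\<Phi>|\<close>, so only the case
  \<open>m = 0\<close> is left. There the upper bound is the power mean inequality with respect to the weight
  \<open>|\<Phi>|\<close>. For the lower bound let \<open>f\<close> be bounded and continuous: the step functions with values
  \<open>|\<alpha>\<^sub>j|\<^sup>d\<^sup>/\<^sup>p T'\<^sub>j f (k)\<close> on the cubes \<open>(k + [0,1)\<^sup>d) / \<alpha>\<^sub>j\<close> converge pointwise to \<open>f\<close>, and Fatou's lemma applies.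
  The general case follows by density, since the \<open>T'\<^sub>j\<close> are uniformly bounded.\<close>

section \<open>Smooth bump functions\<close>

text \<open>The averaging identity must hold for weak derivatives, which are known only through
  smooth test functions. There is no mollification: the identity is tested against tensor products
  of one-variable functions, and the average is moved onto the test function. Averaging such a
  product along a coordinate axis averages one factor and leaves a smooth product, whose partial
  derivative is a difference quotient of the original product. The products must also determine a
  function almost everywhere; explicit bumps on arbitrary intervals serve this purpose, as they
  approximate indicator functions of boxes.

  Averages over a probability measure increase neither the L^1 norm nor the bound on the
  periodization, so a single \<open>B\<close> serves all multiindices, and it is the constant of the
  upper bound. In the lower bound the inequality (x + y)^p <= 2^p (x^p + y^p) is used twice, to pass
  from \<open>f\<close> to continuous functions and back, whence a factor 4; the sum over
  multiindices multiplies it by their number.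

  The numbers \<alpha>_j may be negative, so steps and segments can have either orientation.\<close>

text \<open>\<open>R = 1\<close> and \<open>k = 0\<close> give the classical bump. The polynomial
  and the power of the denominator make the family closed under differentiation, and
  \<open>c\<close> stays free because c -> 0 turns the classical bump into the indicator function of
  the open interval.\<close>

definition bump1 :: "real \<Rightarrow> real \<Rightarrow> real \<Rightarrow> real poly \<Rightarrow> nat \<Rightarrow> real \<Rightarrow> real" where
  "bump1 c a b R k x =
     (if a < x \<and> x < b
      then poly R x / ((x - a) * (b - x)) ^ k * exp (- c / ((x - a) * (b - x))) else 0)"

text \<open>A single term of the exponential series at \<open>c / w\<close> is at most exp (c / w).
  As \<open>n\<close> is free, the exponential beats every power of \<open>w\<close> in a
  denominator.\<close>

lemma exp_inverse_le:
  fixes c w :: real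
  assumes "c > 0" "w > 0"
  shows "exp (- c / w) \<le> fact n / c ^ n * w ^ n"
proof -
  have "(c / w) ^ n / fact n \<le> (\<Sum>i<Suc n. (c / w) ^ i / fact i)"
    by (rule member_le_sum) (use assms in auto)
  also have "\<dots> \<le> exp (c / w)"
  proof -
    have "(\<lambda>i. (c / w) ^ i / fact i) sums exp (c / w)"
      using exp_converges[of "c / w"] by (simp add: divide_inverse mult.commute)
    then show ?thesis
      by (metis (no_types, lifting) assms divide_nonneg_nonneg fact_ge_zero finite_lessThan less_imp_le
          sum_le_suminf sums_iff zero_le_power)
  qed
  finally have "(c / w) ^ n / fact n \<le> exp (c / w)" .
  then have "inverse (exp (c / w)) \<le> inverse ((c / w) ^ n / fact n)"
    by (intro le_imp_inverse_le) (use assms in auto)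
  then show ?thesis
    using assms by (simp add: exp_minus field_simps)
qed

text \<open>Of the k + 2 powers of (x - a) (b - x) supplied by \<open>exp_inverse_le\<close>, k
  cancel the denominator. The two that remain express vanishing of second order at both end points,
  which forces the derivative 0 there.\<close>

lemma bump1_bound:
  assumes "c > 0"
  obtains K where "K \<ge> 0" "\<And>x. \<bar>bump1 c a b R k x\<bar> \<le> K * ((x - a) * (b - x))\<^sup>2"
proof -
  have "bounded (poly R ` {a..b})"
    by (intro compact_imp_bounded compact_continuous_image continuous_intros) simp
  then obtain K where K: "\<And>x. x \<in> {a..b} \<Longrightarrow> \<bar>poly R x\<bar> \<le> K"
    by (force simp: bounded_iff)
  define L where "L = \<bar>K\<bar> * (fact (k + 2) / c ^ (k + 2))"
  have "\<bar>bump1 c a b R k x\<bar> \<le> L * ((x - a) * (b - x))\<^sup>2" for x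
  proof (cases "a < x \<and> x < b")
    case True
    define w where "w = (x - a) * (b - x)"
    have w: "w > 0" using True by (simp add: w_def)
    have "\<bar>bump1 c a b R k x\<bar> = \<bar>poly R x\<bar> / w ^ k * exp (- c / w)"
      using True w by (simp add: bump1_def w_def[symmetric] abs_mult)
    also have "\<dots> \<le> \<bar>K\<bar> / w ^ k * (fact (k + 2) / c ^ (k + 2) * w ^ (k + 2))"
      using K[of x] True w assms exp_inverse_le[OF assms w, of "k + 2"]
      by (intro mult_mono divide_right_mono) auto
    also have "\<dots> = L * w\<^sup>2"
      using w assms by (simp add: L_def power_add power2_eq_square)
    finally show ?thesis by (simp add: w_def)
  qed (use assms in \<open>auto simp: bump1_def L_def\<close>)
  then show thesis
    using that[of L] assms by (simp add: L_def)
qed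

text \<open>Differentiating w^(-k) costs one more power of w and differentiating exp (- c / w) costs
  two, hence the common denominator w^(k + 2). The delicate points are \<open>a\<close> and
  \<open>b\<close>, where the two sides are given by different formulas.\<close>

lemma DERIV_bump1:
  assumes "c > 0" "a < b"
  defines "w \<equiv> [:-a, 1:] * [:b, -1:]"
  shows "(bump1 c a b R k has_real_derivative
           bump1 c a b (pderiv R * w\<^sup>2 - of_nat k * R * pderiv w * w + smult c (R * pderiv w)) (k + 2) x) (at x)"
    (is "(_ has_real_derivative bump1 c a b ?R' _ x) _")
proof -
  have w: "poly w y = (y - a) * (b - y)" for y by (simp add: w_def algebra_simps)
  consider "a < x \<and> x < b" | "x \<notin> {a..b}" | "x = a \<or> x = b" by fastforce
  then show ?thesis
  proof cases
    case 1
    then have pos: "poly w x > 0" by (simp add: w)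
    let ?w = "poly w x" and ?w' = "poly (pderiv w) x"
    have Dk: "((\<lambda>x. inverse (poly w x) ^ k) has_real_derivative
        - (of_nat k * inverse ?w ^ (k + 1) * ?w')) (at x)"
    proof (induction k)
      case (Suc k)
      have "((\<lambda>x. inverse (poly w x)) has_real_derivative - (?w' * (inverse ?w)\<^sup>2)) (at x)"
        by (rule DERIV_inverse_fun[OF poly_DERIV, THEN DERIV_cong]) (use pos in \<open>auto simp: power2_eq_square\<close>)
      from DERIV_mult[OF this Suc] show ?case
        unfolding power_Suc by (rule DERIV_cong) (simp add: algebra_simps power2_eq_square)
    qed simp
    have "((\<lambda>x. poly R x * inverse (poly w x) ^ k * exp (- c * inverse (poly w x))) has_real_derivative
        (poly (pderiv R) x * inverse ?w ^ k - poly R x * (of_nat k * inverse ?w ^ (k + 1) * ?w')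
           + c * poly R x * ?w' * inverse ?w ^ (k + 2)) * exp (- c * inverse ?w)) (at x)"
      by (rule derivative_eq_intros poly_DERIV Dk refl | use pos in \<open>simp; fail\<close>)+
         (simp add: algebra_simps power2_eq_square)
    also have "(poly (pderiv R) x * inverse ?w ^ k - poly R x * (of_nat k * inverse ?w ^ (k + 1) * ?w')
           + c * poly R x * ?w' * inverse ?w ^ (k + 2)) * exp (- c * inverse ?w) = bump1 c a b ?R' (k + 2) x"
    proof -
      have "bump1 c a b ?R' (k + 2) x = poly ?R' x / ?w ^ (k + 2) * exp (- c / ?w)"
        using 1 by (simp add: bump1_def w)
      then show ?thesis
        using pos by (simp add: field_simps power2_eq_square)
    qed
    also have "(\<lambda>x. poly R x * inverse (poly w x) ^ k * exp (- c * inverse (poly w x))) =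
        (\<lambda>x. poly R x / poly w x ^ k * exp (- c / poly w x))"
      by (simp add: divide_inverse power_inverse)
    finally have D: "((\<lambda>x. poly R x / poly w x ^ k * exp (- c / poly w x)) has_real_derivative
        bump1 c a b ?R' (k + 2) x) (at x)" .
    have "eventually (\<lambda>y. y \<in> {a<..<b}) (nhds x)"
      by (rule eventually_nhds_in_open) (use 1 in auto)
    then have "eventually (\<lambda>y. poly R y / poly w y ^ k * exp (- c / poly w y) = bump1 c a b R k y) (nhds x)"
      by eventually_elim (simp add: bump1_def w)
    then show ?thesis using D by (subst (asm) DERIV_cong_ev[OF refl _ refl])
  next
    case 2
    have "eventually (\<lambda>y. y \<in> - {a..b}) (nhds x)"
      by (rule eventually_nhds_in_open) (use 2 in auto)
    then have "eventually (\<lambda>y. 0 = bump1 c a b R k y) (nhds x)"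
      by eventually_elim (auto simp: bump1_def)
    moreover have "((\<lambda>_. 0) has_real_derivative bump1 c a b ?R' (k + 2) x) (at x)"
      using 2 by (auto simp: bump1_def)
    ultimately show ?thesis by (subst (asm) DERIV_cong_ev[OF refl _ refl])
  next
    case 3
    obtain K where K: "K \<ge> 0" "\<And>x. \<bar>bump1 c a b R k x\<bar> \<le> K * ((x - a) * (b - x))\<^sup>2"
      using bump1_bound[OF assms(1)] by blast
    have x0: "bump1 c a b S l x = 0" for S l using 3 by (auto simp: bump1_def)
    \<comment> \<open>At an end point one of the two factors of the quadratic bound is |h|; after
      squaring and dividing by |h|, a factor |h| is left.\<close>
    have le: "\<bar>(bump1 c a b R k (x + h) - bump1 c a b R k x) / h\<bar> \<le> K * \<bar>h\<bar> * (b - a + \<bar>h\<bar>)\<^sup>2" if "h \<noteq> 0" for h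
    proof -
      have "\<bar>(x + h - a) * (b - (x + h))\<bar> \<le> \<bar>h\<bar> * (b - a + \<bar>h\<bar>)"
        using 3 assms(2) unfolding abs_mult
        by (elim disjE) (auto intro!: mult_mono simp: mult.commute[of _ "\<bar>h\<bar>"])
      then have "((x + h - a) * (b - (x + h)))\<^sup>2 \<le> (\<bar>h\<bar> * (b - a + \<bar>h\<bar>))\<^sup>2"
        by (rule abs_le_square_iff[THEN iffD1, OF order.trans]) simp
      then have "\<bar>bump1 c a b R k (x + h)\<bar> \<le> K * (\<bar>h\<bar> * (b - a + \<bar>h\<bar>))\<^sup>2"
        using K by (meson mult_left_mono order_trans)
      then have "\<bar>bump1 c a b R k (x + h)\<bar> / \<bar>h\<bar> \<le> K * (\<bar>h\<bar> * (b - a + \<bar>h\<bar>))\<^sup>2 / \<bar>h\<bar>"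
        by (rule divide_right_mono) simp
      also have "\<dots> = K * \<bar>h\<bar> * (b - a + \<bar>h\<bar>)\<^sup>2"
        using that by (simp add: power2_eq_square)
      finally show ?thesis by (simp add: x0)
    qed
    have "((\<lambda>h. K * \<bar>h\<bar> * (b - a + \<bar>h\<bar>)\<^sup>2) \<longlongrightarrow> K * \<bar>0\<bar> * (b - a + \<bar>0\<bar>)\<^sup>2) (at 0)"
      by (intro tendsto_intros)
    then have lim: "((\<lambda>h. K * \<bar>h\<bar> * (b - a + \<bar>h\<bar>)\<^sup>2) \<longlongrightarrow> 0) (at 0)" by simp
    have "((\<lambda>h. (bump1 c a b R k (x + h) - bump1 c a b R k x) / h) \<longlongrightarrow> 0) (at 0)"
    proof (rule Lim_null_comparison[OF _ lim])
      show "\<forall>\<^sub>F h in at 0. norm ((bump1 c a b R k (x + h) - bump1 c a b R k x) / h) \<le> K * \<bar>h\<bar> * (b - a + \<bar>h\<bar>)\<^sup>2"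
        unfolding eventually_at_filter real_norm_def by (rule always_eventually) (use le in blast)
    qed
    then show ?thesis unfolding DERIV_def x0 by simp
  qed
qed

text \<open>\<open>\<beta> n\<close> is the n-th derivative of \<open>\<beta> 0\<close>. Carrying
  the whole sequence turns partial derivatives of a product into shifts of an index.\<close>

definition deriv_chain :: "(nat \<Rightarrow> real \<Rightarrow> real) \<Rightarrow> bool" where
  "deriv_chain \<beta> \<longleftrightarrow> (\<forall>n x. (\<beta> n has_real_derivative \<beta> (Suc n) x) (at x))"

lemma bump1_deriv_chain:
  assumes "c > 0" "a < b"
  obtains \<beta> where "deriv_chain \<beta>" "\<beta> 0 = bump1 c a b 1 0"
proof -
  define w :: "real poly" where "w = [:-a, 1:] * [:b, -1:]"
  define S where "S n = ((\<lambda>(R, k). (pderiv R * w\<^sup>2 - of_nat k * R * pderiv w * w + smult c (R * pderiv w), k + 2)) ^^ n) (1, 0::nat)" for n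
  have "deriv_chain (\<lambda>n. bump1 c a b (fst (S n)) (snd (S n)))"
    unfolding deriv_chain_def
  proof (intro allI)
    fix n x
    show "(bump1 c a b (fst (S n)) (snd (S n)) has_real_derivative bump1 c a b (fst (S (Suc n))) (snd (S (Suc n))) x) (at x)"
      using DERIV_bump1[OF assms, of "fst (S n)" "snd (S n)" x, folded w_def]
      by (simp add: S_def split_beta)
  qed
  moreover have "bump1 c a b (fst (S 0)) (snd (S 0)) = bump1 c a b 1 0" by (simp add: S_def)
  ultimately show thesis by (rule that)
qed

text \<open>With a primitive G of \<open>\<beta> 0\<close> the average is (G (x + h) - G x) / h, and
  all its derivatives are difference quotients of the same kind. The formula for
  \<open>\<gamma> 1\<close> is what later converts integration by parts into a statement about
  differences.\<close>

lemma deriv_chain_average: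
  assumes "deriv_chain \<beta>" "h \<noteq> 0"
  obtains \<gamma> where "deriv_chain \<gamma>" "\<And>x. \<gamma> 0 x = (LBINT s:{0..1}. \<beta> 0 (x + s * h))"
    "\<And>x. \<gamma> 1 x = (\<beta> 0 (x + h) - \<beta> 0 x) / h"
proof -
  have cont: "isCont (\<beta> 0) x" for x
    using assms DERIV_isCont unfolding deriv_chain_def by blast
  obtain G where G: "\<And>x. (G has_real_derivative \<beta> 0 x) (at x)"
    using einterval_antiderivative[of "-\<infinity>" "\<infinity>" "\<beta> 0"] cont
    by (auto simp: has_real_derivative_iff_has_vector_derivative)
  define \<gamma> where "\<gamma> n x = (case n of 0 \<Rightarrow> (G (x + h) - G x) / h | Suc n \<Rightarrow> (\<beta> n (x + h) - \<beta> n x) / h)" for n x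
  have D: "(F has_real_derivative F' x) (at x) \<Longrightarrow> (F has_real_derivative F' (x + h)) (at (x + h)) \<Longrightarrow>
      ((\<lambda>x. (F (x + h) - F x) / h) has_real_derivative (F' (x + h) - F' x) / h) (at x)" for F F' x
    using assms(2) by (auto intro!: derivative_eq_intros simp: DERIV_shift)
  have "deriv_chain \<gamma>"
    unfolding deriv_chain_def
  proof (intro allI)
    fix n x
    show "(\<gamma> n has_real_derivative \<gamma> (Suc n) x) (at x)"
      by (cases n) (use D[of G "\<beta> 0"] D[of "\<beta> k" "\<beta> (Suc k)" for k] G assms(1)
          in \<open>auto simp: \<gamma>_def[abs_def] deriv_chain_def\<close>)
  qed
  moreover have "\<gamma> 0 x = (LBINT s:{0..1}. \<beta> 0 (x + s * h))" for x
  proof -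
    have "(LBINT s. \<beta> 0 (x + s * h) * indicator {0..1} s) = G (x + 1 * h) / h - G (x + 0 * h) / h"
    proof (rule integral_FTC_Icc_real)
      fix s :: real
      show "((\<lambda>s. G (x + s * h) / h) has_real_derivative \<beta> 0 (x + s * h)) (at s)"
        using assms(2) by (auto intro!: derivative_eq_intros DERIV_chain2[OF G])
      show "isCont (\<lambda>s. \<beta> 0 (x + s * h)) s"
        by (intro isCont_o2[OF _ cont] continuous_intros)
    qed simp
    then show ?thesis by (simp add: \<gamma>_def set_lebesgue_integral_def diff_divide_distrib mult.commute)
  qed
  moreover have "\<gamma> 1 x = (\<beta> 0 (x + h) - \<beta> 0 x) / h" for x
    by (simp add: \<gamma>_def)
  ultimately show thesis by (rule that)
qed

section \<open>Tensor products of one-variable functions\<close>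

definition tensor :: "('d::finite \<Rightarrow> real \<Rightarrow> real) \<Rightarrow> real^'d \<Rightarrow> complex" where
  "tensor \<beta> x = of_real (\<Prod>t\<in>UNIV. \<beta> t (x $ t))"

lemma has_derivative_tensor:
  assumes "\<And>t y. (\<beta> t has_real_derivative \<beta>' t y) (at y)"
  shows "(tensor \<beta> has_derivative
      (\<lambda>v. \<Sum>t\<in>UNIV. of_real (v $ t) * tensor (\<beta>(t := \<beta>' t)) x)) (at x)"
proof -
  have "((\<lambda>x. \<beta> t (x $ t)) has_derivative (\<lambda>v. v $ t * \<beta>' t (x $ t))) (at x)" for t
    using has_derivative_compose[OF bounded_linear.has_derivative[OF bounded_linear_vec_nth[of t] has_derivative_ident],
        of "\<beta> t" "\<lambda>y. y * \<beta>' t (x $ t)" x] assms[of t "x $ t"]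
    by (simp add: has_field_derivative_def mult.commute mult_commute_abs)
  then have "((\<lambda>x. \<Prod>t\<in>UNIV. \<beta> t (x $ t)) has_derivative
      (\<lambda>v. \<Sum>t\<in>UNIV. v $ t * \<beta>' t (x $ t) * (\<Prod>s\<in>UNIV - {t}. \<beta> s (x $ s)))) (at x)"
    by (intro has_derivative_prod)
  from bounded_linear.has_derivative[OF bounded_linear_of_real[where 'a=complex] this]
  have "(tensor \<beta> has_derivative (\<lambda>v. of_real (\<Sum>t\<in>UNIV. v $ t * \<beta>' t (x $ t) * (\<Prod>s\<in>UNIV - {t}. \<beta> s (x $ s))))) (at x)"
    unfolding tensor_def[abs_def] .
  moreover have "(\<Prod>s\<in>UNIV. (\<beta>(t := \<beta>' t)) s (x $ s)) = \<beta>' t (x $ t) * (\<Prod>s\<in>UNIV - {t}. \<beta> s (x $ s))" for t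
    by (subst prod.remove[of _ t]) (auto intro!: prod.cong)
  ultimately show ?thesis
    by (simp add: tensor_def mult.assoc)
qed

lemma partial_tensor:
  assumes "\<And>t y. (\<beta> t has_real_derivative \<beta>' t y) (at y)"
  shows "partial t (tensor \<beta>) = tensor (\<beta>(t := \<beta>' t))"
proof
  fix x
  have "partial t (tensor \<beta>) x = (\<Sum>s\<in>UNIV. of_real (axis t (1::real) $ s) * tensor (\<beta>(s := \<beta>' s)) x)"
    unfolding partial_def frechet_derivative_at[OF has_derivative_tensor[OF assms], symmetric] ..
  also have "\<dots> = (\<Sum>s\<in>UNIV. if s = t then tensor (\<beta>(s := \<beta>' s)) x else 0)"
    by (intro sum.cong) (auto simp: axis_def)
  finally show "partial t (tensor \<beta>) x = tensor (\<beta>(t := \<beta>' t)) x" by simp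
qed

text \<open>Products of members of chains are closed under partial derivatives:
  \<open>partial t\<close> raises the index of the factor \<open>t\<close> by one.\<close>

lemma smooth_tensor:
  fixes \<beta> :: "'d::finite \<Rightarrow> nat \<Rightarrow> real \<Rightarrow> real"
  assumes "\<And>t. deriv_chain (\<beta> t)"
  shows "smooth (tensor (\<lambda>t. \<beta> t (n t)))"
proof -
  have D: "(\<beta> t k has_real_derivative \<beta> t (Suc k) y) (at y)" for t k y
    using assms by (simp add: deriv_chain_def)
  have "\<exists>n'. foldr partial ts (tensor (\<lambda>t. \<beta> t (n t))) = tensor (\<lambda>t. \<beta> t (n' t))" for ts
  proof (induction ts)
    case (Cons t ts)
    then obtain n' where n': "foldr partial ts (tensor (\<lambda>t. \<beta> t (n t))) = tensor (\<lambda>t. \<beta> t (n' t))" by blast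
    have "partial t (tensor (\<lambda>t. \<beta> t (n' t))) = tensor (\<lambda>s. \<beta> s ((n'(t := Suc (n' t))) s))"
      by (subst partial_tensor[OF D]) (auto intro!: arg_cong[where f=tensor])
    then show ?case using n' by auto
  qed auto
  moreover have "tensor (\<lambda>t. \<beta> t (n t)) differentiable_on UNIV" for n
    unfolding differentiable_on_def differentiable_def
    using has_derivative_tensor[of "\<lambda>t. \<beta> t (n t)", OF D] by auto
  ultimately show ?thesis unfolding smooth_def by metis
qed

lemma test_function_tensor:
  fixes \<beta> :: "'d::finite \<Rightarrow> nat \<Rightarrow> real \<Rightarrow> real"
  assumes "\<And>t. deriv_chain (\<beta> t)" "\<And>t y. y \<notin> {l $ t..u $ t} \<Longrightarrow> \<beta> t 0 y = 0"
  shows "test_function (tensor (\<lambda>t. \<beta> t 0))"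
  unfolding test_function_def
proof
  show "smooth (tensor (\<lambda>t. \<beta> t 0))" by (rule smooth_tensor[OF assms(1)])
  have "x \<in> cbox l u" if "tensor (\<lambda>t. \<beta> t 0) x \<noteq> 0" for x
    using that assms(2) by (force simp: tensor_def mem_box_cart)
  then have "closure {x. tensor (\<lambda>t. \<beta> t 0) x \<noteq> 0} \<subseteq> cbox l u"
    by (intro closure_minimal) auto
  then show "compact (closure {x. tensor (\<lambda>t. \<beta> t 0) x \<noteq> 0})"
    by (metis bounded_cbox bounded_subset closed_closure compact_eq_bounded_closed)
qed


section \<open>The fundamental lemma of the calculus of variations\<close>

text \<open>Boxes form an intersection-stable generator of the Borel sets, so the vanishing of the
  integrals extends from boxes to all Borel sets by Dynkin's argument.\<close>

lemma AE_zero_if_box_integrals_zero: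
  fixes f :: "'a::euclidean_space \<Rightarrow> 'b::{banach, second_countable_topology}"
  assumes int: "\<And>l u. set_integrable lborel (cbox l u) f"
    and zero: "\<And>l u. (LINT x:box l u|lborel. f x) = 0"
  shows "AE x in lborel. f x = 0"
proof -
  \<comment> \<open>\<open>f\<close> is only locally integrable, so it is cut off to a cube. The
    cut-off function has total integral 0, which settles complements, and a box meets the cube in a
    box again. Countably many cubes cover the space.\<close>
  have "AE x in lborel. indicator (box (- (real n *\<^sub>R One)) (real n *\<^sub>R One)) x *\<^sub>R f x = 0" for n :: nat
  proof (rule sigma_finite_measure.density_zero[OF sigma_finite_lborel])
    define B :: "'a set" where "B = box (- (real n *\<^sub>R One)) (real n *\<^sub>R One)"
    define v where "v x = indicator B x *\<^sub>R f x" for x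
    have "set_integrable lborel B f"
      by (rule set_integrable_subset[OF int[of "- (real n *\<^sub>R One)" "real n *\<^sub>R One"]]) (auto simp: B_def box_subset_cbox)
    then show v: "integrable lborel (\<lambda>x. indicator (box (- (real n *\<^sub>R One)) (real n *\<^sub>R One)) x *\<^sub>R f x)"
      unfolding set_integrable_def B_def .
    then have v: "integrable lborel v" unfolding v_def B_def .
    have si: "set_integrable lborel A v" if "A \<in> sets borel" for A
      unfolding set_integrable_def using that v by (intro integrable_mult_indicator) auto
    fix A :: "'a set" assume "A \<in> sets lborel"
    then have A: "A \<in> sigma_sets UNIV (range (\<lambda>(a, b). box a b))"
      by (simp add: borel_eq_box)
    have stable: "Int_stable (range (\<lambda>(a, b). box a b :: 'a set))"
    proof (rule Int_stableI)
      fix A B :: "'a set" assume "A \<in> range (\<lambda>(a, b). box a b)" "B \<in> range (\<lambda>(a, b). box a b)"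
      then obtain a b c d where AB: "A = box a b" "B = box c d" by auto
      show "A \<inter> B \<in> range (\<lambda>(a, b). box a b)"
        unfolding AB box_Int_box by (rule range_eqI[where x="(_, _)"]) simp
    qed
    have "set_lebesgue_integral lborel A v = 0"
      using stable subset_UNIV[of "range (\<lambda>(a, b). box a b :: 'a set)", folded Pow_UNIV] A
    proof (induction rule: sigma_sets_induct_disjoint)
      fix A :: "'a set" assume "A \<in> range (\<lambda>(a, b). box a b)"
      then obtain a b where A: "A = box a b" by auto
      obtain c d where cd: "A \<inter> B = box c d"
        unfolding A B_def box_Int_box by blast
      have "indicator A x *\<^sub>R v x = indicator (box c d) x *\<^sub>R f x" for x
        unfolding cd[symmetric] v_def by (simp add: indicator_inter_arith)
      then show "set_lebesgue_integral lborel A v = 0"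
        using zero[of c d] by (simp add: set_lebesgue_integral_def)
    next
      fix A :: "'a set" assume A: "A \<in> sigma_sets UNIV (range (\<lambda>(a, b). box a b))"
        and IH: "set_lebesgue_integral lborel A v = 0"
      then have [measurable]: "A \<in> sets borel" by (simp add: borel_eq_box)
      have "integral\<^sup>L lborel v = 0"
        using zero by (simp add: v_def[abs_def] B_def set_lebesgue_integral_def)
      moreover have "set_lebesgue_integral lborel (A \<union> - A) v = set_lebesgue_integral lborel A v + set_lebesgue_integral lborel (- A) v"
        by (intro set_integral_Un si) auto
      ultimately show "set_lebesgue_integral lborel (UNIV - A) v = 0"
        using IH by (simp add: Compl_eq_Diff_UNIV set_lebesgue_integral_def)
    next
      fix A :: "nat \<Rightarrow> 'a set"
      assume "disjoint_family A" and A: "range A \<subseteq> sigma_sets UNIV (range (\<lambda>(a, b). box a b))"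
        and IH: "\<And>i. set_lebesgue_integral lborel (A i) v = 0"
      then have [measurable]: "A i \<in> sets borel" for i by (auto simp: borel_eq_box)
      have "set_lebesgue_integral lborel (\<Union>i. A i) v = (\<Sum>i. set_lebesgue_integral lborel (A i) v)"
        using \<open>disjoint_family A\<close>
        by (intro lebesgue_integral_countable_add si) (auto simp: disjoint_family_on_def)
      then show "set_lebesgue_integral lborel (\<Union>i. A i) v = 0" by (simp add: IH)
    qed (auto simp: set_lebesgue_integral_def)
    then show "(LINT x:A|lborel. indicator (box (- (real n *\<^sub>R One)) (real n *\<^sub>R One)) x *\<^sub>R f x) = 0"
      unfolding v_def B_def .
  qed
  then have "AE x in lborel. \<forall>n. indicator (box (- (real n *\<^sub>R One)) (real n *\<^sub>R One)) x *\<^sub>R f x = 0"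
    unfolding AE_all_countable by blast
  then show ?thesis
  proof eventually_elim
    case (elim x)
    have "x \<in> (\<Union>n. box (- (real n *\<^sub>R One)) (real n *\<^sub>R One))"
      using UN_box_eq_UNIV by auto
    then obtain n where "x \<in> box (- (real n *\<^sub>R One)) (real n *\<^sub>R One)" by blast
    then show ?case using elim[rule_format, of n] by simp
  qed
qed

text \<open>The product bump of a box with parameter c = 1 / (n + 1) lies between 0 and the
  indicator function of the open box and converges to it, so dominated convergence reduces the claim
  to integrals over boxes.\<close>

lemma AE_zero_if_tensor_integrals_zero:
  fixes f :: "real^'d \<Rightarrow> complex"
  assumes int: "\<And>l u. set_integrable lborel (cbox l u) f"
    and zero: "\<And>(\<beta> :: 'd \<Rightarrow> nat \<Rightarrow> real \<Rightarrow> real) l u. (\<And>t. deriv_chain (\<beta> t)) \<Longrightarrow>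
      (\<And>t y. y \<notin> {l $ t..u $ t} \<Longrightarrow> \<beta> t 0 y = 0) \<Longrightarrow>
      (LINT x|lborel. f x * tensor (\<lambda>t. \<beta> t 0) x) = 0"
  shows "AE x in lborel. f x = 0"
proof (rule AE_zero_if_box_integrals_zero[OF int])
  fix l u :: "real^'d"
  show "(LINT x:box l u|lborel. f x) = 0"
  proof (cases "box l u = {}")
    case False
    then have lu: "l $ t < u $ t" for t by (metis interval_ne_empty_cart(2))
    define E where "E n = tensor (\<lambda>t. bump1 (1 / Suc n) (l $ t) (u $ t) 1 0)" for n :: nat
    define w where "w x t = (x $ t - l $ t) * (u $ t - x $ t)" for x t
    have E: "E n x = indicator (box l u) x * of_real (\<Prod>t\<in>UNIV. exp (- (1 / Suc n) / w x t))" for n x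
    proof (cases "x \<in> box l u")
      case True
      then show ?thesis by (simp add: E_def tensor_def bump1_def w_def mem_box_cart)
    next
      case False
      then obtain t where "\<not> (l $ t < x $ t \<and> x $ t < u $ t)" by (auto simp: mem_box_cart)
      then have "bump1 (1 / Suc n) (l $ t) (u $ t) 1 0 (x $ t) = 0" by (auto simp: bump1_def)
      then have "(\<Prod>t\<in>UNIV. bump1 (1 / Suc n) (l $ t) (u $ t) 1 0 (x $ t)) = 0"
        by (intro prod_zero) auto
      moreover have "indicator (box l u) x = (0::complex)" using False by simp
      ultimately show ?thesis unfolding E_def tensor_def by (simp only: of_real_0 mult_zero_left)
    qed
    have E0: "(LINT x|lborel. f x * E n x) = 0" for n
    proof -
      have "\<forall>t. \<exists>\<beta>. deriv_chain \<beta> \<and> \<beta> 0 = bump1 (1 / Suc n) (l $ t) (u $ t) 1 0"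
        using bump1_deriv_chain[of "1 / Suc n"] lu by (metis of_nat_0_less_iff zero_less_Suc zero_less_divide_1_iff)
      then obtain \<beta> where \<beta>: "\<And>t. deriv_chain (\<beta> t)" "\<And>t. \<beta> t 0 = bump1 (1 / Suc n) (l $ t) (u $ t) 1 0"
        by metis
      have "(LINT x|lborel. f x * tensor (\<lambda>t. \<beta> t 0) x) = 0"
        by (rule zero[of \<beta> l u]) (auto simp: \<beta> bump1_def)
      then show ?thesis by (simp add: E_def \<beta>)
    qed
    have f: "set_integrable lborel (box l u) f"
      by (rule set_integrable_subset[OF int[of l u]]) (auto simp: box_subset_cbox)
    have "(\<lambda>n. LINT x|lborel. f x * E n x) \<longlonglongrightarrow> (LINT x|lborel. indicator (box l u) x *\<^sub>R f x)"
    proof (rule integral_dominated_convergence[where w="\<lambda>x. norm (indicator (box l u) x *\<^sub>R f x)"])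
      show "(\<lambda>x. indicator (box l u) x *\<^sub>R f x) \<in> borel_measurable lborel"
        using f unfolding set_integrable_def by (rule borel_measurable_integrable)
      show "(\<lambda>x. f x * E n x) \<in> borel_measurable lborel" for n
      proof -
        have [measurable]: "(\<lambda>x. x $ t) \<in> borel_measurable lborel" for t :: 'd
          by (auto intro!: borel_measurable_continuous_onI continuous_intros)
        have [measurable]: "(\<lambda>x. indicator (box l u) x *\<^sub>R f x) \<in> borel_measurable lborel"
          using f unfolding set_integrable_def by (rule borel_measurable_integrable)
        have "(\<lambda>x. (indicator (box l u) x *\<^sub>R f x) * of_real (\<Prod>t\<in>UNIV. exp (- (1 / Suc n) / w x t))) \<in> borel_measurable lborel"
          unfolding w_def by measurable
        then show ?thesis by (rule measurable_cong[THEN iffD1, rotated]) (simp add: E scaleR_conv_of_real indicator_def)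
      qed
      show "integrable lborel (\<lambda>x. norm (indicator (box l u) x *\<^sub>R f x))"
        using f unfolding set_integrable_def by (rule integrable_norm)
      show "AE x in lborel. (\<lambda>n. f x * E n x) \<longlonglongrightarrow> indicator (box l u) x *\<^sub>R f x"
      proof (intro always_eventually allI)
        fix x
        have "(\<lambda>n. - (1 / real (Suc n)) / w x t) \<longlonglongrightarrow> - 0 / w x t" for t
          unfolding divide_inverse[of _ "w x t"]
          by (intro tendsto_intros LIMSEQ_inverse_real_of_nat[unfolded inverse_eq_divide])
        then have "(\<lambda>n. E n x) \<longlonglongrightarrow> indicator (box l u) x * of_real (\<Prod>t\<in>(UNIV::'d set). exp (- 0 / w x t))"
          unfolding E by (intro tendsto_mult tendsto_const tendsto_of_real tendsto_prod tendsto_exp)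
        then have "(\<lambda>n. f x * E n x) \<longlonglongrightarrow> f x * (indicator (box l u) x * of_real (\<Prod>t\<in>(UNIV::'d set). exp (- 0 / w x t)))"
          by (rule tendsto_mult_left)
        then show "(\<lambda>n. f x * E n x) \<longlonglongrightarrow> indicator (box l u) x *\<^sub>R f x"
          by (cases "x \<in> box l u") auto
      qed
      show "AE x in lborel. norm (f x * E n x) \<le> norm (indicator (box l u) x *\<^sub>R f x)" for n
      proof (intro always_eventually allI)
        fix x
        have "(\<Prod>t\<in>UNIV. exp (- (1 / Suc n) / w x t)) \<le> 1" if "x \<in> box l u"
        proof (rule prod_le_1)
          fix t
          have "0 < w x t" using that by (simp add: w_def mem_box_cart)
          then have "- (1 / Suc n) / w x t \<le> 0" by (simp add: field_simps)
          then show "0 \<le> exp (- (1 / Suc n) / w x t) \<and> exp (- (1 / Suc n) / w x t) \<le> 1" by simp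
        qed
        then show "norm (f x * E n x) \<le> norm (indicator (box l u) x *\<^sub>R f x)"
          by (auto simp: E norm_mult indicator_def mult_left_le prod_nonneg simp del: of_real_prod)
      qed
    qed
    then show ?thesis by (simp add: E0 LIMSEQ_const_iff set_lebesgue_integral_def)
  qed (simp add: set_lebesgue_integral_def)
qed


section \<open>Averages and sampling kernels\<close>

text \<open>Young's inequality in the form of a tangent: \<open>u\<close> is at most an affine
  function of u^P, with equality at u = r. Integrating this against \<open>w\<close> gives the
  bound, uniformly for all P >= 1.\<close>

lemma weighted_power_mean:
  fixes u w :: "'a \<Rightarrow> real"
  assumes [measurable]: "u \<in> borel_measurable M" "w \<in> borel_measurable M"
    and nonneg: "\<And>x. 0 \<le> u x" "\<And>x. 0 \<le> w x"
    and P: "1 \<le> P" and V: "0 < V" and J: "0 \<le> J"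
    and w: "(\<integral>\<^sup>+x. w x \<partial>M) \<le> ennreal V"
    and uw: "(\<integral>\<^sup>+x. u x powr P * w x \<partial>M) \<le> ennreal J"
  shows "(\<integral>\<^sup>+x. u x * w x \<partial>M) \<le> ennreal (V powr (1 - 1 / P) * J powr (1 / P))"
proof (cases "J = 0")
  case True
  then have "AE x in M. ennreal (u x powr P * w x) = 0"
    using uw by (subst nn_integral_0_iff_AE[symmetric]) auto
  then have "AE x in M. ennreal (u x * w x) = 0"
  proof eventually_elim
    case (elim x)
    have "0 \<le> u x powr P * w x" using nonneg(2)[of x] by simp
    with elim have "u x powr P * w x = 0" by (simp add: ennreal_eq_0_iff)
    then show ?case by auto
  qed
  then show ?thesis by (subst nn_integral_cong_AE) auto
next
  case False
  \<comment> \<open>This \<open>r\<close> minimises the integrated bound r^(1 - P) J / P + (1 - 1 /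
    P) r V, and the minimum is r V. For J = 0 it would be 0, which is why that case is split
    off.\<close>
  define r where "r = (J / V) powr (1 / P)"
  have r: "r > 0" "r powr P = J / V" using False J V P by (auto simp: r_def powr_powr)
  have young: "u x \<le> r powr (1 - P) / P * u x powr P + (1 - 1 / P) * r" for x
  proof (cases "u x = 0")
    case False
    then have "u x > 0" using nonneg(1)[of x] by simp
    then have "u x = (u x powr P * r powr (1 - P)) powr (1 / P) * r powr (1 - 1 / P)"
      using r P by (simp add: powr_mult powr_powr powr_add[symmetric] diff_divide_distrib)
    also have "\<dots> \<le> 1 / P * (u x powr P * r powr (1 - P)) + (1 - 1 / P) * r"
      by (rule Youngs_inequality_0) (use P r \<open>u x > 0\<close> in auto)
    finally show ?thesis by (simp add: mult.commute)
  qed (use P r in auto)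
  have "(\<integral>\<^sup>+x. u x * w x \<partial>M) \<le> (\<integral>\<^sup>+x. ennreal (r powr (1 - P) / P) * ennreal (u x powr P * w x) + ennreal ((1 - 1 / P) * r) * ennreal (w x) \<partial>M)"
  proof (rule nn_integral_mono)
    fix x
    have "u x * w x \<le> (r powr (1 - P) / P * u x powr P + (1 - 1 / P) * r) * w x"
      using young nonneg by (intro mult_right_mono) auto
    also have "\<dots> = (r powr (1 - P) / P) * (u x powr P * w x) + ((1 - 1 / P) * r) * w x"
      by (simp add: algebra_simps)
    finally show "ennreal (u x * w x) \<le> ennreal (r powr (1 - P) / P) * ennreal (u x powr P * w x) + ennreal ((1 - 1 / P) * r) * ennreal (w x)"
      using nonneg P r by (simp add: ennreal_mult[symmetric] ennreal_plus[symmetric] del: ennreal_plus)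
  qed
  also have "\<dots> = ennreal (r powr (1 - P) / P) * (\<integral>\<^sup>+x. u x powr P * w x \<partial>M) + ennreal ((1 - 1 / P) * r) * (\<integral>\<^sup>+x. w x \<partial>M)"
    by (simp add: nn_integral_add nn_integral_cmult)
  also have "\<dots> \<le> ennreal (r powr (1 - P) / P) * ennreal J + ennreal ((1 - 1 / P) * r) * ennreal V"
    by (intro add_mono mult_left_mono w uw) auto
  also have "\<dots> = ennreal (r powr (1 - P) / P * J + (1 - 1 / P) * r * V)"
    using P r J V by (simp add: ennreal_mult[symmetric] ennreal_plus[symmetric] del: ennreal_plus)
  also have "r powr (1 - P) / P * J + (1 - 1 / P) * r * V = r * V"
  proof -
    have "r powr (1 - P) * J = r powr (1 - P) * (r powr P * V)" using r(2) V by simp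
    also have "\<dots> = r * V"
      using r(1) by (simp add: powr_add[symmetric] mult.assoc[symmetric])
    finally have "r powr (1 - P) * J = r * V" .
    then have "r powr (1 - P) / P * J = r * V / P" by (metis times_divide_eq_left)
    then show ?thesis by (simp add: algebra_simps)
  qed
  also have "r * V = V powr (1 - 1 / P) * J powr (1 / P)"
    using V J False P by (simp add: r_def powr_divide powr_diff)
  finally show ?thesis .
qed

lemma nn_integral_lborel_affine:
  fixes f :: "'a::euclidean_space \<Rightarrow> ennreal"
  assumes [measurable]: "f \<in> borel_measurable borel" and "c \<noteq> 0"
  shows "(\<integral>\<^sup>+x. f x \<partial>lborel) = ennreal (\<bar>c\<bar> ^ DIM('a)) * (\<integral>\<^sup>+x. f (t + c *\<^sub>R x) \<partial>lborel)"
  by (subst lborel_affine[OF assms(2), of t])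
     (simp add: nn_integral_density nn_integral_distr nn_integral_cmult ennreal_power)

lemma integral_lborel_affine:
  fixes f :: "'a::euclidean_space \<Rightarrow> complex"
  assumes [measurable]: "f \<in> borel_measurable borel" and "c \<noteq> 0"
  shows "(LINT x|lborel. f x) = of_real (\<bar>c\<bar> ^ DIM('a)) * (LINT x|lborel. f (t + c *\<^sub>R x))"
  by (subst lborel_affine[OF assms(2), of t])
     (simp add: integral_density integral_distr ennreal_power scaleR_conv_of_real)

lemma AE_lborel_affine:
  fixes c :: real and t :: "'a::euclidean_space"
  assumes "AE x in lborel. Q x" "c \<noteq> 0"
  shows "AE x in lborel. Q (t + c *\<^sub>R x)"
proof -
  \<comment> \<open>\<open>Q\<close> itself need not define a measurable set, so the transformation
    rule is applied to a measurable null set that covers the exceptions.\<close>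
  from assms(1) obtain N where N: "{x \<in> space lborel. \<not> Q x} \<subseteq> N" "N \<in> null_sets lborel"
    by (auto simp: eventually_ae_filter)
  have "AE x in lborel. x \<notin> N" using N(2) by (rule AE_not_in)
  then have "AE x in density (distr lborel borel (\<lambda>x. t + c *\<^sub>R x)) (\<lambda>_. \<bar>c\<bar>^DIM('a)). x \<notin> N"
    unfolding lborel_affine[OF assms(2), of t, symmetric] .
  then have "AE x in lborel. t + c *\<^sub>R x \<notin> N"
    using assms(2) N(2) by (subst (asm) AE_density, simp, subst (asm) AE_distr_iff) auto
  then show ?thesis by eventually_elim (use N in auto)
qed

text \<open>Lattice sums are written as integrals over a counting measure, so that they can be
  exchanged with nonnegative integrals and no summability has to be shown.\<close>

lemma borel_measurable_nn_integral_count_space: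
  fixes f :: "'i::countable \<Rightarrow> 'a \<Rightarrow> ennreal"
  assumes [measurable]: "\<And>i. f i \<in> borel_measurable M"
  shows "(\<lambda>x. \<integral>\<^sup>+i. f i x \<partial>count_space UNIV) \<in> borel_measurable M"
proof (rule sigma_finite_measure.borel_measurable_nn_integral)
  show "sigma_finite_measure (count_space (UNIV :: 'i set))"
    by (rule sigma_finite_measure_count_space_countable) simp
  have "(\<lambda>(i, x). f i x) \<in> borel_measurable (count_space UNIV \<Otimes>\<^sub>M M)"
    by (rule measurable_pair_measure_countable1) auto
  from measurable_compose[OF measurable_pair_swap' this]
  show "(\<lambda>(x, i). f i x) \<in> borel_measurable (M \<Otimes>\<^sub>M count_space UNIV)"
    by (simp add: split_beta')
qed

text \<open>Integrability is not assumed, because the integral of a non-integrable function is 0 by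
  convention.\<close>

lemma norm_integral_le_nn_integral:
  fixes f :: "'a \<Rightarrow> 'b::{banach, second_countable_topology}"
  shows "ennreal (norm (integral\<^sup>L M f)) \<le> (\<integral>\<^sup>+x. norm (f x) \<partial>M)"
  by (cases "integrable M f") (auto intro: integral_norm_bound_ennreal simp: not_integrable_integral_eq)

section \<open>Averages over segments\<close>

definition unif :: "real measure" where
  "unif = density lborel (\<lambda>s. ennreal (indicator {0..1} s))"

lemma sets_unif [simp, measurable_cong]: "sets unif = sets borel"
  by (simp add: unif_def)

lemma space_unif [simp]: "space unif = UNIV"
  by (simp add: unif_def)

lemma prob_space_unif: "prob_space unif"
  by (rule prob_spaceI) (simp add: unif_def emeasure_density ennreal_indicator)

interpretation unif: prob_space unif by (rule prob_space_unif)
interpretation unif_lborel: pair_sigma_finite unif lborel ..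
interpretation lborel_unif: pair_sigma_finite lborel unif ..

lemma AE_unif: "AE s in unif. s \<in> {0..1}"
  unfolding unif_def by (subst AE_density) (auto simp: indicator_def)

lemma integral_unif:
  fixes f :: "real \<Rightarrow> 'a::{banach, second_countable_topology}"
  assumes "f \<in> borel_measurable borel"
  shows "(LINT s|unif. f s) = (LBINT s:{0..1}. f s)"
  using assms by (simp add: unif_def integral_density set_lebesgue_integral_def)

text \<open>Convolution with the uniform probability measure on the segment from 0 to
  \<open>- v\<close>. Iterated over coordinate directions it produces the convolutions with
  B-splines.\<close>

definition average :: "'a::euclidean_space \<Rightarrow> ('a \<Rightarrow> complex) \<Rightarrow> 'a \<Rightarrow> complex" where
  "average v f x = (LINT s|unif. f (x + s *\<^sub>R v))"

lemma borel_measurable_average [measurable (raw)]: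
  assumes [measurable]: "f \<in> borel_measurable borel"
  shows "average v f \<in> borel_measurable borel"
  unfolding average_def[abs_def] by measurable

lemma nn_integral_shift:
  fixes f :: "'a::euclidean_space \<Rightarrow> ennreal"
  assumes "f \<in> borel_measurable borel"
  shows "(\<integral>\<^sup>+x. f (x + t) \<partial>lborel) = (\<integral>\<^sup>+x. f x \<partial>lborel)"
  using nn_integral_lborel_affine[OF assms, of 1 t] by (simp add: add.commute)

lemma integral_shift:
  fixes f :: "'a::euclidean_space \<Rightarrow> complex"
  assumes "f \<in> borel_measurable borel"
  shows "(LINT x|lborel. f (x + t)) = (LINT x|lborel. f x)"
  using integral_lborel_affine[OF assms, of 1 t] by (simp add: add.commute)

text \<open>Fubini's theorem for \<open>unif\<close> and Lebesgue measure, with a translation by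
  \<open>s *\<^sub>R v\<close> for each fixed \<open>s\<close>: this moves the average to the other
  factor and reverses the segment. The assumption \<open>fin\<close> is absolute convergence, and
  the translation preserves it.\<close>

lemma average_adjoint:
  fixes g w :: "'a::euclidean_space \<Rightarrow> complex"
  assumes [measurable]: "g \<in> borel_measurable borel" "w \<in> borel_measurable borel"
    and fin: "(\<integral>\<^sup>+s. \<integral>\<^sup>+x. norm (g (x + s *\<^sub>R v)) * norm (w x) \<partial>lborel \<partial>unif) < \<infinity>"
  shows "integrable lborel (\<lambda>x. average v g x * w x)"
    and "(LINT x|lborel. average v g x * w x) = (LINT x|lborel. g x * average (- v) w x)"
proof -
  let ?F = "\<lambda>s x. g (x + s *\<^sub>R v) * w x" and ?G = "\<lambda>s x. g x * w (x - s *\<^sub>R v)"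
  have F: "integrable (unif \<Otimes>\<^sub>M lborel) (\<lambda>(s, x). ?F s x)"
    unfolding integrable_iff_bounded
    using fin by (simp add: split_beta lborel.nn_integral_fst[symmetric] norm_mult)
  have sh: "(\<integral>\<^sup>+x. norm (g x) * norm (w (x - s *\<^sub>R v)) \<partial>lborel) = (\<integral>\<^sup>+x. norm (g (x + s *\<^sub>R v)) * norm (w x) \<partial>lborel)" for s
    using nn_integral_shift[of "\<lambda>x. norm (g x) * norm (w (x - s *\<^sub>R v))" "s *\<^sub>R v"] by simp
  have G: "integrable (unif \<Otimes>\<^sub>M lborel) (\<lambda>(s, x). ?G s x)"
    unfolding integrable_iff_bounded
    using fin by (simp add: split_beta lborel.nn_integral_fst[symmetric] norm_mult sh)
  have "integrable lborel (\<lambda>x. LINT s|unif. ?F s x)"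
    using unif_lborel.integrable_snd[OF F] .
  then show "integrable lborel (\<lambda>x. average v g x * w x)"
    by (simp add: average_def)
  have "(LINT x|lborel. average v g x * w x) = (LINT x|lborel. LINT s|unif. ?F s x)"
    by (simp add: average_def)
  also have "\<dots> = (LINT s|unif. LINT x|lborel. ?F s x)"
    by (rule unif_lborel.Fubini_integral[OF F])
  also have "\<dots> = (LINT s|unif. LINT x|lborel. ?G s x)"
    using integral_shift[of "?G s" "s *\<^sub>R v" for s] by simp
  also have "\<dots> = (LINT x|lborel. LINT s|unif. ?G s x)"
    by (rule unif_lborel.Fubini_integral[OF G, symmetric])
  also have "\<dots> = (LINT x|lborel. g x * average (- v) w x)"
    by (simp add: average_def)
  finally show "(LINT x|lborel. average v g x * w x) = (LINT x|lborel. g x * average (- v) w x)" .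
qed

section \<open>Kernels with bounded periodization and their sampled coefficients\<close>

lemma lat_simps: "lat (k + l) = lat k + lat l" "lat (- k) = - lat k" "lat (k - l) = lat k - lat l"
    "lat (axis t 1) = axis t 1"
  by (simp_all add: lat_def vec_eq_iff axis_def)

text \<open>One constant bounds both the L^1 norm and the periodization. The kernel is Borel, not
  just Lebesgue measurable, so that its translates are jointly measurable in the point and the
  translation parameter.\<close>

definition sampling_kernel :: "real \<Rightarrow> (real^'d \<Rightarrow> complex) \<Rightarrow> bool" where
  "sampling_kernel B \<phi> \<longleftrightarrow> \<phi> \<in> borel_measurable borel \<and> (\<integral>\<^sup>+x. norm (\<phi> x) \<partial>lborel) \<le> ennreal B \<and>
     (AE x in lborel. (\<integral>\<^sup>+k. norm (\<phi> (x - lat k)) \<partial>count_space UNIV) \<le> ennreal B) \<and>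
     (LINT x|lborel. \<phi> x) = 1"

lemma sampling_kernel_ge_1:
  assumes "sampling_kernel B \<phi>"
  shows "1 \<le> B"
proof -
  have "ennreal (norm (LINT x|lborel. \<phi> x)) \<le> ennreal B"
    using norm_integral_le_nn_integral assms by (metis sampling_kernel_def order_trans)
  then show ?thesis
    using assms by (simp add: sampling_kernel_def ennreal_le_iff2 flip: ennreal_1)
qed

text \<open>Every clause survives because \<open>average\<close> is a mean of translates over a
  probability measure; even the constant \<open>B\<close> is kept. The integral 1 comes from the
  adjoint formula with the constant weight 1.\<close>

lemma sampling_kernel_average:
  fixes \<phi> :: "real^'d \<Rightarrow> complex"
  assumes "sampling_kernel B \<phi>"
  shows "sampling_kernel B (average v \<phi>)"
  unfolding sampling_kernel_def
proof (intro conjI)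
  have [measurable]: "\<phi> \<in> borel_measurable borel"
    and B: "(\<integral>\<^sup>+x. norm (\<phi> x) \<partial>lborel) \<le> ennreal B"
    and per: "AE x in lborel. (\<integral>\<^sup>+k. norm (\<phi> (x - lat k)) \<partial>count_space UNIV) \<le> ennreal B"
    and 1: "(LINT x|lborel. \<phi> x) = 1"
    using assms by (auto simp: sampling_kernel_def)
  show "average v \<phi> \<in> borel_measurable borel" by measurable
  have le: "ennreal (norm (average v \<phi> x)) \<le> (\<integral>\<^sup>+s. norm (\<phi> (x + s *\<^sub>R v)) \<partial>unif)" for x
    unfolding average_def by (rule norm_integral_le_nn_integral)
  have shift: "(\<integral>\<^sup>+x. norm (\<phi> (x + s *\<^sub>R v)) \<partial>lborel) = (\<integral>\<^sup>+x. norm (\<phi> x) \<partial>lborel)" for s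
    by (rule nn_integral_shift) measurable
  have "(\<integral>\<^sup>+x. norm (average v \<phi> x) \<partial>lborel) \<le> (\<integral>\<^sup>+x. \<integral>\<^sup>+s. norm (\<phi> (x + s *\<^sub>R v)) \<partial>unif \<partial>lborel)"
    by (intro nn_integral_mono le)
  also have "\<dots> = (\<integral>\<^sup>+s. \<integral>\<^sup>+x. norm (\<phi> (x + s *\<^sub>R v)) \<partial>lborel \<partial>unif)"
    by (rule unif_lborel.Fubini') measurable
  also have "\<dots> = (\<integral>\<^sup>+x. norm (\<phi> x) \<partial>lborel)"
    by (simp add: shift unif.emeasure_space_1[simplified])
  finally show "(\<integral>\<^sup>+x. norm (average v \<phi> x) \<partial>lborel) \<le> ennreal B" using B by simp
  let ?P = "\<lambda>x. \<integral>\<^sup>+k. norm (\<phi> (x - lat k)) \<partial>count_space UNIV"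
  have [measurable]: "?P \<in> borel_measurable borel"
    by (rule borel_measurable_nn_integral_count_space) simp
  have "AE s in unif. AE x in lborel. ?P (x + s *\<^sub>R v) \<le> ennreal B"
  proof (rule AE_I2)
    fix s
    show "AE x in lborel. ?P (x + s *\<^sub>R v) \<le> ennreal B"
      using AE_lborel_affine[OF per, of 1 "s *\<^sub>R v"] by (simp add: add.commute)
  qed
  \<comment> \<open>The exceptional null set of the periodization bound depends on \<open>s\<close>.
    Exchanging the two quantifiers gives, for almost every \<open>x\<close>, the bound for almost
    every \<open>s\<close>.\<close>
  then have "AE x in lborel. AE s in unif. ?P (x + s *\<^sub>R v) \<le> ennreal B"
    by (subst unif_lborel.AE_commute[symmetric]) measurable
  then show "AE x in lborel. (\<integral>\<^sup>+k. norm (average v \<phi> (x - lat k)) \<partial>count_space UNIV) \<le> ennreal B"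
  proof eventually_elim
    case (elim x)
    have "(\<integral>\<^sup>+k. norm (average v \<phi> (x - lat k)) \<partial>count_space UNIV) \<le>
        (\<integral>\<^sup>+k. \<integral>\<^sup>+s. norm (\<phi> (x - lat k + s *\<^sub>R v)) \<partial>unif \<partial>count_space UNIV)"
      by (intro nn_integral_mono le)
    also have "\<dots> = (\<integral>\<^sup>+s. \<integral>\<^sup>+k. norm (\<phi> (x - lat k + s *\<^sub>R v)) \<partial>count_space UNIV \<partial>unif)"
      by (rule nn_integral_count_space_nn_integral[symmetric]) auto
    also have "\<dots> \<le> (\<integral>\<^sup>+s. ennreal B \<partial>unif)"
      using elim by (intro nn_integral_mono_AE) (auto simp: algebra_simps)
    also have "\<dots> = ennreal B" by (simp add: unif.emeasure_space_1[simplified])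
    finally show ?case .
  qed
  have "(LINT x|lborel. average v \<phi> x * 1) = (LINT x|lborel. \<phi> x * average (- v) (\<lambda>_. 1) x)"
    using B by (intro average_adjoint(2)) (auto simp: shift unif.emeasure_space_1[simplified] le_less_trans)
  then show "(LINT x|lborel. average v \<phi> x) = 1"
    using 1 by (simp add: average_def unif.prob_space[simplified])
qed

definition coef :: "(real^'d \<Rightarrow> complex) \<Rightarrow> real \<Rightarrow> (real^'d \<Rightarrow> complex) \<Rightarrow> int^'d \<Rightarrow> complex" where
  "coef \<phi> \<alpha> g k = (LINT x|lborel. g x * cnj (\<phi> (\<alpha> *\<^sub>R x - lat k)))"

definition Lint :: "real \<Rightarrow> (real^'d \<Rightarrow> complex) \<Rightarrow> ennreal" where
  "Lint P g = (\<integral>\<^sup>+x. norm (g x) powr P \<partial>lborel)"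

text \<open>The exponent of |\<alpha>| is d / q, since 1 / q = 1 - 1 / P; so this is the P-th power
  of the l^P norm of the coefficients normalised as in \<open>affine\<close>. Like
  \<open>Lint\<close> it is a power, which keeps roots out of the estimates until the end.\<close>

definition coef_sum :: "real \<Rightarrow> (real^'d \<Rightarrow> complex) \<Rightarrow> real \<Rightarrow> (real^'d \<Rightarrow> complex) \<Rightarrow> ennreal" where
  "coef_sum P \<phi> \<alpha> g = (\<integral>\<^sup>+k. (\<bar>\<alpha>\<bar> powr (CARD('d) * (1 - 1 / P)) * norm (coef \<phi> \<alpha> g k)) powr P \<partial>count_space UNIV)"

text \<open>The weight |\<phi> (\<alpha> x - k)| has mass at most V = B / |\<alpha>|^d, and the sum
  of these weights over k is at most B. The power mean inequality bounds |\<open>coef\<close>|^P by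
  V^(P - 1) \<open>J k\<close>; the normalising factor cancels |\<alpha>|^d, and summing
  \<open>J k\<close> over k supplies the last factor of B^P. The first conclusion gives the absolute
  convergence with which integrals of coefficients are later split and exchanged.\<close>

lemma
  fixes \<phi> g :: "real^'d \<Rightarrow> complex"
  assumes \<phi>: "sampling_kernel B \<phi>" and P: "1 \<le> P" and \<alpha>: "\<alpha> \<noteq> 0" and [measurable]: "g \<in> borel_measurable borel"
    and g: "Lint P g < \<infinity>"
  shows nn_integral_coef_le: "(\<integral>\<^sup>+x. norm (g x) * norm (\<phi> (\<alpha> *\<^sub>R x - lat k)) \<partial>lborel) \<le>
      ennreal ((B / \<bar>\<alpha>\<bar> ^ CARD('d)) powr (1 - 1 / P) * (B * enn2real (Lint P g)) powr (1 / P))"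
    and coef_sum_le: "coef_sum P \<phi> \<alpha> g \<le> ennreal (B powr P) * Lint P g"
proof -
  have [measurable]: "\<phi> \<in> borel_measurable borel"
    and B: "(\<integral>\<^sup>+x. norm (\<phi> x) \<partial>lborel) \<le> ennreal B"
    and per: "AE x in lborel. (\<integral>\<^sup>+k. norm (\<phi> (x - lat k)) \<partial>count_space UNIV) \<le> ennreal B"
    using \<phi> by (auto simp: sampling_kernel_def)
  have B1: "1 \<le> B" using sampling_kernel_ge_1[OF \<phi>] .
  define W where "W k x = norm (\<phi> (\<alpha> *\<^sub>R x - lat k))" for k x
  have [measurable]: "W k \<in> borel_measurable borel" for k by (simp add: W_def[abs_def])
  define D where "D = \<bar>\<alpha>\<bar> ^ CARD('d)"
  have D: "D > 0" using \<alpha> by (simp add: D_def)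
  define V where "V = B / D"
  have V: "V > 0" using D B1 by (simp add: V_def)
  have W: "(\<integral>\<^sup>+x. W k x \<partial>lborel) \<le> ennreal V" for k
  proof -
    have "ennreal D * (\<integral>\<^sup>+x. W k x \<partial>lborel) = (\<integral>\<^sup>+x. norm (\<phi> x) \<partial>lborel)"
      using nn_integral_lborel_affine[of "\<lambda>x. norm (\<phi> x)" \<alpha> "- lat k"] \<alpha> by (simp add: W_def D_def)
    also have "\<dots> \<le> ennreal D * ennreal V" using B D B1 by (simp add: V_def flip: ennreal_mult)
    finally show ?thesis using D by (subst (asm) ennreal_mult_le_mult_iff) auto
  qed
  define J where "J k = (\<integral>\<^sup>+x. norm (g x) powr P * W k x \<partial>lborel)" for k
  have "(\<integral>\<^sup>+k. J k \<partial>count_space UNIV) = (\<integral>\<^sup>+x. \<integral>\<^sup>+k. norm (g x) powr P * W k x \<partial>count_space UNIV \<partial>lborel)"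
    unfolding J_def by (rule nn_integral_count_space_nn_integral[symmetric]) auto
  also have "\<dots> \<le> (\<integral>\<^sup>+x. ennreal B * ennreal (norm (g x) powr P) \<partial>lborel)"
  proof (rule nn_integral_mono_AE)
    have "AE x in lborel. (\<integral>\<^sup>+k. W k x \<partial>count_space UNIV) \<le> ennreal B"
      using AE_lborel_affine[OF per \<alpha>, of 0] by (simp add: W_def)
    then show "AE x in lborel. (\<integral>\<^sup>+k. norm (g x) powr P * W k x \<partial>count_space UNIV) \<le> ennreal B * ennreal (norm (g x) powr P)"
    proof eventually_elim
      case (elim x)
      have "(\<integral>\<^sup>+k. norm (g x) powr P * W k x \<partial>count_space UNIV) = ennreal (norm (g x) powr P) * (\<integral>\<^sup>+k. W k x \<partial>count_space UNIV)"
        by (subst nn_integral_cmult[symmetric]) (auto simp: W_def ennreal_mult)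
      also have "\<dots> \<le> ennreal (norm (g x) powr P) * ennreal B"
        by (rule mult_left_mono[OF elim]) simp
      finally show ?case by (simp add: mult.commute)
    qed
  qed
  also have "\<dots> = ennreal B * Lint P g" by (simp add: nn_integral_cmult Lint_def)
  finally have sumJ: "(\<integral>\<^sup>+k. J k \<partial>count_space UNIV) \<le> ennreal B * Lint P g" .
  have Jle: "J k \<le> ennreal B * Lint P g" for k
    using nn_integral_ge_point[of k UNIV J] sumJ by simp
  then have Jfin: "J k < \<infinity>" for k
    by (rule le_less_trans) (use g in \<open>simp add: ennreal_mult_less_top\<close>)
  define j where "j k = enn2real (J k)" for k
  have j: "J k = ennreal (j k)" "0 \<le> j k" for k using Jfin[of k] by (auto simp: j_def)
  have bound: "(\<integral>\<^sup>+x. norm (g x) * W k x \<partial>lborel) \<le> ennreal (V powr (1 - 1 / P) * j k powr (1 / P))" for k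
    by (rule weighted_power_mean) (use P V j W in \<open>auto simp: W_def J_def\<close>)
  \<comment> \<open>The first conclusion is uniform in \<open>k\<close>, so the single term
    \<open>J k\<close> is estimated by the bound for the whole sum.\<close>
  have "j k \<le> B * enn2real (Lint P g)"
    using enn2real_mono[OF Jle[of k]] g B1 by (simp add: j_def enn2real_mult ennreal_mult_less_top)
  then have "V powr (1 - 1 / P) * j k powr (1 / P) \<le> V powr (1 - 1 / P) * (B * enn2real (Lint P g)) powr (1 / P)"
    using j(2) P by (intro mult_left_mono powr_mono2) auto
  with bound show "(\<integral>\<^sup>+x. norm (g x) * norm (\<phi> (\<alpha> *\<^sub>R x - lat k)) \<partial>lborel) \<le>
      ennreal ((B / \<bar>\<alpha>\<bar> ^ CARD('d)) powr (1 - 1 / P) * (B * enn2real (Lint P g)) powr (1 / P))"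
    unfolding W_def V_def D_def by (meson ennreal_leI order_trans)
  have c: "ennreal ((\<bar>\<alpha>\<bar> powr (CARD('d) * (1 - 1 / P)) * norm (coef \<phi> \<alpha> g k)) powr P) \<le> ennreal (B powr (P - 1)) * J k" for k
  proof -
    have "ennreal (norm (coef \<phi> \<alpha> g k)) \<le> (\<integral>\<^sup>+x. norm (g x) * W k x \<partial>lborel)"
      unfolding coef_def by (rule order.trans[OF norm_integral_le_nn_integral]) (simp add: norm_mult W_def)
    also note bound
    finally have n: "norm (coef \<phi> \<alpha> g k) \<le> V powr (1 - 1 / P) * j k powr (1 / P)"
      by (simp add: ennreal_le_iff)
    have "\<bar>\<alpha>\<bar> powr (CARD('d) * (1 - 1 / P)) = D powr (1 - 1 / P)"
      using \<alpha> by (simp add: D_def powr_powr flip: powr_realpow)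
    then have "\<bar>\<alpha>\<bar> powr (CARD('d) * (1 - 1 / P)) * norm (coef \<phi> \<alpha> g k) \<le> D powr (1 - 1 / P) * (V powr (1 - 1 / P) * j k powr (1 / P))"
      using n by (simp add: mult_left_mono)
    also have "\<dots> = B powr (1 - 1 / P) * j k powr (1 / P)"
      using D B1 by (simp add: V_def powr_divide)
    finally have "(\<bar>\<alpha>\<bar> powr (CARD('d) * (1 - 1 / P)) * norm (coef \<phi> \<alpha> g k)) powr P \<le> (B powr (1 - 1 / P) * j k powr (1 / P)) powr P"
      using P by (intro powr_mono2) auto
    also have "\<dots> = B powr (P - 1) * j k"
      using B1 j P by (simp add: powr_mult powr_powr left_diff_distrib)
    finally show ?thesis
      using j by (subst j(1), subst ennreal_mult[symmetric]) (auto intro!: ennreal_leI)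
  qed
  have "coef_sum P \<phi> \<alpha> g \<le> (\<integral>\<^sup>+k. ennreal (B powr (P - 1)) * J k \<partial>count_space UNIV)"
    unfolding coef_sum_def by (intro nn_integral_mono c)
  also have "\<dots> = ennreal (B powr (P - 1)) * (\<integral>\<^sup>+k. J k \<partial>count_space UNIV)"
    by (simp add: nn_integral_cmult)
  also have "\<dots> \<le> ennreal (B powr (P - 1)) * (ennreal B * Lint P g)"
    by (intro mult_left_mono sumJ) simp
  also have "\<dots> = ennreal (B powr P) * Lint P g"
  proof -
    have "ennreal (B powr (P - 1)) * ennreal B = ennreal (B powr P)"
      using B1 by (subst ennreal_mult[symmetric]) (auto simp: powr_diff)
    then show ?thesis by (simp add: mult.assoc[symmetric])
  qed
  finally show "coef_sum P \<phi> \<alpha> g \<le> ennreal (B powr P) * Lint P g" .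
qed


section \<open>Differences of weakly differentiable functions\<close>

lemma continuous_on_tensor:
  assumes "\<And>t. deriv_chain (\<beta> t)"
  shows "continuous_on UNIV (tensor (\<lambda>t. \<beta> t 0))"
proof -
  have "(\<beta> t 0 has_real_derivative \<beta> t (Suc 0) y) (at y)" for t y
    using assms by (simp add: deriv_chain_def)
  from has_derivative_tensor[of "\<lambda>t. \<beta> t 0", OF this] show ?thesis
    by (meson continuous_at_imp_continuous_on has_derivative_continuous)
qed

lemma tensor_eq_0:
  assumes "\<And>t y. y \<notin> {l $ t..u $ t} \<Longrightarrow> \<beta> t y = 0" "x \<notin> cbox l u"
  shows "tensor \<beta> x = 0"
  using assms by (force simp: tensor_def mem_box_cart)

lemma bounded_support:
  fixes w :: "'a::euclidean_space \<Rightarrow> complex"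
  assumes "continuous_on UNIV w" "\<And>x. x \<notin> cbox l u \<Longrightarrow> w x = 0"
  obtains K where "K \<ge> 0" "\<And>x. norm (w x) \<le> K * indicator (cbox l u) x"
proof -
  have "bounded (w ` cbox l u)"
    by (intro compact_imp_bounded compact_continuous_image continuous_on_subset[OF assms(1)]) auto
  then obtain K where "\<And>x. x \<in> cbox l u \<Longrightarrow> norm (w x) \<le> K" by (auto simp: bounded_iff)
  then have "norm (w x) \<le> \<bar>K\<bar> * indicator (cbox l u) x" for x
    using assms(2)[of x] by (force simp: indicator_def)
  then show thesis using that[of "\<bar>K\<bar>"] by simp
qed

lemma integrable_mult_bounded_support:
  fixes f w :: "'a::euclidean_space \<Rightarrow> complex"
  assumes "set_integrable lborel (cbox l u) f"
    and [measurable]: "f \<in> borel_measurable borel" "w \<in> borel_measurable borel"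
    and w: "\<And>x. norm (w x) \<le> K * indicator (cbox l u) x"
  shows "integrable lborel (\<lambda>x. f x * w x)"
proof (rule Bochner_Integration.integrable_bound)
  show "integrable lborel (\<lambda>x. K * norm (indicator (cbox l u) x *\<^sub>R f x))"
    using assms(1) unfolding set_integrable_def by (intro integrable_mult_right integrable_norm)
  show "AE x in lborel. norm (f x * w x) \<le> norm (K * norm (indicator (cbox l u) x *\<^sub>R f x))"
  proof (intro AE_I2)
    fix x
    have "norm (f x * w x) \<le> norm (f x) * (K * indicator (cbox l u) x)"
      unfolding norm_mult by (intro mult_left_mono w) simp
    also have "\<dots> \<le> norm (K * norm (indicator (cbox l u) x *\<^sub>R f x))"
      by (auto simp: indicator_def abs_mult mult.commute mult_right_mono)
    finally show "norm (f x * w x) \<le> norm (K * norm (indicator (cbox l u) x *\<^sub>R f x))" .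
  qed
qed measurable

text \<open>A translation by s v with 0 <= s <= 1 moves a point by at most |v|, so all translates of
  the support of \<open>w\<close> lie in one larger box, on which \<open>g\<close> is
  integrable.\<close>

lemma nn_integral_average_finite:
  fixes g w :: "real^'d \<Rightarrow> complex"
  assumes int: "\<And>l u. set_integrable lborel (cbox l u) g"
    and [measurable]: "g \<in> borel_measurable borel" "w \<in> borel_measurable borel"
    and w: "\<And>x. norm (w x) \<le> K * indicator (cbox l u) x" and K: "K \<ge> 0"
  shows "(\<integral>\<^sup>+s. \<integral>\<^sup>+x. norm (g (x + s *\<^sub>R v)) * norm (w x) \<partial>lborel \<partial>unif) < \<infinity>"
proof -
  define c where "c = (\<chi> i. norm v :: real^'d)"
  define A where "A = (\<integral>\<^sup>+x. norm (indicator (cbox (l - c) (u + c)) x *\<^sub>R g x) \<partial>lborel)"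
  have A: "A < \<infinity>"
    using int[of "l - c" "u + c"] unfolding set_integrable_def integrable_iff_bounded A_def by simp
  have "(\<integral>\<^sup>+x. norm (g (x + s *\<^sub>R v)) * norm (w x) \<partial>lborel) \<le> ennreal K * A" if s: "s \<in> {0..1}" for s
  proof -
    have "(\<integral>\<^sup>+x. norm (g (x + s *\<^sub>R v)) * norm (w x) \<partial>lborel) \<le>
        (\<integral>\<^sup>+x. ennreal K * norm (indicator (cbox (l - c) (u + c)) (x + s *\<^sub>R v) *\<^sub>R g (x + s *\<^sub>R v)) \<partial>lborel)"
    proof (rule nn_integral_mono)
      fix x
      have "x + s *\<^sub>R v \<in> cbox (l - c) (u + c)" if x: "x \<in> cbox l u"
      proof -
        have "\<bar>s * v $ i\<bar> \<le> norm v" for i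
          using s mult_mono[of "\<bar>s\<bar>" 1 "\<bar>v $ i\<bar>" "norm v"] component_le_norm_cart[of v i] by (simp add: abs_mult)
        then have "- norm v \<le> s * v $ i \<and> s * v $ i \<le> norm v" for i by (meson abs_le_D1 abs_le_D2 minus_le_iff)
        then show ?thesis using x by (auto simp: mem_box_cart c_def algebra_simps add_mono) (smt (verit))+
      qed
      then have "norm (w x) \<le> K * indicator (cbox (l - c) (u + c)) (x + s *\<^sub>R v)"
        using w[of x] K by (cases "x \<in> cbox l u") (auto simp: indicator_def)
      then have "norm (g (x + s *\<^sub>R v)) * norm (w x) \<le> K * norm (indicator (cbox (l - c) (u + c)) (x + s *\<^sub>R v) *\<^sub>R g (x + s *\<^sub>R v))"
        using mult_left_mono[of "norm (w x)" _ "norm (g (x + s *\<^sub>R v))"] by (fastforce simp: mult_ac)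
      then show "ennreal (norm (g (x + s *\<^sub>R v)) * norm (w x)) \<le> ennreal K * norm (indicator (cbox (l - c) (u + c)) (x + s *\<^sub>R v) *\<^sub>R g (x + s *\<^sub>R v))"
        using K by (simp add: ennreal_mult[symmetric] ennreal_leI)
    qed
    also have "\<dots> = ennreal K * A"
      unfolding A_def using nn_integral_shift[of "\<lambda>x. ennreal K * norm (indicator (cbox (l - c) (u + c)) x *\<^sub>R g x)" "s *\<^sub>R v"]
      by (simp add: nn_integral_cmult)
    finally show ?thesis .
  qed
  then have "(\<integral>\<^sup>+s. \<integral>\<^sup>+x. norm (g (x + s *\<^sub>R v)) * norm (w x) \<partial>lborel \<partial>unif) \<le> (\<integral>\<^sup>+s. ennreal K * A \<partial>unif)"
    using AE_unif by (intro nn_integral_mono_AE) auto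
  also have "\<dots> < \<infinity>" using A by (simp add: unif.emeasure_space_1[simplified] ennreal_mult_less_top)
  finally show ?thesis .
qed

lemma set_integrable_average:
  fixes g :: "real^'d \<Rightarrow> complex"
  assumes int: "\<And>l u. set_integrable lborel (cbox l u) g"
    and [measurable]: "g \<in> borel_measurable borel"
  shows "set_integrable lborel (cbox l u) (average v g)"
proof -
  have "integrable lborel (\<lambda>x. average v g x * indicator (cbox l u) x)"
    by (rule average_adjoint(1), measurable, rule nn_integral_average_finite[where K=1 and l=l and u=u])
       (auto simp: int indicator_def)
  then show ?thesis unfolding set_integrable_def
    by (rule Bochner_Integration.integrable_cong[THEN iffD1, rotated 2]) (auto simp: indicator_def)
qed

lemma set_integrable_shift:
  fixes f :: "real^'d \<Rightarrow> complex"
  assumes int: "\<And>l u. set_integrable lborel (cbox l u) f" and [measurable]: "f \<in> borel_measurable borel"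
  shows "set_integrable lborel (cbox l u) (\<lambda>x. f (x - c))"
proof -
  have ind: "indicat_real (cbox (l - c) (u - c)) (x + - c) = indicat_real (cbox l u) x" for x
    by (simp add: indicator_def mem_box_cart)
  have "(\<integral>\<^sup>+x. norm (indicator (cbox l u) x *\<^sub>R f (x - c)) \<partial>lborel) =
      (\<integral>\<^sup>+x. norm (indicator (cbox (l - c) (u - c)) x *\<^sub>R f x) \<partial>lborel)"
    using nn_integral_shift[of "\<lambda>x. norm (indicator (cbox (l - c) (u - c)) x *\<^sub>R f x)" "- c"]
    unfolding ind by simp
  also have "\<dots> < \<infinity>"
    using int[of "l - c" "u - c"] unfolding set_integrable_def integrable_iff_bounded by simp
  finally show ?thesis unfolding set_integrable_def integrable_iff_bounded by simp
qed

text \<open>Let e be \<open>h\<close> times the unit vector of direction \<open>t\<close>. Tested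
  against a product \<psi>, the difference becomes the integral of f (x) (\<psi> (x) - \<psi> (x +
  e)). This last bracket is -h times the partial derivative of \<Psi>, the average of \<psi> over
  the segment from x to x + e. Integration by parts gives h times the integral of g \<Psi>, and the
  adjoint formula moves the average onto \<open>g\<close>.\<close>

lemma weak_derivative_difference:
  fixes f g :: "real^'d \<Rightarrow> complex"
  assumes [measurable]: "f \<in> borel_measurable borel" "g \<in> borel_measurable borel"
    and f: "\<And>l u. set_integrable lborel (cbox l u) f" and g: "\<And>l u. set_integrable lborel (cbox l u) g"
    and weak: "\<And>\<psi>. test_function \<psi> \<Longrightarrow>
      (LINT x|lborel. f x * partial t \<psi> x) = - (LINT x|lborel. g x * \<psi> x)"
    and h: "h \<noteq> 0"
  shows "AE x in lborel. f x - f (x - h *\<^sub>R axis t 1) = of_real h * average (- (h *\<^sub>R axis t 1)) g x"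
proof -
  define e :: "real^'d" where "e = h *\<^sub>R axis t 1"
  define w where "w x = f x - f (x - e) - of_real h * average (- e) g x" for x
  have "AE x in lborel. w x = 0"
  proof (rule AE_zero_if_tensor_integrals_zero)
    show "set_integrable lborel (cbox l u) w" for l u
      unfolding w_def
      by (intro set_integral_diff set_integrable_mult_right set_integrable_average set_integrable_shift f g) measurable
  next
    fix \<beta> :: "'d \<Rightarrow> nat \<Rightarrow> real \<Rightarrow> real" and l u :: "real^'d"
    assume \<beta>: "\<And>t. deriv_chain (\<beta> t)" and supp: "\<And>t y. y \<notin> {l $ t..u $ t} \<Longrightarrow> \<beta> t 0 y = 0"
    define \<psi> where "\<psi> = tensor (\<lambda>t. \<beta> t 0)"
    obtain \<gamma> where \<gamma>: "deriv_chain \<gamma>" "\<And>x. \<gamma> 0 x = (LBINT s:{0..1}. \<beta> t 0 (x + s * h))"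
        "\<And>x. \<gamma> 1 x = (\<beta> t 0 (x + h) - \<beta> t 0 x) / h"
      using deriv_chain_average[OF \<beta>[of t] h] by blast
    define \<Psi> where "\<Psi> = tensor (\<lambda>s. (\<beta>(t := \<gamma>)) s 0)"
    have \<gamma>_chain: "deriv_chain ((\<beta>(t := \<gamma>)) s)" for s using \<beta> \<gamma>(1) by simp
    \<comment> \<open>The average reaches points at distance up to |h|, so the support grows by |h|;
      both sides are enlarged because the sign of \<open>h\<close> is open.\<close>
    define l' u' where "l' = (\<chi> s. l $ s - \<bar>h\<bar>)" and "u' = (\<chi> s. u $ s + \<bar>h\<bar>)"
    have supp': "(\<beta>(t := \<gamma>)) s 0 y = 0" if y: "y \<notin> {l' $ s..u' $ s}" for s y
    proof (cases "s = t")
      case True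
      have "\<beta> t 0 (y + r * h) = 0" if "r \<in> {0..1}" for r
      proof (rule supp)
        have "\<bar>r * h\<bar> \<le> \<bar>h\<bar>" using that by (auto simp: abs_mult mult_left_le_one_le)
        then show "y + r * h \<notin> {l $ t..u $ t}" using y True by (auto simp: l'_def u'_def)
      qed
      then have "\<gamma> 0 y = 0" unfolding \<gamma>(2) set_lebesgue_integral_def
        by (intro integral_eq_zero_AE AE_I2) (auto simp: indicator_def)
      then show ?thesis using True by simp
    next
      case False
      moreover have "y \<notin> {l $ s..u $ s}" using y by (auto simp: l'_def u'_def)
      ultimately show ?thesis using supp[of y s] by simp
    qed
    have cont: "continuous_on UNIV \<psi>" "continuous_on UNIV \<Psi>"
      unfolding \<psi>_def \<Psi>_def by (intro continuous_on_tensor \<beta> \<gamma>_chain)+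
    then have [measurable]: "\<psi> \<in> borel_measurable borel" "\<Psi> \<in> borel_measurable borel"
      by (auto intro: borel_measurable_continuous_onI)
    have test: "test_function \<Psi>"
      unfolding \<Psi>_def by (intro test_function_tensor[where l=l' and u=u'] \<gamma>_chain supp')
    have \<psi>0: "\<psi> x = 0" if "x \<notin> cbox l u" for x
      unfolding \<psi>_def using that by (rule tensor_eq_0[rotated]) (rule supp)
    obtain K where K: "K \<ge> 0" "\<And>x. norm (\<psi> x) \<le> K * indicator (cbox l u) x"
      using bounded_support[OF cont(1) \<psi>0] by blast
    have split: "(\<Prod>s\<in>UNIV. (\<beta>'(t := F)) s (x $ s)) = F (x $ t) * (\<Prod>s\<in>UNIV - {t}. \<beta>' s (x $ s))"
      for F \<beta>' and x :: "real^'d"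
      by (subst prod.remove[of _ t]) (auto intro!: prod.cong)
    have partial: "partial t \<Psi> x = (\<psi> (x + e) - \<psi> x) / of_real h" for x
    proof -
      have D: "((\<beta>(t := \<gamma>)) s 0 has_real_derivative (\<beta>(t := \<gamma>)) s 1 y) (at y)" for s y
        using \<gamma>_chain[of s] by (auto simp: deriv_chain_def)
      have "partial t \<Psi> x = of_real (\<Prod>s\<in>UNIV. ((\<lambda>s. (\<beta>(t := \<gamma>)) s 0)(t := \<gamma> 1)) s (x $ s))"
        unfolding \<Psi>_def by (subst partial_tensor[where \<beta>'="\<lambda>s. (\<beta>(t := \<gamma>)) s 1", OF D]) (simp add: tensor_def)
      also have "\<dots> = of_real ((\<beta> t 0 (x $ t + h) - \<beta> t 0 (x $ t)) / h * (\<Prod>s\<in>UNIV - {t}. \<beta> s 0 (x $ s)))"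
        unfolding split \<gamma>(3) by (intro arg_cong[where f=of_real] arg_cong2[where f="(*)"] refl prod.cong) auto
      also have "\<dots> = (of_real (\<beta> t 0 (x $ t + h) * (\<Prod>s\<in>UNIV - {t}. \<beta> s 0 (x $ s)))
            - of_real (\<beta> t 0 (x $ t) * (\<Prod>s\<in>UNIV - {t}. \<beta> s 0 (x $ s)))) / of_real h"
        by (simp add: field_simps)
      also have "\<beta> t 0 (x $ t + h) * (\<Prod>s\<in>UNIV - {t}. \<beta> s 0 (x $ s)) = (\<Prod>s\<in>UNIV. \<beta> s 0 ((x + e) $ s))"
        by (subst prod.remove[of _ t]) (auto simp: e_def axis_def intro!: prod.cong)
      also have "\<beta> t 0 (x $ t) * (\<Prod>s\<in>UNIV - {t}. \<beta> s 0 (x $ s)) = (\<Prod>s\<in>UNIV. \<beta> s 0 (x $ s))"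
        by (subst prod.remove[of _ t]) auto
      finally show ?thesis by (simp add: \<psi>_def tensor_def)
    qed
    \<comment> \<open>Only the factor \<open>t\<close> varies along the segment, so averaging the
      product means averaging this factor, which gives \<open>\<gamma> 0\<close>.\<close>
    have avg: "average (- (- e)) \<psi> x = \<Psi> x" for x
    proof -
      define R where "R = (\<Prod>s\<in>UNIV - {t}. \<beta> s 0 (x $ s))"
      have \<psi>s: "\<psi> (x + s *\<^sub>R e) = of_real (\<beta> t 0 (x $ t + s * h)) * of_real R" for s
      proof -
        have "(\<Prod>r\<in>UNIV. \<beta> r 0 ((x + s *\<^sub>R e) $ r)) = \<beta> t 0 (x $ t + s * h) * R"
          unfolding R_def by (subst prod.remove[of _ t]) (auto simp: e_def axis_def intro!: prod.cong)
        then show ?thesis unfolding \<psi>_def tensor_def by (metis of_real_mult)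
      qed
      have cb: "continuous_on UNIV (\<beta> t 0)"
        using \<beta>[of t] by (auto intro!: continuous_at_imp_continuous_on DERIV_isCont simp: deriv_chain_def)
      have [measurable]: "(\<lambda>s. \<beta> t 0 (x $ t + s * h)) \<in> borel_measurable borel"
        by (intro borel_measurable_continuous_onI continuous_on_compose2[OF cb] continuous_intros) auto
      have "average (- (- e)) \<psi> x = (LINT s|unif. of_real (\<beta> t 0 (x $ t + s * h)) * of_real R)"
        by (simp add: average_def \<psi>s)
      also have "\<dots> = of_real (LINT s|unif. \<beta> t 0 (x $ t + s * h)) * of_real R"
        by (simp only: integral_mult_left_zero integral_complex_of_real)
      also have "(LINT s|unif. \<beta> t 0 (x $ t + s * h)) = \<gamma> 0 (x $ t)"
        unfolding \<gamma>(2) by (rule integral_unif) measurable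
      also have "complex_of_real (\<gamma> 0 (x $ t)) * of_real R = of_real (\<gamma> 0 (x $ t) * R)" by simp
      also have "\<gamma> 0 (x $ t) * R = (\<Prod>s\<in>UNIV. (\<beta>(t := \<gamma>)) s 0 (x $ s))"
        unfolding R_def by (subst prod.remove[of UNIV t]) (auto intro!: prod.cong)
      finally show ?thesis by (simp only: \<Psi>_def tensor_def)
    qed
    have i1: "integrable lborel (\<lambda>x. f x * \<psi> x)"
      by (rule integrable_mult_bounded_support[OF f _ _ K(2)]) measurable
    have i2: "integrable lborel (\<lambda>x. f (x - e) * \<psi> x)"
      by (rule integrable_mult_bounded_support[OF set_integrable_shift[OF f] _ _ K(2)]) measurable
    have fin: "(\<integral>\<^sup>+s. \<integral>\<^sup>+x. norm (g (x + s *\<^sub>R - e)) * norm (\<psi> x) \<partial>lborel \<partial>unif) < \<infinity>"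
      by (rule nn_integral_average_finite[OF g _ _ K(2,1)]) measurable
    have i3: "integrable lborel (\<lambda>x. average (- e) g x * \<psi> x)"
      by (rule average_adjoint(1)[OF _ _ fin]) measurable
    have "norm (\<psi> (x + e)) \<le> K * indicator (cbox (l - e) (u - e)) x" for x
      using K(2)[of "x + e"] by (simp add: indicator_def mem_box_cart algebra_simps)
    then have i4: "integrable lborel (\<lambda>x. f x * \<psi> (x + e))"
      by (rule integrable_mult_bounded_support[OF f, rotated 2]) measurable
    have s2: "(LINT x|lborel. f (x - e) * \<psi> x) = (LINT x|lborel. f x * \<psi> (x + e))"
      using integral_shift[of "\<lambda>x. f (x - e) * \<psi> x" e] by simp
    have "(LINT x|lborel. f x * \<psi> x) - (LINT x|lborel. f x * \<psi> (x + e)) = (LINT x|lborel. f x * \<psi> x - f x * \<psi> (x + e))"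
      using i1 i4 by simp
    also have "\<dots> = (LINT x|lborel. - of_real h * (f x * partial t \<Psi> x))"
      using h by (intro Bochner_Integration.integral_cong refl) (simp add: partial field_simps)
    also have "\<dots> = of_real h * (LINT x|lborel. g x * \<Psi> x)"
      by (simp only: integral_mult_right_zero weak[OF test]) simp
    also have "(LINT x|lborel. g x * \<Psi> x) = (LINT x|lborel. average (- e) g x * \<psi> x)"
      unfolding avg[symmetric] by (rule average_adjoint(2)[OF _ _ fin, symmetric]) measurable
    finally have eq: "(LINT x|lborel. f x * \<psi> x) - (LINT x|lborel. f (x - e) * \<psi> x) = of_real h * (LINT x|lborel. average (- e) g x * \<psi> x)"
      unfolding s2 .
    have "(LINT x|lborel. w x * \<psi> x) = (LINT x|lborel. f x * \<psi> x - f (x - e) * \<psi> x - of_real h * (average (- e) g x * \<psi> x))"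
      by (simp add: w_def algebra_simps)
    also have "\<dots> = (LINT x|lborel. f x * \<psi> x) - (LINT x|lborel. f (x - e) * \<psi> x) - of_real h * (LINT x|lborel. average (- e) g x * \<psi> x)"
      using i1 i2 i3 by simp
    also have "\<dots> = 0" using eq by simp
    finally show "(LINT x|lborel. w x * tensor (\<lambda>t. \<beta> t 0) x) = 0" unfolding \<psi>_def .
  qed
  then show ?thesis by (simp add: w_def e_def)
qed


section \<open>Density of continuous functions\<close>

text \<open>A crude constant obtained through the maximum replaces Minkowski's inequality, so that
  all estimates can stay with P-th powers.\<close>

lemma powr_norm_add_le:
  fixes a b :: "'a::real_normed_vector"
  assumes "1 \<le> P"
  shows "norm (a + b) powr P \<le> 2 powr P * (norm a powr P + norm b powr P)"
proof -
  have "norm (a + b) powr P \<le> (2 * max (norm a) (norm b)) powr P"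
    using norm_triangle_ineq[of a b] assms by (intro powr_mono2) auto
  also have "\<dots> = 2 powr P * max (norm a) (norm b) powr P" by (simp add: powr_mult)
  also have "\<dots> \<le> 2 powr P * (norm a powr P + norm b powr P)" by (auto simp: max_def)
  finally show ?thesis .
qed

lemma Lint_add_le:
  assumes "1 \<le> P" and [measurable]: "f \<in> borel_measurable borel" "g \<in> borel_measurable borel"
  shows "Lint P (\<lambda>x. f x + g x) \<le> ennreal (2 powr P) * (Lint P f + Lint P g)"
proof -
  have "Lint P (\<lambda>x. f x + g x) \<le> (\<integral>\<^sup>+x. ennreal (2 powr P) * (norm (f x) powr P + norm (g x) powr P) \<partial>lborel)"
    unfolding Lint_def by (intro nn_integral_mono) (simp add: powr_norm_add_le[OF assms(1)] ennreal_mult[symmetric] ennreal_leI del: ennreal_plus)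
  also have "\<dots> = ennreal (2 powr P) * (Lint P f + Lint P g)"
    unfolding Lint_def by (simp add: nn_integral_cmult nn_integral_add)
  finally show ?thesis .
qed

lemma set_integrable_if_Lint_finite:
  fixes f :: "real^'d \<Rightarrow> complex"
  assumes "1 \<le> P" and [measurable]: "f \<in> borel_measurable borel" and "Lint P f < \<infinity>"
  shows "set_integrable lborel (cbox l u) f"
  unfolding set_integrable_def integrable_iff_bounded
proof
  have "norm (f x) \<le> 1 + norm (f x) powr P" for x
  proof (cases "norm (f x) \<le> 1")
    case False
    then show ?thesis using powr_mono[of 1 P "norm (f x)"] assms(1) by simp
  qed (simp add: add_increasing2)
  then have "(\<integral>\<^sup>+x. norm (indicator (cbox l u) x *\<^sub>R f x) \<partial>lborel) \<le> (\<integral>\<^sup>+x. indicator (cbox l u) x + ennreal (norm (f x) powr P) \<partial>lborel)"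
    by (intro nn_integral_mono) (auto simp: indicator_def ennreal_leI simp flip: ennreal_1 ennreal_plus)
  also have "\<dots> = emeasure lborel (cbox l u) + Lint P f" unfolding Lint_def by (simp add: nn_integral_add)
  also have "\<dots> < \<infinity>" using assms(3) emeasure_lborel_cbox_finite[of l u] by (simp add: ennreal_add_less_top)
  finally show "(\<integral>\<^sup>+x. norm (indicator (cbox l u) x *\<^sub>R f x) \<partial>lborel) < \<infinity>" .
qed measurable

text \<open>Measurability provides continuous functions that converge to \<open>f\<close> off a null
  set, without control of size or support. Projecting the values onto the ball of radius
  \<open>N\<close> and multiplying by a cutoff yields a common dominating function. The limit is
  unchanged, since \<open>f\<close> is bounded by \<open>N\<close> and vanishes outside radius
  \<open>N\<close>.\<close>

lemma dense_bounded_support: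
  fixes f :: "real^'d \<Rightarrow> complex"
  assumes [measurable]: "f \<in> borel_measurable borel" and P: "1 \<le> P"
    and N: "\<And>x. norm (f x) \<le> N" "\<And>x. norm x > N \<Longrightarrow> f x = 0" and "\<epsilon> > 0"
  obtains c K where "continuous_on UNIV c" "\<And>x. norm (c x) \<le> K" "Lint P (\<lambda>x. f x - c x) < \<epsilon>"
proof -
  have N0: "N \<ge> 0" using N(1) norm_ge_zero order_trans by blast
  have "f measurable_on UNIV"
    by (rule lebesgue_measurable_imp_measurable_on) (auto intro: measurable_completion)
  then obtain Z g where Z: "negligible Z" and g: "\<And>n. continuous_on UNIV (g n)" "\<And>x. x \<notin> Z \<Longrightarrow> (\<lambda>n. g n x) \<longlonglongrightarrow> f x"
    by (auto simp: measurable_on_def)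
  define \<eta> where "\<eta> = closest_point (cball (0::complex) N)"
  define \<kappa> where "\<kappa> x = max 0 (min 1 (N + 1 - norm x))" for x :: "real^'d"
  define c where "c n x = \<kappa> x *\<^sub>R \<eta> (g n x)" for n x
  have \<eta>: "continuous_on UNIV \<eta>" "norm (\<eta> z) \<le> N" "norm z \<le> N \<Longrightarrow> \<eta> z = z" for z
    using N0 closest_point_in_set[of "cball (0::complex) N" z] closest_point_self[of z "cball (0::complex) N"]
    by (auto simp: \<eta>_def intro!: continuous_on_closest_point)
  have \<kappa>: "0 \<le> \<kappa> x" "\<kappa> x \<le> 1" "norm x \<le> N \<Longrightarrow> \<kappa> x = 1" "\<kappa> x \<noteq> 0 \<Longrightarrow> norm x \<le> N + 1" for x
    by (auto simp: \<kappa>_def)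
  have c: "continuous_on UNIV (c n)" for n
    unfolding c_def \<kappa>_def by (intro continuous_intros continuous_on_compose2[OF \<eta>(1) g(1)]) auto
  then have [measurable]: "c n \<in> borel_measurable borel" for n by (rule borel_measurable_continuous_onI)
  have cN: "norm (c n x) \<le> N" for n x
    using mult_mono[OF \<kappa>(2) \<eta>(2)[of "g n x"]] \<kappa>(1)[of x] by (simp add: c_def)
  have lim: "(\<lambda>n. c n x) \<longlonglongrightarrow> f x" if "x \<notin> Z" for x
  proof -
    have "(\<lambda>n. \<eta> (g n x)) \<longlonglongrightarrow> \<eta> (f x)"
      by (rule continuous_on_tendsto_compose[OF \<eta>(1) g(2)[OF that]]) auto
    then have "(\<lambda>n. c n x) \<longlonglongrightarrow> \<kappa> x *\<^sub>R f x"
      unfolding c_def using \<eta>(3)[OF N(1)] by (intro tendsto_intros) simp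
    moreover have "\<kappa> x *\<^sub>R f x = f x"
      using \<kappa>(3)[of x] N(2)[of x] by (cases "norm x \<le> N") auto
    ultimately show ?thesis by simp
  qed
  have "(\<lambda>n. \<integral>\<^sup>+x. norm (f x - c n x) powr P \<partial>lborel) \<longlonglongrightarrow> (\<integral>\<^sup>+x. 0 \<partial>(lborel :: (real^'d) measure))"
  proof (rule nn_integral_dominated_convergence[where w="\<lambda>x. ennreal ((2 * N) powr P) * indicator (cball 0 (N + 1)) x"])
    show "AE x in lborel. ennreal (norm (f x - c n x) powr P) \<le> ennreal ((2 * N) powr P) * indicator (cball 0 (N + 1)) x" for n
    proof (intro AE_I2)
      fix x
      have "f x - c n x = 0" if "x \<notin> cball 0 (N + 1)"
        using N(2)[of x] \<kappa>(4)[of x] that by (auto simp: c_def)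
      moreover have "norm (f x - c n x) powr P \<le> (2 * N) powr P"
        using norm_triangle_ineq4[of "f x" "c n x"] N(1)[of x] cN[of n x] P by (intro powr_mono2) auto
      ultimately show "ennreal (norm (f x - c n x) powr P) \<le> ennreal ((2 * N) powr P) * indicator (cball 0 (N + 1)) x"
        by (cases "x \<in> cball 0 (N + 1)") (auto intro: ennreal_leI)
    qed
    show "(\<integral>\<^sup>+x. ennreal ((2 * N) powr P) * indicator (cball (0::real^'d) (N + 1)) x \<partial>lborel) < \<infinity>"
      using emeasure_bounded_finite[of "cball (0::real^'d) (N + 1)"]
      by (subst nn_integral_cmult_indicator) (auto simp: ennreal_mult_less_top)
    have "AE x in lebesgue. x \<notin> Z" using Z by (simp add: negligible_iff_null_sets AE_not_in)
    then have "AE x in lborel. x \<notin> Z" by (simp add: AE_completion_iff)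
    then show "AE x in lborel. (\<lambda>n. ennreal (norm (f x - c n x) powr P)) \<longlonglongrightarrow> 0"
    proof eventually_elim
      case (elim x)
      have "(\<lambda>n. norm (f x - c n x) powr P) \<longlonglongrightarrow> norm (f x - f x) powr P"
        using P by (intro tendsto_powr2 tendsto_intros lim[OF elim]) auto
      then show ?case using P by (simp add: tendsto_ennrealI[of _ 0, simplified])
    qed
  next
    show "(\<lambda>x. ennreal (norm (f x - c n x) powr P)) \<in> borel_measurable lborel" for n
      by measurable
    show "(\<lambda>x. ennreal ((2 * N) powr P) * indicator (cball 0 (N + 1)) x) \<in> borel_measurable (lborel :: (real^'d) measure)"
      by (intro borel_measurable_times_ennreal borel_measurable_const borel_measurable_indicator) simp
  qed measurable
  then have "eventually (\<lambda>n. Lint P (\<lambda>x. f x - c n x) < \<epsilon>) sequentially"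
    using \<open>\<epsilon> > 0\<close> unfolding Lint_def by (simp add: order_tendstoD)
  then obtain n where "Lint P (\<lambda>x. f x - c n x) < \<epsilon>" by (auto simp: eventually_sequentially)
  then show thesis using that c cN by blast
qed

lemma dense_continuous:
  fixes f :: "real^'d \<Rightarrow> complex"
  assumes [measurable]: "f \<in> borel_measurable borel" and P: "1 \<le> P"
    and f: "Lint P f < \<infinity>" and "\<epsilon> > 0"
  obtains c K where "continuous_on UNIV c" "\<And>x. norm (c x) \<le> K" "Lint P (\<lambda>x. f x - c x) < ennreal \<epsilon>"
proof -
  define F where "F n x = (if norm x \<le> real n \<and> norm (f x) \<le> real n then f x else 0)" for n x
  have [measurable]: "F n \<in> borel_measurable borel" for n unfolding F_def[abs_def] by measurable
  have "(\<lambda>n. \<integral>\<^sup>+x. norm (f x - F n x) powr P \<partial>lborel) \<longlonglongrightarrow> (\<integral>\<^sup>+x. 0 \<partial>(lborel :: (real^'d) measure))"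
  proof (rule nn_integral_dominated_convergence[where w="\<lambda>x. norm (f x) powr P"])
    show "AE x in lborel. (\<lambda>n. ennreal (norm (f x - F n x) powr P)) \<longlonglongrightarrow> 0"
    proof (intro AE_I2)
      fix x
      obtain N where "max (norm x) (norm (f x)) \<le> real N" using real_arch_simple by blast
      then have "ennreal (norm (f x - F n x) powr P) = 0" if "n \<ge> N" for n
        using that by (auto simp: F_def)
      then have "eventually (\<lambda>n. ennreal (norm (f x - F n x) powr P) = 0) sequentially"
        by (auto simp: eventually_sequentially)
      then show "(\<lambda>n. ennreal (norm (f x - F n x) powr P)) \<longlonglongrightarrow> 0" by (rule tendsto_eventually)
    qed
    show "AE x in lborel. ennreal (norm (f x - F n x) powr P) \<le> ennreal (norm (f x) powr P)" for n
      using P by (intro AE_I2) (auto simp: F_def)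
  qed (use f in \<open>simp_all add: Lint_def\<close>)
  \<comment> \<open>Two errors below \<open>\<delta>\<close> are added at the price of the factor
    2^P in \<open>Lint_add_le\<close>, which leaves less than \<open>\<epsilon>\<close>.\<close>
  moreover define \<delta> where "\<delta> = \<epsilon> / (2 * 2 powr P)"
  moreover have \<delta>: "\<delta> > 0" using \<open>\<epsilon> > 0\<close> by (simp add: \<delta>_def)
  ultimately have "eventually (\<lambda>n. Lint P (\<lambda>x. f x - F n x) < ennreal \<delta>) sequentially"
    unfolding Lint_def by (simp add: order_tendstoD)
  then obtain n where n: "Lint P (\<lambda>x. f x - F n x) < ennreal \<delta>" by (auto simp: eventually_sequentially)
  obtain c K where c: "continuous_on UNIV c" "\<And>x. norm (c x) \<le> K" "Lint P (\<lambda>x. F n x - c x) < ennreal \<delta>"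
    by (rule dense_bounded_support[of "F n" P "real n" "ennreal \<delta>"]) (use P \<delta> in \<open>auto simp: F_def\<close>)
  have [measurable]: "c \<in> borel_measurable borel" using c(1) by (rule borel_measurable_continuous_onI)
  have "Lint P (\<lambda>x. f x - c x) = Lint P (\<lambda>x. (f x - F n x) + (F n x - c x))" by simp
  also have "\<dots> \<le> ennreal (2 powr P) * (Lint P (\<lambda>x. f x - F n x) + Lint P (\<lambda>x. F n x - c x))"
    by (rule Lint_add_le[OF P]) measurable
  also have "\<dots> < ennreal (2 powr P) * (ennreal \<delta> + ennreal \<delta>)"
    by (intro ennreal_mult_strict_left_mono add_strict_mono n c(3)) auto
  also have "\<dots> = ennreal \<epsilon>"
    using \<delta> by (simp add: \<delta>_def flip: ennreal_plus ennreal_mult)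
  finally show thesis using that c by blast
qed


section \<open>Bounds for the sampled coefficients\<close>

lemma borel_measurable_cnj [measurable (raw)]:
  "f \<in> borel_measurable M \<Longrightarrow> (\<lambda>x. cnj (f x)) \<in> borel_measurable M"
  by (rule measurable_compose[where g=cnj, OF _ borel_measurable_continuous_onI]) (auto intro: continuous_intros)

text \<open>Translates of the kernel occur along the segment in \<open>coef_diff\<close>; as they
  share the bound \<open>B\<close>, the estimates there are uniform along the segment.\<close>

lemma sampling_kernel_shift:
  fixes \<phi> :: "real^'d \<Rightarrow> complex"
  assumes "sampling_kernel B \<phi>"
  shows "sampling_kernel B (\<lambda>x. \<phi> (x + v))"
proof -
  have [measurable]: "\<phi> \<in> borel_measurable borel"
    and per: "AE x in lborel. (\<integral>\<^sup>+k. norm (\<phi> (x - lat k)) \<partial>count_space UNIV) \<le> ennreal B"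
    using assms by (auto simp: sampling_kernel_def)
  have "AE x in lborel. (\<integral>\<^sup>+k. norm (\<phi> (x - lat k + v)) \<partial>count_space UNIV) \<le> ennreal B"
    using AE_lborel_affine[OF per, of 1 v] by (simp add: algebra_simps)
  moreover have "(\<integral>\<^sup>+x. norm (\<phi> (x + v)) \<partial>lborel) = (\<integral>\<^sup>+x. norm (\<phi> x) \<partial>lborel)"
    by (rule nn_integral_shift) measurable
  ultimately show ?thesis
    using assms by (simp add: sampling_kernel_def integral_shift)
qed

lemma integrable_coef:
  fixes \<phi> g :: "real^'d \<Rightarrow> complex"
  assumes "sampling_kernel B \<phi>" "1 \<le> P" "\<alpha> \<noteq> 0" and [measurable]: "g \<in> borel_measurable borel" and "Lint P g < \<infinity>"
  shows "integrable lborel (\<lambda>x. g x * cnj (\<phi> (\<alpha> *\<^sub>R x - lat k)))"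
  unfolding integrable_iff_bounded
proof
  have [measurable]: "\<phi> \<in> borel_measurable borel" using assms(1) by (simp add: sampling_kernel_def)
  show "(\<lambda>x. g x * cnj (\<phi> (\<alpha> *\<^sub>R x - lat k))) \<in> borel_measurable lborel" by measurable
  show "(\<integral>\<^sup>+x. norm (g x * cnj (\<phi> (\<alpha> *\<^sub>R x - lat k))) \<partial>lborel) < \<infinity>"
    using nn_integral_coef_le[OF assms, of k] by (simp add: norm_mult le_less_trans)
qed

text \<open>Lowering \<open>k\<close> by a unit vector translates the kernel by that vector in its
  own variable, hence by 1 / \<alpha> times it in \<open>x\<close>; so the difference falls on
  \<open>f\<close> with step h = 1 / \<alpha>. The difference formula contributes the factor
  \<open>h\<close>, and the adjoint formula moves the average onto the kernel, where rescaling
  restores a unit step.\<close>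

lemma coef_diff:
  fixes \<phi> f g :: "real^'d \<Rightarrow> complex"
  assumes \<phi>: "sampling_kernel B \<phi>" and P: "1 \<le> P" and \<alpha>: "\<alpha> \<noteq> 0"
    and [measurable]: "f \<in> borel_measurable borel" "g \<in> borel_measurable borel"
    and f: "Lint P f < \<infinity>" and g: "Lint P g < \<infinity>"
    and weak: "\<And>\<psi>. test_function \<psi> \<Longrightarrow>
      (LINT x|lborel. f x * partial t \<psi> x) = - (LINT x|lborel. g x * \<psi> x)"
  shows "diff t (coef \<phi> \<alpha> f) k = coef (average (axis t 1) \<phi>) \<alpha> g k / of_real \<alpha>"
proof -
  have [measurable]: "\<phi> \<in> borel_measurable borel" using \<phi> by (simp add: sampling_kernel_def)
  define h where "h = 1 / \<alpha>"
  define e :: "real^'d" where "e = axis t 1"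
  define w where "w x = cnj (\<phi> (\<alpha> *\<^sub>R x - lat k))" for x
  have [measurable]: "w \<in> borel_measurable borel" unfolding w_def[abs_def] by measurable
  have h: "h \<noteq> 0" "\<alpha> * h = 1" using \<alpha> by (auto simp: h_def)
  have wshift: "w (x + s *\<^sub>R (h *\<^sub>R e)) = cnj (\<phi> (\<alpha> *\<^sub>R x - lat k + s *\<^sub>R e))" for x s
  proof -
    have "\<alpha> * (s * h) = s" using h by (simp add: mult.left_commute)
    then have "\<alpha> *\<^sub>R (x + s *\<^sub>R (h *\<^sub>R e)) - lat k = \<alpha> *\<^sub>R x - lat k + s *\<^sub>R e"
      by (simp add: scaleR_add_right)
    then show ?thesis unfolding w_def by (rule arg_cong)
  qed
  have i1: "integrable lborel (\<lambda>x. f x * w x)"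
    unfolding w_def by (rule integrable_coef[OF \<phi> P \<alpha> _ f]) measurable
  have fsh: "Lint P (\<lambda>x. f (x - h *\<^sub>R e)) < \<infinity>"
    using f nn_integral_shift[of "\<lambda>x. norm (f x) powr P" "- (h *\<^sub>R e)"] by (simp add: Lint_def)
  have i2: "integrable lborel (\<lambda>x. f (x - h *\<^sub>R e) * w x)"
    unfolding w_def by (rule integrable_coef[OF \<phi> P \<alpha> _ fsh]) measurable
  have "coef \<phi> \<alpha> f (k - axis t 1) = (LINT x|lborel. f x * w (x + h *\<^sub>R e))"
    using wshift[of _ 1] by (simp add: coef_def lat_simps e_def algebra_simps)
  also have "\<dots> = (LINT x|lborel. f (x - h *\<^sub>R e) * w x)"
    using integral_shift[of "\<lambda>x. f (x - h *\<^sub>R e) * w x" "h *\<^sub>R e"] by simp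
  finally have "diff t (coef \<phi> \<alpha> f) k = (LINT x|lborel. f x * w x) - (LINT x|lborel. f (x - h *\<^sub>R e) * w x)"
    by (simp add: diff_def coef_def w_def)
  also have "\<dots> = (LINT x|lborel. (f x - f (x - h *\<^sub>R e)) * w x)"
    using i1 i2 by (simp add: left_diff_distrib)
  also have "\<dots> = (LINT x|lborel. of_real h * (average (- (h *\<^sub>R e)) g x * w x))"
  proof (rule integral_cong_AE)
    have "AE x in lborel. f x - f (x - h *\<^sub>R e) = of_real h * average (- (h *\<^sub>R e)) g x"
      unfolding e_def
      by (rule weak_derivative_difference[OF _ _ _ _ weak h(1)]) (use P f g in \<open>auto intro: set_integrable_if_Lint_finite\<close>)
    then show "AE x in lborel. (f x - f (x - h *\<^sub>R e)) * w x = of_real h * (average (- (h *\<^sub>R e)) g x * w x)"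
      by eventually_elim simp
  qed measurable
  also have "\<dots> = of_real h * (LINT x|lborel. average (- (h *\<^sub>R e)) g x * w x)"
    by simp
  also have "(LINT x|lborel. average (- (h *\<^sub>R e)) g x * w x) = (LINT x|lborel. g x * average (- (- (h *\<^sub>R e))) w x)"
  proof (rule average_adjoint(2))
    \<comment> \<open>\<open>K\<close> does not depend on \<open>s\<close>: after a translation the
      integrand pairs \<open>g\<close> with a translate of the kernel, which has the same bound
      \<open>B\<close>.\<close>
    define K where "K = ennreal ((B / \<bar>\<alpha>\<bar> ^ CARD('d)) powr (1 - 1 / P) * (B * enn2real (Lint P g)) powr (1 / P))"
    have "(\<integral>\<^sup>+x. norm (g (x + s *\<^sub>R - (h *\<^sub>R e))) * norm (w x) \<partial>lborel) \<le> K" for s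
    proof -
      have "(\<integral>\<^sup>+x. norm (g (x + s *\<^sub>R - (h *\<^sub>R e))) * norm (w x) \<partial>lborel) =
          (\<integral>\<^sup>+x. norm (g x) * norm (\<phi> (\<alpha> *\<^sub>R x - lat k + s *\<^sub>R e)) \<partial>lborel)"
        using nn_integral_shift[of "\<lambda>x. norm (g (x + s *\<^sub>R - (h *\<^sub>R e))) * norm (w x)" "s *\<^sub>R (h *\<^sub>R e)"]
        unfolding wshift by simp
      also have "\<dots> \<le> K"
        unfolding K_def by (rule nn_integral_coef_le[OF sampling_kernel_shift[OF \<phi>] P \<alpha> _ g]) measurable
      finally show ?thesis .
    qed
    then have "(\<integral>\<^sup>+s. \<integral>\<^sup>+x. norm (g (x + s *\<^sub>R - (h *\<^sub>R e))) * norm (w x) \<partial>lborel \<partial>unif) \<le> (\<integral>\<^sup>+s. K \<partial>unif)"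
      by (intro nn_integral_mono)
    also have "\<dots> < \<infinity>" by (simp add: unif.emeasure_space_1[simplified] K_def)
    finally show "(\<integral>\<^sup>+s. \<integral>\<^sup>+x. norm (g (x + s *\<^sub>R - (h *\<^sub>R e))) * norm (w x) \<partial>lborel \<partial>unif) < \<infinity>" .
  qed measurable
  finally have "diff t (coef \<phi> \<alpha> f) k = of_real h * (LINT x|lborel. g x * average (- (- (h *\<^sub>R e))) w x)" .
  moreover have "average (- (- (h *\<^sub>R e))) w x = cnj (average e \<phi> (\<alpha> *\<^sub>R x - lat k))" for x
    unfolding average_def minus_minus wshift by (rule Bochner_Integration.integral_cnj)
  ultimately show ?thesis by (simp add: coef_def h_def e_def)
qed

text \<open>After scaling by \<alpha> the step function is constant on the cubes k + [0,1)^d, which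
  partition the space. Each cube lies in a closed box of volume 1, which gives the
  inequality.\<close>

lemma nn_integral_floor_le:
  fixes G :: "int^'d \<Rightarrow> ennreal" and \<alpha> :: real
  assumes "\<alpha> \<noteq> 0"
  shows "ennreal (\<bar>\<alpha>\<bar> ^ CARD('d)) * (\<integral>\<^sup>+x. G (\<chi> t. \<lfloor>\<alpha> * x $ t\<rfloor>) \<partial>lborel) \<le> (\<integral>\<^sup>+k. G k \<partial>count_space UNIV)"
    and "(\<lambda>x::real^'d. G (\<chi> t. \<lfloor>\<alpha> * x $ t\<rfloor>)) \<in> borel_measurable borel"
proof -
  define C :: "int^'d \<Rightarrow> (real^'d) set" where "C k = (\<Inter>t. {x. of_int (k $ t) \<le> x $ t \<and> x $ t < of_int (k $ t) + 1})" for k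
  have [measurable]: "(\<lambda>x::real^'d. x $ t) \<in> borel_measurable borel" for t
    by (auto intro!: borel_measurable_continuous_onI continuous_intros)
  have [measurable]: "C k \<in> sets borel" for k
    unfolding C_def by (intro sets.finite_INT) auto
  have C: "(\<chi> t. \<lfloor>x $ t\<rfloor>) = k \<longleftrightarrow> x \<in> C k" for x k
    by (auto simp: C_def vec_eq_iff floor_eq_iff)
  have sum: "G (\<chi> t. \<lfloor>x $ t\<rfloor>) = (\<integral>\<^sup>+k. G k * indicator (C k) x \<partial>count_space UNIV)" for x
  proof -
    have "(\<integral>\<^sup>+k. G k * indicator (C k) x \<partial>count_space UNIV) = (\<Sum>k\<in>{\<chi> t. \<lfloor>x $ t\<rfloor>}. G k * indicator (C k) x)"
      by (rule nn_integral_count_space') (auto simp: indicator_def C[symmetric])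
    then show ?thesis by (simp add: C[symmetric])
  qed
  have m: "(\<lambda>x::real^'d. G (\<chi> t. \<lfloor>x $ t\<rfloor>)) \<in> borel_measurable borel"
    unfolding sum by (rule borel_measurable_nn_integral_count_space) measurable
  from measurable_compose[OF _ m, of "\<lambda>x. \<alpha> *\<^sub>R x" borel]
  show "(\<lambda>x. G (\<chi> t. \<lfloor>\<alpha> * x $ t\<rfloor>)) \<in> borel_measurable borel" by simp
  have "emeasure lborel (C k) \<le> 1" for k
  proof -
    define o1 :: "real^'d" where "o1 = (\<chi> t. 1)"
    have "C k \<subseteq> cbox (lat k) (lat k + o1)"
      by (auto simp: C_def mem_box_cart lat_def o1_def less_imp_le)
    then have "emeasure lborel (C k) \<le> emeasure lborel (cbox (lat k) (lat k + o1))"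
      by (intro emeasure_mono) auto
    also have "\<dots> = 1"
    proof -
      have b1: "(lat k + o1 - lat k) \<bullet> b = 1" if "b \<in> Basis" for b
        using that by (auto simp: Basis_vec_def o1_def inner_axis)
      have "(\<Prod>b\<in>Basis. (lat k + o1 - lat k) \<bullet> b) = 1"
        by (rule prod.neutral) (use b1 in blast)
      moreover have "lat k \<bullet> b \<le> (lat k + o1) \<bullet> b" if "b \<in> Basis" for b
        using that by (auto simp: Basis_vec_def o1_def inner_axis)
      ultimately show ?thesis by (simp add: emeasure_lborel_cbox_eq)
    qed
    finally show ?thesis .
  qed
  then have le: "G k * emeasure lborel (C k) \<le> G k" for k
    using mult_left_mono[of "emeasure lborel (C k)" 1 "G k"] by simp
  have "ennreal (\<bar>\<alpha>\<bar> ^ CARD('d)) * (\<integral>\<^sup>+x. G (\<chi> t. \<lfloor>\<alpha> * x $ t\<rfloor>) \<partial>lborel) = (\<integral>\<^sup>+x. G (\<chi> t. \<lfloor>(x :: real^'d) $ t\<rfloor>) \<partial>lborel)"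
    using nn_integral_lborel_affine[OF m assms, of 0] by simp
  also have "\<dots> = (\<integral>\<^sup>+k. \<integral>\<^sup>+x. G k * indicator (C k) x \<partial>lborel \<partial>count_space UNIV)"
    unfolding sum by (rule nn_integral_count_space_nn_integral) auto
  also have "\<dots> = (\<integral>\<^sup>+k. G k * emeasure lborel (C k) \<partial>count_space UNIV)"
    by (simp add: nn_integral_cmult_indicator)
  also have "\<dots> \<le> (\<integral>\<^sup>+k. G k \<partial>count_space UNIV)"
    by (intro nn_integral_mono le)
  finally show "ennreal (\<bar>\<alpha>\<bar> ^ CARD('d)) * (\<integral>\<^sup>+x. G (\<chi> t. \<lfloor>\<alpha> * x $ t\<rfloor>) \<partial>lborel) \<le> (\<integral>\<^sup>+k. G k \<partial>count_space UNIV)" .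
qed

text \<open>The substitution y = \<alpha> x - k turns the scaled coefficient into the integral of c
  ((y + k) / \<alpha>) against the conjugate kernel. For k the integer part of \<alpha> x the
  argument tends to x, and the kernel has integral 1: an approximate identity, dominated by K
  |\<phi>|.\<close>

lemma coef_floor_tendsto:
  fixes \<phi> c :: "real^'d \<Rightarrow> complex" and \<alpha> :: "nat \<Rightarrow> real"
  assumes \<phi>: "sampling_kernel B \<phi>" and \<alpha>: "\<And>j. j > 0 \<Longrightarrow> \<alpha> j \<noteq> 0" "filterlim (\<lambda>j. \<bar>\<alpha> j\<bar>) at_top sequentially"
    and c: "continuous_on UNIV c" "\<And>x. norm (c x) \<le> K"
  shows "(\<lambda>j. of_real (\<bar>\<alpha> j\<bar> ^ CARD('d)) * coef \<phi> (\<alpha> j) c (\<chi> t. \<lfloor>\<alpha> j * x $ t\<rfloor>)) \<longlonglongrightarrow> c x"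
proof -
  have [measurable]: "\<phi> \<in> borel_measurable borel" and 1: "(LINT x|lborel. \<phi> x) = 1"
    and \<phi>int: "integrable lborel \<phi>"
    using \<phi> by (auto simp: sampling_kernel_def integrable_iff_bounded le_less_trans)
  have [measurable]: "c \<in> borel_measurable borel" using c(1) by (rule borel_measurable_continuous_onI)
  define k where "k j = (\<chi> t. \<lfloor>\<alpha> j * x $ t\<rfloor>)" for j
  have eq: "of_real (\<bar>\<alpha> j\<bar> ^ CARD('d)) * coef \<phi> (\<alpha> j) c (k j) =
      (LINT y|lborel. c ((1 / \<alpha> j) *\<^sub>R (y + lat (k j))) * cnj (\<phi> y))" if "j > 0" for j
    using integral_lborel_affine[of "\<lambda>y. c ((1 / \<alpha> j) *\<^sub>R (y + lat (k j))) * cnj (\<phi> y)" "\<alpha> j" "- lat (k j)"] \<alpha>(1)[OF that]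
    by (simp add: coef_def)
  have "(\<lambda>j. LINT y|lborel. c ((1 / \<alpha> j) *\<^sub>R (y + lat (k j))) * cnj (\<phi> y)) \<longlonglongrightarrow> (LINT y|lborel. c x * cnj (\<phi> y))"
  proof (rule integral_dominated_convergence[where w="\<lambda>y. K * norm (\<phi> y)"])
    show "integrable lborel (\<lambda>y. K * norm (\<phi> y))" using \<phi>int by simp
    show "AE y in lborel. norm (c ((1 / \<alpha> j) *\<^sub>R (y + lat (k j))) * cnj (\<phi> y)) \<le> K * norm (\<phi> y)" for j
      using c(2) by (intro AE_I2) (simp add: norm_mult mult_right_mono)
    show "AE y in lborel. (\<lambda>j. c ((1 / \<alpha> j) *\<^sub>R (y + lat (k j))) * cnj (\<phi> y)) \<longlonglongrightarrow> c x * cnj (\<phi> y)"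
    proof (intro AE_I2 tendsto_mult tendsto_const)
      fix y
      have "((\<lambda>j. (1 / \<alpha> j) *\<^sub>R (y + lat (k j)) - x) \<longlongrightarrow> 0) sequentially"
      proof (rule Lim_null_comparison)
        have "filterlim (\<lambda>j. \<bar>\<alpha> j\<bar>) at_infinity sequentially"
          using \<alpha>(2) by (rule filterlim_at_top_imp_at_infinity)
        then show "(\<lambda>j. (norm y + CARD('d)) / \<bar>\<alpha> j\<bar>) \<longlonglongrightarrow> 0"
          by (intro tendsto_divide_0[OF tendsto_const])
        show "\<forall>\<^sub>F j in sequentially. norm ((1 / \<alpha> j) *\<^sub>R (y + lat (k j)) - x) \<le> (norm y + CARD('d)) / \<bar>\<alpha> j\<bar>"
          using eventually_gt_at_top[of 0]
        proof eventually_elim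
          case (elim j)
          note a = \<alpha>(1)[OF elim]
          \<comment> \<open>Rounding changes each coordinate by at most 1, hence moves the point by
            at most the dimension, uniformly in \<open>j\<close>; dividing by |\<alpha>_j| makes
            this vanish.\<close>
          have "\<bar>(lat (k j) - \<alpha> j *\<^sub>R x) $ t\<bar> \<le> 1" for t
            by (simp add: lat_def k_def) linarith
          then have "norm (lat (k j) - \<alpha> j *\<^sub>R x) \<le> CARD('d)"
            using norm_le_l1_cart[of "lat (k j) - \<alpha> j *\<^sub>R x"] sum_bounded_above[of UNIV "\<lambda>t. \<bar>(lat (k j) - \<alpha> j *\<^sub>R x) $ t\<bar>" 1]
            by fastforce
          then have "norm (y + (lat (k j) - \<alpha> j *\<^sub>R x)) \<le> norm y + CARD('d)"
            using norm_triangle_ineq[of y "lat (k j) - \<alpha> j *\<^sub>R x"] by linarith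
          moreover have "(1 / \<alpha> j) *\<^sub>R (y + lat (k j)) - x = (1 / \<alpha> j) *\<^sub>R (y + (lat (k j) - \<alpha> j *\<^sub>R x))"
            using a by (simp add: algebra_simps)
          ultimately show ?case
            by (simp add: divide_right_mono)
        qed
      qed
      then have "(\<lambda>j. (1 / \<alpha> j) *\<^sub>R (y + lat (k j))) \<longlonglongrightarrow> x" by (rule LIM_zero_cancel)
      then show "(\<lambda>j. c ((1 / \<alpha> j) *\<^sub>R (y + lat (k j)))) \<longlonglongrightarrow> c x"
        by (rule continuous_on_tendsto_compose[OF c(1)]) auto
    qed
  qed measurable
  also have "(LINT y|lborel. c x * cnj (\<phi> y)) = c x" using 1 by simp
  finally show ?thesis
    by (rule Lim_transform_eventually)
       (use eventually_gt_at_top[of 0] in \<open>eventually_elim, simp only: eq k_def[symmetric]\<close>)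
qed

text \<open>Fatou's lemma for the step functions, whose integral is at most 1 / D times a sum over
  k, with D = |\<alpha>|^d. The identity D^P = D (D^(1 - 1 / P))^P shows that this quotient is
  exactly \<open>coef_sum\<close>.\<close>

lemma Lint_le_liminf_coef_sum:
  fixes \<phi> c :: "real^'d \<Rightarrow> complex" and \<alpha> :: "nat \<Rightarrow> real"
  assumes \<phi>: "sampling_kernel B \<phi>" and \<alpha>: "\<And>j. j > 0 \<Longrightarrow> \<alpha> j \<noteq> 0" "filterlim (\<lambda>j. \<bar>\<alpha> j\<bar>) at_top sequentially"
    and c: "continuous_on UNIV c" "\<And>x. norm (c x) \<le> K" and P: "1 \<le> P"
  shows "Lint P c \<le> liminf (\<lambda>j. coef_sum P \<phi> (\<alpha> j) c)"
proof -
  define G where "G j k = ennreal (norm (of_real (\<bar>\<alpha> j\<bar> ^ CARD('d)) * coef \<phi> (\<alpha> j) c k) powr P)" for j k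
  have lim: "(\<lambda>j. G j (\<chi> t. \<lfloor>\<alpha> j * x $ t\<rfloor>)) \<longlonglongrightarrow> ennreal (norm (c x) powr P)" for x
    unfolding G_def using P
    by (intro tendsto_ennrealI tendsto_powr2 tendsto_norm coef_floor_tendsto[OF \<phi> \<alpha> c] tendsto_const) auto
  \<comment> \<open>The shift to \<open>Suc j\<close> skips the scale 0, at which \<alpha> is
    unconstrained and may be 0; the lower limit is unaffected.\<close>
  have m: "(\<lambda>x::real^'d. G (Suc j) (\<chi> t. \<lfloor>\<alpha> (Suc j) * x $ t\<rfloor>)) \<in> borel_measurable borel" for j
    by (rule nn_integral_floor_le(2)) (simp add: \<alpha>)
  have "Lint P c = (\<integral>\<^sup>+x. liminf (\<lambda>j. G (Suc j) (\<chi> t. \<lfloor>\<alpha> (Suc j) * x $ t\<rfloor>)) \<partial>lborel)"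
    unfolding Lint_def by (intro nn_integral_cong lim_imp_Liminf[symmetric] LIMSEQ_Suc lim) auto
  also have "\<dots> \<le> liminf (\<lambda>j. \<integral>\<^sup>+x. G (Suc j) (\<chi> t. \<lfloor>\<alpha> (Suc j) * x $ t\<rfloor>) \<partial>lborel)"
    using m by (intro nn_integral_liminf) simp
  also have "\<dots> \<le> liminf (\<lambda>j. coef_sum P \<phi> (\<alpha> (Suc j)) c)"
  proof (intro Liminf_mono always_eventually allI)
    fix j
    define D where "D = \<bar>\<alpha> (Suc j)\<bar> ^ CARD('d)"
    have D: "D > 0" using \<alpha>(1)[of "Suc j"] by (simp add: D_def)
    have Dp: "\<bar>\<alpha> (Suc j)\<bar> powr (CARD('d) * (1 - 1 / P)) = D powr (1 - 1 / P)"
      using \<alpha>(1)[of "Suc j"] by (simp add: D_def powr_powr flip: powr_realpow)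
    have "ennreal D * (\<integral>\<^sup>+x. G (Suc j) (\<chi> t. \<lfloor>\<alpha> (Suc j) * x $ t\<rfloor>) \<partial>lborel) \<le> (\<integral>\<^sup>+k. G (Suc j) k \<partial>count_space UNIV)"
      unfolding D_def by (rule nn_integral_floor_le(1)) (simp add: \<alpha>)
    also have "\<dots> = (\<integral>\<^sup>+k. ennreal D * ennreal ((\<bar>\<alpha> (Suc j)\<bar> powr (CARD('d) * (1 - 1 / P)) * norm (coef \<phi> (\<alpha> (Suc j)) c k)) powr P) \<partial>count_space UNIV)"
    proof (intro nn_integral_cong)
      fix k
      have "norm (of_real D * coef \<phi> (\<alpha> (Suc j)) c k) powr P = D powr P * norm (coef \<phi> (\<alpha> (Suc j)) c k) powr P"
        using D by (simp add: norm_mult powr_mult)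
      also have "D powr P = D * (D powr (1 - 1 / P)) powr P"
      proof -
        have "(1 - 1 / P) * P = P - 1" using P by (simp add: left_diff_distrib)
        then have "(D powr (1 - 1 / P)) powr P = D powr (P - 1)" by (simp only: powr_powr)
        then show ?thesis using D by (simp add: powr_diff)
      qed
      finally show "G (Suc j) k = ennreal D * ennreal ((\<bar>\<alpha> (Suc j)\<bar> powr (CARD('d) * (1 - 1 / P)) * norm (coef \<phi> (\<alpha> (Suc j)) c k)) powr P)"
        using D unfolding G_def Dp D_def[symmetric] by (simp add: powr_mult mult.assoc flip: ennreal_mult)
    qed
    also have "\<dots> = ennreal D * coef_sum P \<phi> (\<alpha> (Suc j)) c"
      by (simp add: coef_sum_def nn_integral_cmult)
    finally show "(\<integral>\<^sup>+x. G (Suc j) (\<chi> t. \<lfloor>\<alpha> (Suc j) * x $ t\<rfloor>) \<partial>lborel) \<le> coef_sum P \<phi> (\<alpha> (Suc j)) c"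
      using D by (subst (asm) ennreal_mult_le_mult_iff) auto
  qed
  also have "\<dots> = liminf (\<lambda>j. coef_sum P \<phi> (\<alpha> j) c)" using liminf_shift[of "\<lambda>j. coef_sum P \<phi> (\<alpha> j) c"] by simp
  finally show ?thesis .
qed

lemma coef_sum_add_le:
  fixes \<phi> f g :: "real^'d \<Rightarrow> complex"
  assumes \<phi>: "sampling_kernel B \<phi>" and P: "1 \<le> P" and \<alpha>: "\<alpha> \<noteq> 0"
    and [measurable]: "f \<in> borel_measurable borel" "g \<in> borel_measurable borel"
    and f: "Lint P f < \<infinity>" and g: "Lint P g < \<infinity>"
  shows "coef_sum P \<phi> \<alpha> (\<lambda>x. f x + g x) \<le> ennreal (2 powr P) * (coef_sum P \<phi> \<alpha> f + coef_sum P \<phi> \<alpha> g)"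
proof -
  define a where "a = \<bar>\<alpha>\<bar> powr (CARD('d) * (1 - 1 / P))"
  have "coef \<phi> \<alpha> (\<lambda>x. f x + g x) k = coef \<phi> \<alpha> f k + coef \<phi> \<alpha> g k" for k
    using integrable_coef[OF \<phi> P \<alpha> _ f, of k] integrable_coef[OF \<phi> P \<alpha> _ g, of k]
    by (simp add: coef_def distrib_right)
  then have "(a * norm (coef \<phi> \<alpha> (\<lambda>x. f x + g x) k)) powr P \<le>
      2 powr P * ((a * norm (coef \<phi> \<alpha> f k)) powr P + (a * norm (coef \<phi> \<alpha> g k)) powr P)" for k
    using powr_norm_add_le[OF P, of "of_real a * coef \<phi> \<alpha> f k" "of_real a * coef \<phi> \<alpha> g k"]
    by (simp add: norm_mult a_def flip: distrib_left)
  then have "coef_sum P \<phi> \<alpha> (\<lambda>x. f x + g x) \<le> (\<integral>\<^sup>+k. ennreal (2 powr P) *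
      (ennreal ((a * norm (coef \<phi> \<alpha> f k)) powr P) + ennreal ((a * norm (coef \<phi> \<alpha> g k)) powr P)) \<partial>count_space UNIV)"
    unfolding coef_sum_def a_def[symmetric]
    by (intro nn_integral_mono) (simp add: ennreal_leI flip: ennreal_mult ennreal_plus)
  also have "\<dots> = ennreal (2 powr P) * (coef_sum P \<phi> \<alpha> f + coef_sum P \<phi> \<alpha> g)"
    unfolding coef_sum_def a_def[symmetric] by (simp add: nn_integral_cmult nn_integral_add)
  finally show ?thesis .
qed

text \<open>A bounded continuous \<open>c\<close> near \<open>g\<close> obeys the liminf bound, and
  by \<open>coef_sum_le\<close> its coefficients are close to those of \<open>g\<close> uniformly
  over all scales. Passing from \<open>g\<close> to \<open>c\<close> in the coefficients and from
  \<open>c\<close> back to \<open>g\<close> in the integral costs 2^P each time.\<close>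

lemma Lint_le_coef_sum:
  fixes \<phi> g :: "real^'d \<Rightarrow> complex" and \<alpha> :: "nat \<Rightarrow> real"
  assumes \<phi>: "sampling_kernel B \<phi>" and \<alpha>: "\<And>j. j > 0 \<Longrightarrow> \<alpha> j \<noteq> 0" "filterlim (\<lambda>j. \<bar>\<alpha> j\<bar>) at_top sequentially"
    and P: "1 \<le> P" and [measurable]: "g \<in> borel_measurable borel" and g: "Lint P g < \<infinity>"
    and S: "\<And>j. j > 0 \<Longrightarrow> coef_sum P \<phi> (\<alpha> j) g \<le> S"
  shows "Lint P g \<le> ennreal (4 powr P) * S"
proof (rule ennreal_le_epsilon)
  fix e :: real assume e: "e > 0"
  \<comment> \<open>\<open>A\<close> collects what multiplies \<open>\<epsilon>\<close> in the end:
    2^P 2^P B^P from the coefficients of c - g, and 2^P from the integral of g - c.\<close>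
  define A where "A = 2 powr P * (2 powr P * B powr P + 1)"
  have A: "A > 0" by (simp add: A_def add_nonneg_pos)
  define \<epsilon> where "\<epsilon> = e / A"
  have \<epsilon>: "\<epsilon> > 0" using A e by (simp add: \<epsilon>_def)
  obtain c K where c: "continuous_on UNIV c" "\<And>x. norm (c x) \<le> K" "Lint P (\<lambda>x. g x - c x) < ennreal \<epsilon>"
    using dense_continuous[OF _ P g \<epsilon>] by auto
  have [measurable]: "c \<in> borel_measurable borel" using c(1) by (rule borel_measurable_continuous_onI)
  have cg: "Lint P (\<lambda>x. c x - g x) < ennreal \<epsilon>"
    using c(3) by (simp add: Lint_def norm_minus_commute)
  have cs: "coef_sum P \<phi> (\<alpha> j) c \<le> ennreal (2 powr P) * (S + ennreal (B powr P) * ennreal \<epsilon>)" if j: "j > 0" for j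
  proof -
    have cgf: "Lint P (\<lambda>x. c x - g x) < \<infinity>" using cg by (rule less_trans) simp
    have "coef_sum P \<phi> (\<alpha> j) (\<lambda>x. c x - g x) \<le> ennreal (B powr P) * Lint P (\<lambda>x. c x - g x)"
      by (rule coef_sum_le[OF \<phi> P \<alpha>(1)[OF j] _ cgf]) measurable
    also have "\<dots> \<le> ennreal (B powr P) * ennreal \<epsilon>"
      using cg by (intro mult_left_mono) auto
    finally have "coef_sum P \<phi> (\<alpha> j) (\<lambda>x. c x - g x) \<le> ennreal (B powr P) * ennreal \<epsilon>" .
    then have "ennreal (2 powr P) * (coef_sum P \<phi> (\<alpha> j) g + coef_sum P \<phi> (\<alpha> j) (\<lambda>x. c x - g x)) \<le>
        ennreal (2 powr P) * (S + ennreal (B powr P) * ennreal \<epsilon>)"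
      by (intro mult_left_mono add_mono S j) simp_all
    moreover have "coef_sum P \<phi> (\<alpha> j) (\<lambda>x. g x + (c x - g x)) \<le>
        ennreal (2 powr P) * (coef_sum P \<phi> (\<alpha> j) g + coef_sum P \<phi> (\<alpha> j) (\<lambda>x. c x - g x))"
      by (rule coef_sum_add_le[OF \<phi> P \<alpha>(1)[OF j] _ _ g cgf]) measurable
    ultimately show ?thesis by simp
  qed
  have "Lint P c \<le> liminf (\<lambda>j. coef_sum P \<phi> (\<alpha> j) c)"
    by (rule Lint_le_liminf_coef_sum[OF \<phi> \<alpha> c(1,2) P])
  also have "\<dots> \<le> liminf (\<lambda>j. ennreal (2 powr P) * (S + ennreal (B powr P) * ennreal \<epsilon>))"
    by (rule Liminf_mono, rule eventually_mono[OF eventually_gt_at_top[of 0] cs])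
  also have "\<dots> = ennreal (2 powr P) * (S + ennreal (B powr P) * ennreal \<epsilon>)"
    by (simp add: Liminf_const)
  finally have c': "Lint P c \<le> ennreal (2 powr P) * (S + ennreal (B powr P) * ennreal \<epsilon>)" .
  have "Lint P g = Lint P (\<lambda>x. c x + (g x - c x))" by simp
  also have "\<dots> \<le> ennreal (2 powr P) * (Lint P c + Lint P (\<lambda>x. g x - c x))"
    by (rule Lint_add_le[OF P]) measurable
  also have "\<dots> \<le> ennreal (2 powr P) * (ennreal (2 powr P) * (S + ennreal (B powr P) * ennreal \<epsilon>) + ennreal \<epsilon>)"
    by (intro mult_left_mono add_mono c' less_imp_le[OF c(3)]) auto
  also have "\<dots> = ennreal (2 powr P) * ennreal (2 powr P) * S +
      ennreal (2 powr P) * (ennreal (2 powr P) * (ennreal (B powr P) * ennreal \<epsilon>) + ennreal \<epsilon>)"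
    by (simp add: distrib_left mult.assoc add.assoc)
  also have "ennreal (2 powr P) * ennreal (2 powr P) = ennreal (4 powr P)"
    by (simp flip: ennreal_mult powr_mult)
  also have "ennreal (2 powr P) * (ennreal (2 powr P) * (ennreal (B powr P) * ennreal \<epsilon>) + ennreal \<epsilon>) = ennreal (A * \<epsilon>)"
    using \<epsilon> by (simp add: A_def algebra_simps flip: ennreal_mult ennreal_plus)
  also have "A * \<epsilon> = e" using A by (simp add: \<epsilon>_def)
  finally show "Lint P g \<le> ennreal (4 powr P) * S + ennreal e" .
qed


section \<open>Higher differences\<close>

lemma mpower_zero: "mdeg \<rho> = 0 \<Longrightarrow> mpower A \<rho> x = x"
proof -
  assume "mdeg \<rho> = 0"
  then have "\<rho> $ t = 0" for t by (simp add: mdeg_def)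
  then have "foldr (\<lambda>t. A t ^^ (\<rho> $ t)) ts x = x" for ts by (induction ts) auto
  then show ?thesis by (simp add: mpower_def)
qed

definition lower :: "'d \<Rightarrow> nat^'d \<Rightarrow> nat^'d" where
  "lower t \<rho> = (\<chi> s. if s = t then \<rho> $ s - 1 else \<rho> $ s)"

text \<open>Peeling off the innermost operator makes a commutation of partial derivatives unnecessary.\<close>

lemma ex_innermost_coordinate:
  fixes \<rho> :: "nat^'d"
  assumes "mdeg \<rho> \<noteq> 0"
  obtains t xs ys where "coords = xs @ t # ys" "\<rho> $ t \<noteq> 0" "\<And>s. s \<in> set ys \<Longrightarrow> \<rho> $ s = 0"
proof -
  have "\<exists>t\<in>set coords. \<rho> $ t \<noteq> 0" using assms by (auto simp: mdeg_def coords)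
  from split_list_last_prop[OF this] show thesis using that by blast
qed

text \<open>\<open>foldr\<close> applies the last coordinate first, and the exponents in
  \<open>ys\<close> vanish, so \<open>A t\<close> is the first operator to act on \<open>x\<close>
  and one copy splits off. The coordinates are distinct, so the exponents in \<open>xs\<close> are
  not affected.\<close>

lemma mpower_lower:
  fixes \<rho> :: "nat^'d"
  assumes c: "coords = xs @ t # ys" "\<rho> $ t \<noteq> 0" "\<And>s. s \<in> set ys \<Longrightarrow> \<rho> $ s = 0"
  shows "mpower A \<rho> x = mpower A (lower t \<rho>) (A t x)"
proof -
  have "distinct (xs @ t # ys)" unfolding c(1)[symmetric] by (rule coords)
  then have t: "t \<notin> set xs" "t \<notin> set ys" by auto
  have ys: "foldr (\<lambda>s. A s ^^ (\<tau> $ s)) zs y = y" if "\<And>s. s \<in> set zs \<Longrightarrow> \<tau> $ s = 0" for \<tau> :: "nat^'d" and zs y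
    using that by (induction zs) auto
  have xs: "foldr (\<lambda>s. A s ^^ (lower t \<rho> $ s)) xs = foldr (\<lambda>s. A s ^^ (\<rho> $ s)) xs"
    using t by (intro ext foldr_cong refl) (auto simp: lower_def)
  have "(A t ^^ (\<rho> $ t)) x = (A t ^^ (lower t \<rho> $ t)) (A t x)"
    using c(2) by (cases "\<rho> $ t") (simp_all add: lower_def funpow_swap1)
  moreover have "lower t \<rho> $ s = 0" if "s \<in> set ys" for s
    using c(3)[OF that] t that by (auto simp: lower_def)
  ultimately show ?thesis
    using ys[of ys \<rho>] ys[of ys "lower t \<rho>"] c(3) by (simp add: mpower_def c(1) xs)
qed

lemma mdeg_lower:
  assumes "\<rho> $ t \<noteq> 0"
  shows "mdeg \<rho> = Suc (mdeg (lower t \<rho>))"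
proof -
  have "mdeg (lower t \<rho>) = (\<rho> $ t - 1) + (\<Sum>s\<in>UNIV - {t}. \<rho> $ s)"
    unfolding mdeg_def by (subst sum.remove[of _ t]) (auto simp: lower_def)
  moreover have "mdeg \<rho> = \<rho> $ t + (\<Sum>s\<in>UNIV - {t}. \<rho> $ s)"
    unfolding mdeg_def by (subst sum.remove[of _ t]) auto
  ultimately show ?thesis using assms by simp
qed

lemma mpower_diff_commute: "mpower diff \<rho> (diff t s) = diff t (mpower diff \<rho> s)"
proof -
  have "diff u (diff t s) = diff t (diff u s)" for u s
    using fun_cong[OF diff_commute[of u t]] by simp
  then have *: "(diff u ^^ n) (diff t s) = diff t ((diff u ^^ n) s)" for u n s
    by (induction n) simp_all
  have "foldr (\<lambda>u. diff u ^^ (\<rho> $ u)) us (diff t s) = diff t (foldr (\<lambda>u. diff u ^^ (\<rho> $ u)) us s)" for us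
    by (induction us) (simp_all add: *)
  then show ?thesis by (simp add: mpower_def)
qed

lemma mpower_diff_cmult: "mpower diff \<rho> (\<lambda>k. c * s k) = (\<lambda>k. c * mpower diff \<rho> s k)"
proof -
  have *: "(diff u ^^ n) (\<lambda>k. c * s k) = (\<lambda>k. c * (diff u ^^ n) s k)" for u n s
    by (induction n) (auto simp: diff_def algebra_simps)
  have "foldr (\<lambda>u. diff u ^^ (\<rho> $ u)) us (\<lambda>k. c * s k) = (\<lambda>k. c * foldr (\<lambda>u. diff u ^^ (\<rho> $ u)) us s k)" for us
    by (induction us) (simp_all add: *)
  then show ?thesis by (simp add: mpower_def)
qed

text \<open>\<open>g \<sigma>\<close> stands for the weak derivative of \<open>g 0\<close> of order
  \<open>\<sigma>\<close>. Integration by parts is demanded only for a \<open>t\<close> that can act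
  first in the fixed order of the operators, as \<open>mpower_lower\<close> provides.\<close>

definition weak_family :: "real \<Rightarrow> nat \<Rightarrow> (nat^'d \<Rightarrow> real^'d \<Rightarrow> complex) \<Rightarrow> bool" where
  "weak_family P n g \<longleftrightarrow>
     (\<forall>\<sigma>. mdeg \<sigma> \<le> n \<longrightarrow> g \<sigma> \<in> borel_measurable borel \<and> Lint P (g \<sigma>) < \<infinity>) \<and>
     (\<forall>\<sigma> t \<psi>. \<sigma> $ t \<noteq> 0 \<longrightarrow> mdeg \<sigma> \<le> n \<longrightarrow>
        (\<forall>\<psi>. mpower partial \<sigma> \<psi> = mpower partial (lower t \<sigma>) (partial t \<psi>)) \<longrightarrow> test_function \<psi> \<longrightarrow>
        (LINT x|lborel. g (lower t \<sigma>) x * partial t \<psi> x) = - (LINT x|lborel. g \<sigma> x * \<psi> x))"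

lemma weak_family_mono: "weak_family P n g \<Longrightarrow> k \<le> n \<Longrightarrow> weak_family P k g"
  unfolding weak_family_def by (meson order_trans)

text \<open>Each difference in \<open>k\<close> moves one derivative onto \<open>f\<close> and convolves the kernel with the
  indicator function of a unit segment, so that \<open>\<Phi>\<close> depends only on \<open>\<phi>\<close> and \<open>\<rho>\<close>.\<close>

lemma mpower_diff_coef:
  fixes \<phi> :: "real^'d \<Rightarrow> complex"
  assumes \<phi>: "sampling_kernel B \<phi>" and P: "1 \<le> P"
  shows "\<exists>\<Phi>. sampling_kernel B \<Phi> \<and> (\<forall>\<alpha> g. \<alpha> \<noteq> 0 \<longrightarrow> weak_family P (mdeg \<rho>) g \<longrightarrow>
    mpower diff \<rho> (coef \<phi> \<alpha> (g 0)) = (\<lambda>k. inverse (of_real \<alpha> ^ mdeg \<rho>) * coef \<Phi> \<alpha> (g \<rho>) k))"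
proof (induction "mdeg \<rho>" arbitrary: \<rho>)
  case 0
  then have "\<rho> = 0" by (simp add: mdeg_def vec_eq_iff)
  then show ?case using \<phi> 0 by (auto simp: mpower_zero)
next
  case (Suc n)
  then have "mdeg \<rho> \<noteq> 0" by simp
  then obtain t xs ys where c: "coords = xs @ t # ys" "\<rho> $ t \<noteq> 0" "\<And>s. s \<in> set ys \<Longrightarrow> \<rho> $ s = 0"
    by (rule ex_innermost_coordinate) (rule that)
  have n: "mdeg (lower t \<rho>) = n" using mdeg_lower[of \<rho> t] c(2) Suc(2) by simp
  from Suc(1)[OF n[symmetric]] obtain \<Phi> where \<Phi>: "sampling_kernel B \<Phi>" and
    IH: "\<forall>\<alpha> g. \<alpha> \<noteq> 0 \<longrightarrow> weak_family P n g \<longrightarrow>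
    mpower diff (lower t \<rho>) (coef \<phi> \<alpha> (g 0)) = (\<lambda>k. inverse (of_real \<alpha> ^ n) * coef \<Phi> \<alpha> (g (lower t \<rho>)) k)"
    unfolding n by (elim exE conjE) (rule that; assumption)
  show ?case
  proof (intro exI[of _ "average (axis t 1) \<Phi>"] conjI allI impI sampling_kernel_average \<Phi>)
    fix \<alpha> :: real and g :: "nat^'d \<Rightarrow> real^'d \<Rightarrow> complex"
    assume \<alpha>: "\<alpha> \<noteq> 0" and w: "weak_family P (mdeg \<rho>) g"
    \<comment> \<open>The difference peeled off on the inside is commuted to the outside: the
      induction hypothesis concerns the coefficients of \<open>g 0\<close>, and
      \<open>coef_diff\<close> is to act on those of \<open>g (lower t \<rho>)\<close>.\<close>
    have "mpower diff \<rho> (coef \<phi> \<alpha> (g 0)) = diff t (mpower diff (lower t \<rho>) (coef \<phi> \<alpha> (g 0)))"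
      using mpower_lower[OF c, of diff "coef \<phi> \<alpha> (g 0)"] mpower_diff_commute[of "lower t \<rho>" t] by simp
    also have "mpower diff (lower t \<rho>) (coef \<phi> \<alpha> (g 0)) = (\<lambda>k. inverse (of_real \<alpha> ^ n) * coef \<Phi> \<alpha> (g (lower t \<rho>)) k)"
      using IH \<alpha> weak_family_mono[OF w] Suc(2) by simp
    also have "diff t (\<lambda>k. inverse (of_real \<alpha> ^ n) * coef \<Phi> \<alpha> (g (lower t \<rho>)) k) =
        (\<lambda>k. inverse (of_real \<alpha> ^ n) * diff t (coef \<Phi> \<alpha> (g (lower t \<rho>))) k)"
      by (simp add: diff_def algebra_simps fun_eq_iff)
    also have "\<dots> = (\<lambda>k. inverse (of_real \<alpha> ^ n) * (coef (average (axis t 1) \<Phi>) \<alpha> (g \<rho>) k / of_real \<alpha>))"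
    proof (intro ext arg_cong2[where f="(*)"] refl coef_diff[OF \<Phi> P \<alpha>])
      show "(LINT x|lborel. g (lower t \<rho>) x * partial t \<psi> x) = - (LINT x|lborel. g \<rho> x * \<psi> x)" if "test_function \<psi>" for \<psi>
        using w c(2) that mpower_lower[OF c, where A=partial] unfolding weak_family_def by blast
      show "g (lower t \<rho>) \<in> borel_measurable borel" "g \<rho> \<in> borel_measurable borel"
        "Lint P (g (lower t \<rho>)) < \<infinity>" "Lint P (g \<rho>) < \<infinity>"
        using w n Suc(2) unfolding weak_family_def by (metis le_refl le_SucI)+
    qed
    finally show "mpower diff \<rho> (coef \<phi> \<alpha> (g 0)) = (\<lambda>k. inverse (of_real \<alpha> ^ mdeg \<rho>) * coef (average (axis t 1) \<Phi>) \<alpha> (g \<rho>) k)"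
      by (simp add: Suc(2)[symmetric] divide_inverse mult_ac)
  qed
qed

section \<open>Test functions, Borel representatives and uniqueness of weak derivatives\<close>

lemma test_function_partial:
  assumes "test_function \<psi>"
  shows "test_function (partial t \<psi>)"
  unfolding test_function_def
proof
  have "foldr partial ts (partial t \<psi>) = foldr partial (ts @ [t]) \<psi>" for ts by simp
  then show "smooth (partial t \<psi>)" using assms unfolding test_function_def smooth_def by metis
  let ?S = "{x. \<psi> x \<noteq> 0}"
  have "partial t \<psi> x = 0" if x: "x \<notin> closure ?S" for x
  proof -
    have "(\<psi> has_derivative (\<lambda>_. 0)) (at x)"
      by (rule has_derivative_transform_within_open[where s="- closure ?S" and f="\<lambda>_. 0"])
         (use x closure_subset[of ?S] in auto)
    from fun_cong[OF frechet_derivative_at[OF this], of "axis t 1"]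
    show ?thesis by (simp add: partial_def)
  qed
  then have "closure {x. partial t \<psi> x \<noteq> 0} \<subseteq> closure ?S"
    by (intro closure_minimal) auto
  then show "compact (closure {x. partial t \<psi> x \<noteq> 0})"
    using assms unfolding test_function_def by (metis bounded_subset closed_closure compact_eq_bounded_closed)
qed

lemma borel_measurable_test_function:
  assumes "test_function \<psi>"
  shows "\<psi> \<in> borel_measurable borel"
proof -
  have "foldr partial [] \<psi> differentiable_on UNIV"
    using assms unfolding test_function_def smooth_def by blast
  then show ?thesis
    by (simp add: borel_measurable_continuous_onI differentiable_imp_continuous_on)
qed

lemma lebesgue_ex_borel:
  fixes f :: "real^'d \<Rightarrow> complex"
  assumes "f \<in> borel_measurable lebesgue"
  obtains f' where "f' \<in> borel_measurable borel" "AE x in lborel. f x = f' x"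
proof -
  have "(\<lambda>x. Re (f x)) \<in> borel_measurable lebesgue" "(\<lambda>x. Im (f x)) \<in> borel_measurable lebesgue"
    using assms by measurable
  from this[THEN completion_ex_borel_measurable_real]
  obtain r i where r: "r \<in> borel_measurable lborel" "AE x in lborel. Re (f x) = r x"
    and i: "i \<in> borel_measurable lborel" "AE x in lborel. Im (f x) = i x"
    by blast
  show thesis
  proof (rule that[of "\<lambda>x. Complex (r x) (i x)"])
    show "(\<lambda>x. Complex (r x) (i x)) \<in> borel_measurable borel"
      unfolding Complex_eq using r(1) i(1) by measurable
    show "AE x in lborel. f x = Complex (r x) (i x)"
      using r(2) i(2) by eventually_elim (simp add: complex_eq_iff)
  qed
qed

text \<open>The norms and pairings refer to Lebesgue measurable functions, whereas translations and
  Fubini's theorem are used on \<open>lborel\<close>. The passage is by Borel representatives;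
  \<open>f\<close> itself is measurable because Lebesgue measure is complete.\<close>

lemma LINT_lebesgue_eq:
  fixes f f' :: "real^'d \<Rightarrow> complex"
  assumes "f' \<in> borel_measurable borel" "AE x in lborel. f x = f' x"
  shows "(LINT x|lebesgue. f x) = (LINT x|lborel. f' x)"
proof -
  have f': "f' \<in> borel_measurable lebesgue" using assms(1) by (intro measurable_completion) simp
  have ae: "AE x in lebesgue. f x = f' x" using assms(2) by (rule AE_completion)
  then have "f \<in> borel_measurable lebesgue"
    by (intro borel_measurable_AE[OF f']) (auto elim: eventually_mono)
  with f' ae have "(LINT x|lebesgue. f x) = (LINT x|lebesgue. f' x)"
    by (intro integral_cong_AE)
  also have "\<dots> = (LINT x|lborel. f' x)"
    using assms(1) by (intro integral_completion) simp
  finally show ?thesis .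
qed

text \<open>Integrability is given on compact sets only, but the function is the pointwise limit of
  its restrictions to growing balls.\<close>

lemma locally_integrable_measurable:
  fixes f :: "real^'d \<Rightarrow> complex"
  assumes "locally_integrable f"
  shows "f \<in> borel_measurable lebesgue"
proof (rule borel_measurable_LIMSEQ_metric)
  show "(\<lambda>x. indicator (cball 0 (real n)) x *\<^sub>R f x) \<in> borel_measurable lebesgue" for n
    using assms unfolding locally_integrable_def set_integrable_def
    by (intro borel_measurable_integrable) auto
  fix x :: "real^'d"
  obtain N where N: "norm x \<le> real N" using real_arch_simple by blast
  then have "eventually (\<lambda>n. indicator (cball 0 (real n)) x *\<^sub>R f x = f x) sequentially"
    unfolding eventually_sequentially by (intro exI[of _ N]) auto
  then show "(\<lambda>n. indicator (cball 0 (real n)) x *\<^sub>R f x) \<longlonglongrightarrow> f x" by (rule tendsto_eventually)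
qed

lemma locally_integrable_borel:
  fixes f f' :: "real^'d \<Rightarrow> complex"
  assumes "locally_integrable f" and f': "f' \<in> borel_measurable borel" "AE x in lborel. f x = f' x"
  shows "set_integrable lborel (cbox l u) f'"
proof -
  have "set_integrable lebesgue (cbox l u) f" using assms(1) by (simp add: locally_integrable_def)
  then have "integrable lebesgue (\<lambda>x. indicator (cbox l u) x *\<^sub>R f' x)"
    unfolding set_integrable_def
  proof (rule integrable_cong_AE_imp)
    show "(\<lambda>x. indicator (cbox l u) x *\<^sub>R f' x) \<in> borel_measurable lebesgue"
      using f'(1) by (intro measurable_completion) simp
    show "AE x in lebesgue. indicator (cbox l u) x *\<^sub>R f x = indicator (cbox l u) x *\<^sub>R f' x"
      using AE_completion[OF f'(2)] by eventually_elim simp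
  qed
  then show ?thesis
    unfolding set_integrable_def using f'(1) by (subst (asm) integrable_completion) auto
qed

text \<open>\<open>weak_deriv\<close> is an arbitrary choice, and what is known of another witness,
  such as a finite L^p norm, reaches it through this uniqueness. Product test functions already
  decide it.\<close>

lemma is_weak_deriv_unique:
  fixes f g g' :: "real^'d \<Rightarrow> complex"
  assumes "is_weak_deriv \<rho> f g" "is_weak_deriv \<rho> f g'"
  shows "AE x in lborel. g x = g' x"
proof -
  have loc: "locally_integrable g" "locally_integrable g'" using assms by (auto simp: is_weak_deriv_def)
  then have m: "g \<in> borel_measurable lebesgue" "g' \<in> borel_measurable lebesgue"
    by (auto intro: locally_integrable_measurable)
  obtain h where h [measurable]: "h \<in> borel_measurable borel" and gh: "AE x in lborel. g x = h x"
    using lebesgue_ex_borel[OF m(1)] .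
  obtain h' where h' [measurable]: "h' \<in> borel_measurable borel" and gh': "AE x in lborel. g' x = h' x"
    using lebesgue_ex_borel[OF m(2)] .
  note hint = locally_integrable_borel[OF loc(1) h gh] locally_integrable_borel[OF loc(2) h' gh']
  have "AE x in lborel. h x - h' x = 0"
  proof (rule AE_zero_if_tensor_integrals_zero)
    show "set_integrable lborel (cbox l u) (\<lambda>x. h x - h' x)" for l u
      using hint by (intro set_integral_diff)
  next
    fix \<beta> :: "'d \<Rightarrow> nat \<Rightarrow> real \<Rightarrow> real" and l u :: "real^'d"
    assume \<beta>: "\<And>t. deriv_chain (\<beta> t)" and supp: "\<And>t y. y \<notin> {l $ t..u $ t} \<Longrightarrow> \<beta> t 0 y = 0"
    define \<psi> where "\<psi> = tensor (\<lambda>t. \<beta> t 0)"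
    have test: "test_function \<psi>" unfolding \<psi>_def by (rule test_function_tensor[OF \<beta> supp])
    then have [measurable]: "\<psi> \<in> borel_measurable borel" by (rule borel_measurable_test_function)
    have cont: "continuous_on UNIV \<psi>" unfolding \<psi>_def by (rule continuous_on_tensor[OF \<beta>])
    have \<psi>0: "\<psi> x = 0" if "x \<notin> cbox l u" for x
      unfolding \<psi>_def using that by (rule tensor_eq_0[rotated]) (rule supp)
    obtain K where K: "K \<ge> 0" "\<And>x. norm (\<psi> x) \<le> K * indicator (cbox l u) x"
      using bounded_support[OF cont \<psi>0] by blast
    have i: "integrable lborel (\<lambda>x. h x * \<psi> x)" "integrable lborel (\<lambda>x. h' x * \<psi> x)"
      by (rule integrable_mult_bounded_support[OF hint(1) _ _ K(2)] integrable_mult_bounded_support[OF hint(2) _ _ K(2)]; measurable)+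
    have "(LINT x|lebesgue. g x * \<psi> x) = (LINT x|lebesgue. g' x * \<psi> x)"
      using assms test by (auto simp: is_weak_deriv_def)
    moreover have "(LINT x|lebesgue. g x * \<psi> x) = (LINT x|lborel. h x * \<psi> x)"
      by (rule LINT_lebesgue_eq) (use gh in auto)
    moreover have "(LINT x|lebesgue. g' x * \<psi> x) = (LINT x|lborel. h' x * \<psi> x)"
      by (rule LINT_lebesgue_eq) (use gh' in auto)
    ultimately show "(LINT x|lborel. (h x - h' x) * tensor (\<lambda>t. \<beta> t 0) x) = 0"
      using i unfolding \<psi>_def[symmetric] by (simp add: left_diff_distrib)
  qed
  with gh gh' show ?thesis by eventually_elim simp
qed


section \<open>Norm equivalence\<close>

lemma epowr_ennreal: "0 \<le> r \<Longrightarrow> epowr (ennreal r) P = ennreal (r powr P)"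
  by (simp add: epowr_def)

lemma epowr_mono: "x \<le> y \<Longrightarrow> 0 \<le> r \<Longrightarrow> epowr x r \<le> epowr y r"
  by (cases x; cases y) (auto simp: epowr_def ennreal_leI powr_mono2 top_unique)

lemma epowr_cmult:
  assumes "0 < c" "0 < P"
  shows "epowr (ennreal (c powr P) * x) (1 / P) = ennreal c * epowr x (1 / P)"
proof (cases x)
  case (real r)
  then show ?thesis using assms
    by (simp add: epowr_ennreal powr_mult powr_powr flip: ennreal_mult)
qed (use assms in \<open>simp add: epowr_def ennreal_mult_top\<close>)

lemma epowr_epowr: "0 < P \<Longrightarrow> epowr (epowr x (1 / P)) P = x"
  by (cases x) (simp_all add: epowr_ennreal powr_powr epowr_def)

lemma epowr_less_top: "epowr x r < \<infinity> \<longleftrightarrow> x < \<infinity>"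
  by (cases x) (simp_all add: epowr_def)

lemma Lp_norm_eq: "p \<noteq> \<infinity> \<Longrightarrow> Lp_norm p f = epowr (Lint (enn2real p) f) (1 / enn2real p)"
  by (simp add: Lp_norm_def Lnorm_def epowr_ennreal nn_integral_completion Lint_def)

lemma lp_norm_eq:
  "p \<noteq> \<infinity> \<Longrightarrow> lp_norm p s = epowr (\<integral>\<^sup>+k. norm (s k) powr enn2real p \<partial>count_space UNIV) (1 / enn2real p)"
  by (simp add: lp_norm_def Lnorm_def epowr_ennreal)

lemma Lint_cong_AE:
  assumes "AE x in lborel. f x = g x"
  shows "Lint P f = Lint P g"
  unfolding Lint_def by (rule nn_integral_cong_AE) (use assms in eventually_elim, simp)

text \<open>The sum in \<open>periodization\<close> is a supremum over finite sets, the integral one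
  over initial segments of an enumeration, and each initial segment contains finitely many
  indices.\<close>

lemma nn_integral_count_space_le_infsum:
  fixes f :: "'i::countable \<Rightarrow> ennreal"
  shows "(\<integral>\<^sup>+k. f k \<partial>count_space UNIV) \<le> (\<Sum>\<^sub>\<infinity>k. f k)"
proof -
  \<comment> \<open>\<open>to_nat\<close> need not be onto; numbers outside its range contribute
    0.\<close>
  define h where "h n = f (from_nat n) * indicator (range (to_nat :: 'i \<Rightarrow> nat)) n" for n
  have "(\<integral>\<^sup>+k. f k \<partial>count_space UNIV) = (\<integral>\<^sup>+k. f (from_nat (to_nat (k :: 'i))) \<partial>count_space UNIV)" by simp
  also have "\<dots> = (\<integral>\<^sup>+n. f (from_nat n) \<partial>count_space (range (to_nat :: 'i \<Rightarrow> nat)))"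
    by (rule nn_integral_bij_count_space) (simp add: bij_betw_def)
  also have "\<dots> = (\<integral>\<^sup>+n. h n \<partial>count_space UNIV)"
    unfolding h_def by (rule nn_integral_count_space_indicator) simp
  also have "\<dots> = (SUP n. \<Sum>i<n. h i)"
    by (simp add: nn_integral_count_space_nat suminf_eq_SUP)
  also have "\<dots> \<le> (\<Sum>\<^sub>\<infinity>k. f k)"
  proof (rule SUP_least)
    fix n
    define F where "F = {k :: 'i. to_nat k < n}"
    have F: "finite F" unfolding F_def by (rule finite_imageD[of to_nat]) (auto intro: finite_subset[of _ "{..<n}"])
    have "(\<Sum>i<n. h i) = (\<Sum>i\<in>to_nat ` F. f (from_nat i))"
      by (rule sum.mono_neutral_cong_right) (auto simp: h_def F_def indicator_def)
    also have "\<dots> = (\<Sum>k\<in>F. f k)" by (simp add: sum.reindex)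
    also have "\<dots> \<le> (\<Sum>\<^sub>\<infinity>k. f k)"
      using F by (subst nonneg_infsum_complete) (auto intro!: SUP_upper)
    finally show "(\<Sum>i<n. h i) \<le> (\<Sum>\<^sub>\<infinity>k. f k)" .
  qed
  finally show ?thesis .
qed

lemma ex_sampling_kernel:
  fixes \<phi> :: "real^'d \<Rightarrow> complex"
  assumes m: "\<phi> \<in> borel_measurable lebesgue" and per: "Lnorm lebesgue \<infinity> (periodization (emod \<phi>)) < \<infinity>"
    and 1: "(LINT x|lebesgue. \<phi> x) = 1"
  obtains B \<phi>' where "sampling_kernel B \<phi>'" "AE x in lborel. \<phi> x = \<phi>' x"
proof -
  obtain \<phi>' where m' [measurable]: "\<phi>' \<in> borel_measurable borel" and ae: "AE x in lborel. \<phi> x = \<phi>' x"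
    using lebesgue_ex_borel[OF m] .
  have one': "(LINT x|lborel. \<phi>' x) = 1" using LINT_lebesgue_eq[OF m' ae] 1 by simp
  \<comment> \<open>A non-integrable function would have integral 0, so the value 1 already contains
    integrability.\<close>
  then have "integrable lborel \<phi>'" using not_integrable_integral_eq by force
  then have fin1: "(\<integral>\<^sup>+x. norm (\<phi>' x) \<partial>lborel) < \<infinity>" by (simp add: integrable_iff_bounded)
  define E where "E = esssup lebesgue (periodization (emod \<phi>))"
  have E: "E < \<infinity>" using per by (simp add: E_def Lnorm_def)
  define B where "B = max (enn2real (\<integral>\<^sup>+x. norm (\<phi>' x) \<partial>lborel)) (enn2real E)"
  have B: "(\<integral>\<^sup>+x. norm (\<phi>' x) \<partial>lborel) \<le> ennreal B" "E \<le> ennreal B"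
  proof -
    have "(\<integral>\<^sup>+x. norm (\<phi>' x) \<partial>lborel) = ennreal (enn2real (\<integral>\<^sup>+x. norm (\<phi>' x) \<partial>lborel))" "E = ennreal (enn2real E)"
      using fin1 E by simp_all
    then show "(\<integral>\<^sup>+x. norm (\<phi>' x) \<partial>lborel) \<le> ennreal B" "E \<le> ennreal B"
      unfolding B_def by (metis ennreal_leI max.cobounded1 max.cobounded2)+
  qed
  \<comment> \<open>The lattice is countable, so one null set serves all translates.\<close>
  have "AE x in lborel. \<forall>k. \<phi> (x - lat k) = \<phi>' (x - lat k)"
    unfolding AE_all_countable using AE_lborel_affine[OF ae, of 1 "- lat k" for k] by simp
  moreover have "AE x in lborel. periodization (emod \<phi>) x \<le> E"
    using esssup_AE[of "periodization (emod \<phi>)" lebesgue] unfolding E_def by (simp add: AE_completion_iff)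
  ultimately have "AE x in lborel. (\<integral>\<^sup>+k. norm (\<phi>' (x - lat k)) \<partial>count_space UNIV) \<le> ennreal B"
  proof eventually_elim
    case (elim x)
    have "(\<integral>\<^sup>+k. norm (\<phi>' (x - lat k)) \<partial>count_space UNIV) \<le> periodization (emod \<phi>) x"
      unfolding periodization_def elim(1)[rule_format, symmetric] by (rule nn_integral_count_space_le_infsum)
    with elim(2) B(2) show ?case by simp
  qed
  then have "sampling_kernel B \<phi>'" using m' B(1) one' by (simp add: sampling_kernel_def)
  then show thesis using that ae by blast
qed

text \<open>Testing order \<open>\<sigma>\<close> with \<psi> and order
  \<open>lower t \<sigma>\<close> with the t-th partial derivative of \<psi> leads to the same
  integral of \<open>f\<close>. The two signs differ by one factor -1, and this is integration by
  parts between neighbouring orders.\<close>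

lemma Sobolev_weak_family:
  fixes f :: "real^'d \<Rightarrow> complex"
  assumes f: "f \<in> Sobolev_space m p" and p: "p \<noteq> \<infinity>"
  obtains g where "weak_family (enn2real p) m g" "AE x in lborel. f x = g 0 x"
    "\<And>\<rho>. mdeg \<rho> \<le> m \<Longrightarrow> Lp_norm p (weak_deriv \<rho> f) = Lp_norm p (g \<rho>)"
proof -
  define G where "G \<rho> = weak_deriv \<rho> f" for \<rho>
  have ex: "\<exists>g\<in>Lp_space p. is_weak_deriv \<rho> f g" if "mdeg \<rho> \<le> m" for \<rho>
    using f that by (auto simp: Sobolev_space_def)
  have G: "is_weak_deriv \<rho> f (G \<rho>)" if "mdeg \<rho> \<le> m" for \<rho>
    unfolding G_def weak_deriv_def using ex[OF that] by (metis someI_ex)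
  have "\<exists>h. h \<in> borel_measurable borel \<and> (AE x in lborel. G \<rho> x = h x)" if "mdeg \<rho> \<le> m" for \<rho>
    using G[OF that] lebesgue_ex_borel[OF locally_integrable_measurable] unfolding is_weak_deriv_def by metis
  then obtain g where g: "\<And>\<rho>. mdeg \<rho> \<le> m \<Longrightarrow> g \<rho> \<in> borel_measurable borel"
    "\<And>\<rho>. mdeg \<rho> \<le> m \<Longrightarrow> AE x in lborel. G \<rho> x = g \<rho> x" by metis
  show thesis
  proof (rule that[of g])
    show norm: "Lp_norm p (weak_deriv \<rho> f) = Lp_norm p (g \<rho>)" if "mdeg \<rho> \<le> m" for \<rho>
      using Lint_cong_AE[OF g(2)[OF that]] p by (simp add: Lp_norm_eq G_def)
    have "locally_integrable f" using G[of 0] by (simp add: is_weak_deriv_def mdeg_def)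
    \<comment> \<open>\<open>f\<close> is its own weak derivative of order 0, so the chosen one
      agrees with \<open>f\<close> almost everywhere.\<close>
    then have "is_weak_deriv 0 f f" by (simp add: is_weak_deriv_def mdeg_def mpower_zero)
    moreover have zero: "mdeg (0 :: nat^'d) \<le> m" by (simp add: mdeg_def)
    ultimately have "AE x in lborel. f x = G 0 x" using G is_weak_deriv_unique by blast
    then show "AE x in lborel. f x = g 0 x" using g(2)[OF zero] by eventually_elim simp
    show "weak_family (enn2real p) m g"
      unfolding weak_family_def
    proof (intro conjI allI impI)
      fix \<sigma> :: "nat^'d" assume \<sigma>: "mdeg \<sigma> \<le> m"
      show "g \<sigma> \<in> borel_measurable borel" using g(1)[OF \<sigma>] .
      \<comment> \<open>Finiteness of the norm is known for the witness \<open>g0\<close> and passes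
        to the chosen derivative by uniqueness.\<close>
      obtain g0 where g0: "g0 \<in> Lp_space p" "is_weak_deriv \<sigma> f g0" using ex[OF \<sigma>] by blast
      have "Lint (enn2real p) (g \<sigma>) = Lint (enn2real p) g0"
        using Lint_cong_AE[OF g(2)[OF \<sigma>]] Lint_cong_AE[OF is_weak_deriv_unique[OF G[OF \<sigma>] g0(2)]] by simp
      also have "\<dots> < \<infinity>" using g0(1) p by (simp add: Lp_space_def Lp_norm_eq epowr_less_top flip: infinity_ennreal_def)
      finally show "Lint (enn2real p) (g \<sigma>) < \<infinity>" .
    next
      fix \<sigma> :: "nat^'d" and t :: 'd and \<psi> :: "real^'d \<Rightarrow> complex"
      assume \<sigma>: "\<sigma> $ t \<noteq> 0" "mdeg \<sigma> \<le> m" and eq: "\<forall>\<psi> :: real^'d \<Rightarrow> complex. mpower partial \<sigma> \<psi> = mpower partial (lower t \<sigma>) (partial t \<psi>)"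
        and \<psi>: "test_function \<psi>"
      note deg = mdeg_lower[of \<sigma> t, OF \<sigma>(1)]
      have low: "mdeg (lower t \<sigma>) \<le> m" using deg \<sigma>(2) by simp
      have LINT: "(LINT x|lebesgue. G \<tau> x * \<theta> x) = (LINT x|lborel. g \<tau> x * \<theta> x)" if "mdeg \<tau> \<le> m" "test_function \<theta>" for \<tau> \<theta>
      proof (rule LINT_lebesgue_eq)
        show "(\<lambda>x. g \<tau> x * \<theta> x) \<in> borel_measurable borel"
          using g(1)[OF that(1)] borel_measurable_test_function[OF that(2)] by measurable
        show "AE x in lborel. G \<tau> x * \<theta> x = g \<tau> x * \<theta> x"
          using g(2)[OF that(1)] by eventually_elim simp
      qed
      have "(-1) ^ mdeg \<sigma> * (LINT x|lborel. g \<sigma> x * \<psi> x) = (LINT x|lebesgue. f x * mpower partial \<sigma> \<psi> x)"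
        using G[OF \<sigma>(2)] \<psi> by (simp add: is_weak_deriv_def LINT[OF \<sigma>(2)])
      also have "\<dots> = (-1) ^ mdeg (lower t \<sigma>) * (LINT x|lborel. g (lower t \<sigma>) x * partial t \<psi> x)"
        using G[OF low] test_function_partial[OF \<psi>, of t] by (simp add: eq is_weak_deriv_def LINT[OF low])
      finally have parts: "(-1) ^ mdeg \<sigma> * (LINT x|lborel. g \<sigma> x * \<psi> x) =
          (-1) ^ mdeg (lower t \<sigma>) * (LINT x|lborel. g (lower t \<sigma>) x * partial t \<psi> x)" .
      show "(LINT x|lborel. g (lower t \<sigma>) x * partial t \<psi> x) = - (LINT x|lborel. g \<sigma> x * \<psi> x)"
      proof -
        have "(-1) ^ mdeg (lower t \<sigma>) * - (LINT x|lborel. g \<sigma> x * \<psi> x) =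
            (-1) ^ mdeg (lower t \<sigma>) * (LINT x|lborel. g (lower t \<sigma>) x * partial t \<psi> x)"
          using parts unfolding deg by simp
        then show ?thesis unfolding mult_cancel_left by simp
      qed
    qed
  qed
qed

lemma analysis_eq:
  fixes f f' \<phi> \<phi>' :: "real^'d \<Rightarrow> complex"
  assumes a: "a j = \<alpha> j *\<^sub>R mat 1" "\<alpha> j \<noteq> 0" and q: "enn2real (1 / q) = 1 - 1 / P"
    and \<phi>: "\<phi>' \<in> borel_measurable borel" "AE x in lborel. \<phi> x = \<phi>' x"
    and f: "f' \<in> borel_measurable borel" "AE x in lborel. f x = f' x"
  shows "analysis q a \<phi> f j = (\<lambda>k. of_real (\<bar>\<alpha> j\<bar> powr (CARD('d) * (1 - 1 / P))) * coef \<phi>' (\<alpha> j) f' k)"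
proof
  fix k
  define c where "c = \<bar>\<alpha> j\<bar> powr (CARD('d) * (1 - 1 / P))"
  have "\<alpha> j *\<^sub>R mat 1 = (matrix ((*\<^sub>R) (\<alpha> j)) :: real^'d^'d)"
    by (simp add: matrix_def mat_def vec_eq_iff axis_def)
  then have "det (a j) = \<alpha> j ^ CARD('d)" by (simp add: a)
  then have det: "\<bar>det (a j)\<bar> powr enn2real (1 / q) = c"
    using a(2) by (simp add: q c_def power_abs powr_powr flip: powr_realpow)
  have mult: "a j *v x = \<alpha> j *\<^sub>R x" for x by (simp add: a flip: scaleR_matrix_vector_assoc)
  have [measurable]: "\<phi>' \<in> borel_measurable borel" "f' \<in> borel_measurable borel" by fact+
  have "analysis q a \<phi> f j k = (LINT x|lborel. f' x * cnj (of_real c * \<phi>' (\<alpha> j *\<^sub>R x - lat k)))"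
    unfolding analysis_def pairing_def
  proof (rule LINT_lebesgue_eq)
    show "(\<lambda>x. f' x * cnj (of_real c * \<phi>' (\<alpha> j *\<^sub>R x - lat k))) \<in> borel_measurable borel" by measurable
    show "AE x in lborel. f x * cnj (affine q a \<phi> j k x) = f' x * cnj (of_real c * \<phi>' (\<alpha> j *\<^sub>R x - lat k))"
      using f(2) AE_lborel_affine[OF \<phi>(2) a(2), of "- lat k"]
      by eventually_elim (simp add: affine_def det mult)
  qed
  also have "\<dots> = (LINT x|lborel. of_real c * (f' x * cnj (\<phi>' (\<alpha> j *\<^sub>R x - lat k))))"
    by (simp add: mult_ac)
  also have "\<dots> = of_real c * coef \<phi>' (\<alpha> j) f' k"
    unfolding coef_def by (rule integral_mult_right_zero)
  finally show "analysis q a \<phi> f j k = of_real (\<bar>\<alpha> j\<bar> powr (CARD('d) * (1 - 1 / P))) * coef \<phi>' (\<alpha> j) f' k"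
    unfolding c_def .
qed

theorem corollary15:
  fixes \<alpha> :: "nat \<Rightarrow> real" and a :: "nat \<Rightarrow> real^'d^'d"
    and \<phi> :: "real^'d \<Rightarrow> complex" and p q :: ennreal and m :: nat
  assumes "\<And>j. j > 0 \<Longrightarrow> \<alpha> j \<noteq> 0"
    and "filterlim (\<lambda>j. \<bar>\<alpha> j\<bar>) at_top sequentially"
    and "\<And>j. j > 0 \<Longrightarrow> a j = \<alpha> j *\<^sub>R mat 1"
    and "1 \<le> p" and "p < \<infinity>" and "1 / p + 1 / q = 1"
    and "\<phi> \<in> Lp_space q"
    and "Lnorm lebesgue \<infinity> (periodization (emod \<phi>)) < \<infinity>"
    and "(LINT x|lebesgue. \<phi> x) = 1"
  shows "\<exists>C\<^sub>1 C\<^sub>2 :: real. C\<^sub>1 > 0 \<and> C\<^sub>2 > 0 \<and>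
    (\<forall>f \<in> Sobolev_space m p.
       Sobolev_norm m p f \<le> ennreal C\<^sub>1 * linf_w_norm m p \<alpha> (analysis q a \<phi> f) \<and>
       linf_w_norm m p \<alpha> (analysis q a \<phi> f) \<le> ennreal C\<^sub>2 * Sobolev_norm m p f)"
proof -
  note \<alpha> = assms(1,2) and a = assms(3)
  define P where "P = enn2real p"
  have p: "p = ennreal P" "p \<noteq> \<infinity>" using assms(5) by (auto simp: P_def)
  have P: "1 \<le> P" using assms(4) p by (metis P_def enn2real_1 enn2real_mono assms(5) infinity_ennreal_def)
  \<comment> \<open>For p = 1 the exponent q is infinite, and 1 / q = 0 fits the same
    formula.\<close>
  have q: "enn2real (1 / q) = 1 - 1 / P"
  proof -
    have "1 / p = ennreal (1 / P)" using P p(1) by (simp add: divide_ennreal flip: ennreal_1)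
    then have e: "ennreal (1 / P) + 1 / q = 1" using assms(6) by simp
    then have "1 / q \<noteq> \<infinity>" by (metis ennreal_add_eq_top ennreal_one_neq_top infinity_ennreal_def)
    then have "enn2real (ennreal (1 / P) + 1 / q) = 1 / P + enn2real (1 / q)"
      using P by (subst enn2real_plus) (auto simp: less_top)
    then show ?thesis using e by simp
  qed
  obtain B \<phi>' where \<phi>': "sampling_kernel B \<phi>'" "AE x in lborel. \<phi> x = \<phi>' x"
    using ex_sampling_kernel[of \<phi>] assms(7-9) by (auto simp: Lp_space_def)
  have B: "1 \<le> B" by (rule sampling_kernel_ge_1[OF \<phi>'(1)])
  \<comment> \<open>The kernels depend on \<open>\<phi>'\<close> and the multiindex, but neither on
    the scale nor on the function, and all have the bound \<open>B\<close>; this makes both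
    constants independent of \<open>f\<close>.\<close>
  obtain \<Phi> where \<Phi>: "\<And>\<rho>. sampling_kernel B (\<Phi> \<rho>)" and
    diff: "\<And>\<rho> \<alpha> g. \<alpha> \<noteq> 0 \<Longrightarrow> weak_family P (mdeg \<rho>) g \<Longrightarrow>
      mpower diff \<rho> (coef \<phi>' \<alpha> (g 0)) = (\<lambda>k. inverse (of_real \<alpha> ^ mdeg \<rho>) * coef (\<Phi> \<rho>) \<alpha> (g \<rho>) k)"
    using mpower_diff_coef[OF \<phi>'(1) P] by metis
  define N where "N = card {\<rho> :: nat^'d. mdeg \<rho> \<le> m}"
  have "0 \<in> {\<rho> :: nat^'d. mdeg \<rho> \<le> m}" by (simp add: mdeg_def)
  then have N: "N > 0" unfolding N_def by (metis card_gt_0_iff empty_iff finite_mdeg_le)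
  show ?thesis
  proof (intro exI conjI ballI)
    \<comment> \<open>Each of the \<open>N\<close> derivatives has norm at most 4 times the sequence
      norm, and \<open>B\<close> bounds the sampling operator of every kernel at every
      scale.\<close>
    show "4 * real N > 0" "B > 0" using N B by auto
    fix f :: "real^'d \<Rightarrow> complex" assume f: "f \<in> Sobolev_space m p"
    obtain g where g: "weak_family P m g" "AE x in lborel. f x = g 0 x"
      and norm: "\<And>\<rho>. mdeg \<rho> \<le> m \<Longrightarrow> Lp_norm p (weak_deriv \<rho> f) = Lp_norm p (g \<rho>)"
      using Sobolev_weak_family[OF f p(2)] unfolding P_def by metis
    have gm: "g \<rho> \<in> borel_measurable borel" "Lint P (g \<rho>) < \<infinity>" if "mdeg \<rho> \<le> m" for \<rho>
      using g(1) that by (auto simp: weak_family_def)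
    define S where "S j \<rho> = ennreal (\<bar>\<alpha> j\<bar> ^ mdeg \<rho>) * lp_norm p (mpower diff \<rho> (analysis q a \<phi> f j))" for j \<rho>
    \<comment> \<open>The weight |\<alpha>_j|^|\<rho>| cancels the factor \<open>b\<close> produced
      by the differences, which leaves the plain coefficient norm of the derivative
      \<open>g \<rho>\<close> for the kernel \<open>\<Phi> \<rho>\<close>.\<close>
    have S: "S j \<rho> = epowr (coef_sum P (\<Phi> \<rho>) (\<alpha> j) (g \<rho>)) (1 / P)" if j: "j > 0" and \<rho>: "mdeg \<rho> \<le> m" for j \<rho>
    proof -
      define c where "c = \<bar>\<alpha> j\<bar> powr (CARD('d) * (1 - 1 / P))"
      define b where "b = inverse (\<bar>\<alpha> j\<bar> ^ mdeg \<rho>)"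
      have b: "b > 0" using \<alpha>(1)[OF j] by (simp add: b_def)
      have "analysis q a \<phi> f j = (\<lambda>k. of_real c * coef \<phi>' (\<alpha> j) (g 0) k)"
        unfolding c_def
        by (rule analysis_eq[where \<alpha>=\<alpha> and a=a and j=j])
           (use a[OF j] \<alpha>(1)[OF j] q \<phi>' gm(1)[of 0] g(2) in \<open>auto simp: sampling_kernel_def mdeg_def\<close>)
      then have "mpower diff \<rho> (analysis q a \<phi> f j) = (\<lambda>k. of_real c * (inverse (of_real (\<alpha> j) ^ mdeg \<rho>) * coef (\<Phi> \<rho>) (\<alpha> j) (g \<rho>) k))"
        by (simp add: mpower_diff_cmult diff[OF \<alpha>(1)[OF j] weak_family_mono[OF g(1) \<rho>]])
      then have n: "norm (mpower diff \<rho> (analysis q a \<phi> f j) k) powr P = b powr P * (c * norm (coef (\<Phi> \<rho>) (\<alpha> j) (g \<rho>) k)) powr P" for k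
        by (simp add: norm_mult norm_inverse norm_power b_def c_def powr_mult mult_ac)
      have "(\<integral>\<^sup>+k. norm (mpower diff \<rho> (analysis q a \<phi> f j) k) powr P \<partial>count_space UNIV) = ennreal (b powr P) * coef_sum P (\<Phi> \<rho>) (\<alpha> j) (g \<rho>)"
        unfolding n coef_sum_def c_def[symmetric] by (simp add: ennreal_mult nn_integral_cmult)
      then have "lp_norm p (mpower diff \<rho> (analysis q a \<phi> f j)) = ennreal b * epowr (coef_sum P (\<Phi> \<rho>) (\<alpha> j) (g \<rho>)) (1 / P)"
        using b P by (simp add: lp_norm_eq[OF p(2)] epowr_cmult flip: P_def)
      moreover have "ennreal (\<bar>\<alpha> j\<bar> ^ mdeg \<rho>) * ennreal b = 1"
        using \<alpha>(1)[OF j] by (simp add: b_def flip: ennreal_mult)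
      ultimately show ?thesis unfolding S_def by (simp add: mult.assoc[symmetric])
    qed
    have L: "linf_w_norm m p \<alpha> (analysis q a \<phi> f) = (SUP j\<in>{0<..}. \<Sum>\<rho> | mdeg \<rho> \<le> m. S j \<rho>)"
      by (simp add: linf_w_norm_def S_def)
    have Lp: "Lp_norm p (g \<rho>) = epowr (Lint P (g \<rho>)) (1 / P)" for \<rho>
      by (simp add: Lp_norm_eq[OF p(2)] flip: P_def)
    show "Sobolev_norm m p f \<le> ennreal (4 * real N) * linf_w_norm m p \<alpha> (analysis q a \<phi> f)"
    proof -
      define T where "T = linf_w_norm m p \<alpha> (analysis q a \<phi> f)"
      have "Lp_norm p (weak_deriv \<rho> f) \<le> ennreal 4 * T" if \<rho>: "mdeg \<rho> \<le> m" for \<rho>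
      proof -
        \<comment> \<open>\<open>T\<close> is a supremum in the extended reals; \<open>epowr\<close>
          keeps the value infinity, so the argument does not depend on whether \<open>T\<close> is
          finite.\<close>
        have "coef_sum P (\<Phi> \<rho>) (\<alpha> j) (g \<rho>) \<le> epowr T P" if j: "j > 0" for j
        proof -
          have "S j \<rho> \<le> (\<Sum>\<rho> | mdeg \<rho> \<le> m. S j \<rho>)"
            by (rule member_le_sum) (use \<rho> in \<open>auto simp: finite_mdeg_le\<close>)
          also have "\<dots> \<le> T" unfolding T_def L using j by (intro SUP_upper) auto
          finally have "epowr (epowr (coef_sum P (\<Phi> \<rho>) (\<alpha> j) (g \<rho>)) (1 / P)) P \<le> epowr T P"
            using P by (intro epowr_mono) (auto simp: S[OF j \<rho>])
          then show ?thesis using P by (simp add: epowr_epowr)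
        qed
        then have "Lint P (g \<rho>) \<le> ennreal (4 powr P) * epowr T P"
          by (intro Lint_le_coef_sum[OF \<Phi> \<alpha> P gm[OF \<rho>]])
        then have "Lp_norm p (g \<rho>) \<le> epowr (ennreal (4 powr P) * epowr T P) (1 / P)"
          unfolding Lp using P by (intro epowr_mono) auto
        also have "\<dots> = ennreal 4 * T"
          using P epowr_epowr[of "1 / P" T] by (subst epowr_cmult) auto
        finally show ?thesis by (simp add: norm[OF \<rho>])
      qed
      then have "Sobolev_norm m p f \<le> (\<Sum>\<rho> | mdeg (\<rho> :: nat^'d) \<le> m. ennreal 4 * T)"
        unfolding Sobolev_norm_def by (intro sum_mono) auto
      also have "\<dots> = ennreal (4 * real N) * T"
        by (simp add: N_def ennreal_mult ennreal_of_nat_eq_real_of_nat mult_ac)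
      finally show ?thesis unfolding T_def .
    qed
    show "linf_w_norm m p \<alpha> (analysis q a \<phi> f) \<le> ennreal B * Sobolev_norm m p f"
      unfolding L
    proof (rule SUP_least)
      fix j :: nat assume "j \<in> {0<..}"
      then have j: "j > 0" by simp
      have "S j \<rho> \<le> ennreal B * Lp_norm p (weak_deriv \<rho> f)" if \<rho>: "mdeg \<rho> \<le> m" for \<rho>
      proof -
        have "S j \<rho> \<le> epowr (ennreal (B powr P) * Lint P (g \<rho>)) (1 / P)"
          unfolding S[OF j \<rho>] using P by (intro epowr_mono coef_sum_le[OF \<Phi> P \<alpha>(1)[OF j] gm[OF \<rho>]]) auto
        also have "\<dots> = ennreal B * Lp_norm p (weak_deriv \<rho> f)"
          using B P by (simp add: epowr_cmult norm[OF \<rho>] Lp)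
        finally show ?thesis .
      qed
      then have "(\<Sum>\<rho> | mdeg \<rho> \<le> m. S j \<rho>) \<le> (\<Sum>\<rho> | mdeg \<rho> \<le> m. ennreal B * Lp_norm p (weak_deriv \<rho> f))"
        by (intro sum_mono) auto
      then show "(\<Sum>\<rho> | mdeg \<rho> \<le> m. S j \<rho>) \<le> ennreal B * Sobolev_norm m p f"
        by (simp add: Sobolev_norm_def sum_distrib_left)
    qed
  qed
qed

end
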